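(* Let $(X,\mathcal B,\mu,\mathcal T)$ be a finitary factor of an iid system with factor map $\pi$ and coding radius $R$. Let $v\in C(X)$ with $\mathbb E_\mu[v]=0$. Suppose that there exist $p\ge d-1$ and $s>2d^2+d^2/(p+1)$ such that $v$ is $p$-regular and $\mathbb E[R^s]<\infty$. If $\sigma_v^2=\sum_{i\in\mathbb Z^d}\mathbb E_\mu[v\,(v\circ T^i)]$ is positive, then, as $n\to\infty$, $$n^{-d/2}W_n(v)\longrightarrow_w \sigma_v W,$$ where $W$ is a standard Brownian sheet on $[0,1]^d$, $\sigma_v=\sqrt{\sigma_v^2}$, and $\longrightarrow_w$ denotes weak convergence of probability measures (the laws of these random elements) on $\mathcal C([0,1]^d)$ with the supremum norm.
   Context: Let $A$ be a finite alphabet and $d$ a positive integer. The space $A^{\mathbb Z^d}$ carries the prodiscrete topology and the shift operators $(T^ix)_j=x_{i+j}$, $i,j\in\mathbb Z^d$; $\mathcal T=\{T^i\}_{i\in\mathbb Z^d}$. $X\subseteq A^{\mathbb Z^d}$ is a closed shift-invariant set (subshift), $\mathcal B$ its Borel $\sigma$-algebra, and $\mu$ a $\mathcal T$-invariant probability measure on $(X,\mathcal B)$. $C(X)$ is the space of continuous functions $X\to\mathbb R$, and $\mathbb E_\mu$ is expectation with respect to $\mu$. For $k\ge0$, $B_k=[-k,k]^d\cap\mathbb Z^d$. For bounded $v\colon X\to\mathbb R$, $\delta_k(v)=\sup\{|v(x)-v(x')|: x,x'\in X,\ x|_{B_k}=x'|_{B_k}\}$. For $p\ge0$, $v\in C(X)$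 is $p$-regular if $\sum_{k=1}^\infty k^p\delta_k(v)<\infty$. An iid system is a tuple $(\Lambda^{\mathbb Z^d},\mathcal F^{\otimes\mathbb Z^d},\mathbb P^{\mathbb Z^d},\mathcal S)$ where $(\Lambda,\mathcal F,\mathbb P)$ is a standard Borel probability space and $\mathcal S=\{S^i\}_{i\in\mathbb Z^d}$ is the group of shifts, $(S^iy)_j=y_{i+j}$. The system $(X,\mathcal B,\mu,\mathcal T)$ is a finitary factor of an iid system if there exist an iid system and a shift-invariant $G_\delta$ set $Y\subseteq\Lambda^{\mathbb Z^d}$ with $\mathbb P^{\mathbb Z^d}(Y)=1$ such that, with $\mathcal A$ the $\sigma$-algebra induced by $\mathcal F^{\otimes \mathbb Z^d}$ on $Y$: (I) there is an $\mathcal A$-measurable map $\pi\colon Y\to X$ (factor map) with $\pi_*(\mathbb P^{\mathbb Z^d}|_Y)=\mu$ and $T^i\circ\pi=\pi\circ S^i$ for all $i\in\mathbb Z^d$; (II) there is an $\mathcal A$-measurable function $R\colon Y\to\mathbb Z_{\ge0}$ (coding radius of $\pi$) such that whenever $y,y'\in Y$ satisfy $y|_{B_{R(y)}}=y'|_{B_{R(y)}}$, then $(\pi y)_{\mathbf 0}=(\pi y')_{\mathbf 0}$. $\mathbb E$ without subscript is expectation with respect to $\mathbb P^{\mathbb Z^d}$. The paper notes that under the hypotheses of the theorem the series defining $\sigma_v^2$ converges and is non-negative. For $t\in[0,1]^d$ let $A_t=\prod_{i=1}^d[0,t_i]$; for $i\in\mathbb Z^d$ let $Q_i=(i_1-1,i_1]\times\cdots\times(i_d-1,i_d]$;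 let $\lambda$ be Lebesgue measure on $\mathbb R^d$. The process $W_n(v)=\{W_{n,t}(v)\}_{t\in[0,1]^d}$ on $(X,\mathcal B,\mu)$ is $$W_{n,t}(v)=\sum_{i\in\{1,\dots,n\}^d}\lambda(nA_t\cap Q_i)\,(v\circ T^i).$$ A standard Brownian sheet on $[0,1]^d$ is a zero-mean Gaussian random field $W=\{W_t\}_{t\in[0,1]^d}$ with covariance $\mathbb E[W_sW_t]=\prod_{i=1}^d\min(s_i,t_i)$. $W_n(v)$ and $W$ are viewed as random elements of the space $\mathcal C([0,1]^d)$ of continuous functions with the supremum norm. *)

theory Defs
  imports "HOL-Probability.Probability"
begin

subsection \<open>Subshifts\<close>

text \<open>The lattice $\mathbb Z^d$ is the type \<^typ>\<open>int^'d\<close> with $d$ = \<open>CARD('d)\<close>. An alphabet with its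
  discrete topology is a type of class \<open>{finite, discrete_topology}\<close>, so the library topology on
  the function space is the prodiscrete one. The symbol space of an iid system is instead a
  measure with an explicit carrier; \<open>shift\<close> serves both.\<close>

definition shift :: "int^'d \<Rightarrow> (int^'d \<Rightarrow> 'b) \<Rightarrow> (int^'d \<Rightarrow> 'b)" where
  "shift i x = (\<lambda>j. x (i + j))"

definition shift_invariant :: "(int^'d \<Rightarrow> 'b) set \<Rightarrow> bool" where
  "shift_invariant X \<longleftrightarrow> (\<forall>i. shift i ` X = X)"

definition subshift :: "(int^'d \<Rightarrow> 'a::{finite, discrete_topology}) set \<Rightarrow> bool" where
  "subshift X \<longleftrightarrow> closed X \<and> shift_invariant X"

definition invariant_prob ::
    "(int^'d \<Rightarrow> 'a::{finite, discrete_topology}) set \<Rightarrow> (int^'d \<Rightarrow> 'a) measure \<Rightarrow> bool" where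
  "invariant_prob X \<mu> \<longleftrightarrow>
     prob_space \<mu> \<and> space \<mu> = X \<and> sets \<mu> = sets (restrict_space borel X) \<and>
     (\<forall>i. distr \<mu> \<mu> (shift i) = \<mu>)"

definition lattice_box :: "nat \<Rightarrow> (int^'d) set" where
  "lattice_box k = {j. \<forall>m. - int k \<le> j $ m \<and> j $ m \<le> int k}"

definition variation ::
    "(int^'d \<Rightarrow> 'a) set \<Rightarrow> nat \<Rightarrow> ((int^'d \<Rightarrow> 'a) \<Rightarrow> real) \<Rightarrow> real" where
  "variation X k v =
     Sup {\<bar>v x - v x'\<bar> | x x'. x \<in> X \<and> x' \<in> X \<and> (\<forall>j\<in>lattice_box k. x j = x' j)}"

text \<open>The defining series starts at $k = 1$.\<close>

definition p_regular ::
    "(int^'d \<Rightarrow> 'a) set \<Rightarrow> real \<Rightarrow> ((int^'d \<Rightarrow> 'a) \<Rightarrow> real) \<Rightarrow> bool" where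
  "p_regular X p v \<longleftrightarrow> summable (\<lambda>k. real (Suc k) powr p * variation X (Suc k) v)"


subsection \<open>Finitary factors of iid systems\<close>

definition borel_of :: "'b topology \<Rightarrow> 'b measure" where
  "borel_of T = sigma (topspace T) {U. openin T U}"

text \<open>A standard Borel probability space, together with a Polish topology generating its
  \<open>\<sigma>\<close>-algebra. The topology is kept as a parameter because the notion of a \<open>G\<^sub>\<delta>\<close> subset of the
  product space refers to it.\<close>

definition standard_borel_prob :: "'l topology \<Rightarrow> 'l measure \<Rightarrow> bool" where
  "standard_borel_prob \<tau> L \<longleftrightarrow>
     completely_metrizable_space \<tau> \<and> separable_space \<tau> \<and>
     space L = topspace \<tau> \<and> sets L = sets (borel_of \<tau>) \<and> prob_space L"

definition iid_measure :: "'l measure \<Rightarrow> (int^'d \<Rightarrow> 'l) measure" where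
  "iid_measure L = Pi\<^sub>M UNIV (\<lambda>_. L)"

definition finitary_factor ::
    "'l topology \<Rightarrow> 'l measure \<Rightarrow> (int^'d \<Rightarrow> 'l) set \<Rightarrow>
     (int^'d \<Rightarrow> 'a::{finite, discrete_topology}) measure \<Rightarrow>
     ((int^'d \<Rightarrow> 'l) \<Rightarrow> (int^'d \<Rightarrow> 'a)) \<Rightarrow> ((int^'d \<Rightarrow> 'l) \<Rightarrow> nat) \<Rightarrow> bool" where
  "finitary_factor \<tau> L Y \<mu> \<pi> R \<longleftrightarrow>
     standard_borel_prob \<tau> L \<and>
     shift_invariant Y \<and> gdelta_in (product_topology (\<lambda>_. \<tau>) UNIV) Y \<and>
     emeasure (iid_measure L) Y = 1 \<and>
     \<pi> \<in> measurable (restrict_space (iid_measure L) Y) \<mu> \<and>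
     distr (restrict_space (iid_measure L) Y) \<mu> \<pi> = \<mu> \<and>
     (\<forall>i. \<forall>y\<in>Y. shift i (\<pi> y) = \<pi> (shift i y)) \<and>
     R \<in> measurable (restrict_space (iid_measure L) Y) (count_space UNIV) \<and>
     (\<forall>y\<in>Y. \<forall>y'\<in>Y. (\<forall>j\<in>lattice_box (R y). y j = y' j) \<longrightarrow> \<pi> y 0 = \<pi> y' 0)"


subsection \<open>The partial-sum process\<close>

text \<open>An infinite sum that does not converge is 0 by convention, so positivity of \<open>asymp_var\<close>
  entails convergence.\<close>

definition asymp_var ::
    "(int^'d \<Rightarrow> 'a) measure \<Rightarrow> ((int^'d \<Rightarrow> 'a) \<Rightarrow> real) \<Rightarrow> real" where
  "asymp_var \<mu> v = infsum (\<lambda>i. \<integral>x. v x * v (shift i x) \<partial>\<mu>) UNIV"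

definition unit_cell :: "int^'d \<Rightarrow> (real^'d) set" where
  "unit_cell i = {x. \<forall>m. real_of_int (i $ m) - 1 < x $ m \<and> x $ m \<le> real_of_int (i $ m)}"

text \<open>Here \<open>cbox 0 t\<close> is $A_t = \prod_m [0, t_m]$.\<close>

definition W_proc ::
    "((int^'d \<Rightarrow> 'a) \<Rightarrow> real) \<Rightarrow> nat \<Rightarrow> real^'d \<Rightarrow> (int^'d \<Rightarrow> 'a) \<Rightarrow> real" where
  "W_proc v n t x =
     (\<Sum>i\<in>{i. \<forall>m. 1 \<le> i $ m \<and> i $ m \<le> int n}.
        measure lborel ((\<lambda>u. real n *\<^sub>R u) ` cbox 0 t \<inter> unit_cell i) * v (shift i x))"


subsection \<open>Brownian sheet\<close>

text \<open>Constants count as (degenerate) Gaussian variables.\<close>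

definition gaussian_rv :: "'w measure \<Rightarrow> ('w \<Rightarrow> real) \<Rightarrow> bool" where
  "gaussian_rv N Z \<longleftrightarrow> Z \<in> borel_measurable N \<and>
     ((\<exists>m s. 0 < s \<and> distributed N lborel Z (normal_density m s)) \<or> (\<exists>m. AE w in N. Z w = m))"

definition gaussian_field :: "'w measure \<Rightarrow> 't set \<Rightarrow> ('t \<Rightarrow> 'w \<Rightarrow> real) \<Rightarrow> bool" where
  "gaussian_field N I W \<longleftrightarrow>
     (\<forall>F c. finite F \<and> F \<subseteq> I \<longrightarrow> gaussian_rv N (\<lambda>w. \<Sum>t\<in>F. c t * W t w))"

abbreviation unit_cube :: "(real^'d) set" where
  "unit_cube \<equiv> cbox 0 1"

text \<open>Continuity of the sample paths makes the field a random element of \<open>C([0,1]\<^sup>d)\<close>.\<close>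

definition brownian_sheet :: "'w measure \<Rightarrow> (real^'d \<Rightarrow> 'w \<Rightarrow> real) \<Rightarrow> bool" where
  "brownian_sheet N W \<longleftrightarrow>
     prob_space N \<and> gaussian_field N unit_cube W \<and>
     (\<forall>t\<in>unit_cube. (\<integral>w. W t w \<partial>N) = 0) \<and>
     (\<forall>s\<in>unit_cube. \<forall>t\<in>unit_cube. (\<integral>w. W s w * W t w \<partial>N) = (\<Prod>m\<in>UNIV. min (s $ m) (t $ m))) \<and>
     (\<forall>w\<in>space N. continuous_on unit_cube (\<lambda>t. W t w))"


subsection \<open>Weak convergence on the space of continuous functions\<close>

text \<open>\<open>C([0,1]\<^sup>d)\<close> with the topology of the supremum metric. Its elements are functions on
  \<^typ>\<open>real^'d\<close> that are \<open>undefined\<close> off the cube, whence the restriction in \<open>path_of\<close>.\<close>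

definition C_cube :: "(real^'d \<Rightarrow> real) topology" where
  "C_cube = mtopology_of (cfunspace (top_of_set unit_cube) euclidean_metric)"

definition path_of :: "(real^'d \<Rightarrow> 'w \<Rightarrow> real) \<Rightarrow> 'w \<Rightarrow> (real^'d \<Rightarrow> real)" where
  "path_of Z w = restrict (\<lambda>t. Z t w) unit_cube"

definition weak_conv_on :: "'b topology \<Rightarrow> (nat \<Rightarrow> 'b measure) \<Rightarrow> 'b measure \<Rightarrow> bool" where
  "weak_conv_on T P Q \<longleftrightarrow>
     (\<forall>f. continuous_map T euclideanreal f \<and> bounded (f ` topspace T) \<longrightarrow>
        (\<lambda>n. \<integral>x. f x \<partial>(P n)) \<longlonglongrightarrow> (\<integral>x. f x \<partial>Q))"

text \<open>Weak convergence of the laws of random elements. That the maps are Borel measurable, i.e.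
  are random elements, is part of the claim.\<close>

definition conv_in_law ::
    "'b topology \<Rightarrow> 'x measure \<Rightarrow> (nat \<Rightarrow> 'x \<Rightarrow> 'b) \<Rightarrow> 'w measure \<Rightarrow> ('w \<Rightarrow> 'b) \<Rightarrow> bool" where
  "conv_in_law T M Z N Z' \<longleftrightarrow>
     (\<forall>n. Z n \<in> measurable M (borel_of T)) \<and> Z' \<in> measurable N (borel_of T) \<and>
     weak_conv_on T (\<lambda>n. distr M (borel_of T) (Z n)) (distr N (borel_of T) Z')"

end

theory Submission
  imports Defs
begin

text \<open>Let $Z$ be the observable $v \circ \pi$ on the iid system and $T_l$ its conditional expectation given
  the coordinates in a box of radius of order $2^l$. Choosing inside this box a window of radius
  $2^{al}$, $a = d/(p+1)$, on which the coding radius is at most $2^l$ with high probability,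
  regularity and the moment of $R$ give $\|Z - T_l\|_{4d} = O(2^{-\gamma l})$ for some $\gamma > d/2$. The
  increment $T_{l+1} - T_l$ is a local field; splitting the lattice into residue classes makes it a
  sum of independent variables, so that its weighted sums have $L^{4d}$ norm
  $O(2^{dl/2}\,2^{-\gamma l}\,(\sum_i a_i^2)^{1/2})$. Summing over $l$ yields the moment inequality
  $\|\sum_i a_i Z_i\|_{4d} \le K (\sum_i a_i^2)^{1/2}$, and the same estimate for the tail reduces the
  central limit theorem for weighted sums to the local field $T_l$, where Stein's method gives a
  differential equation for the characteristic function. As $4d > 2d$, chaining along dyadic grids
  controls the modulus of continuity of $W_n(v)$ uniformly in $n$, so that it is enough to treat
  multilinear interpolations and Lipschitz functionals; these depend on finitely many points.\<close>

subsection \<open>Moments of bounded random variables\<close>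

text \<open>The moment q = 4d is constrained from several sides. It is even, for the binomial
  expansion, and exceeds 2d, so that the 2^(d j) dyadic edges of level j, with increments of order
  2^(-j/2), can be controlled together. It also explains the moment hypothesis: a window of order
  2^(a d l) sites contains a site of coding radius above 2^l with probability O(2^((a d - s) l)),
  and the q-th root of this decays faster than 2^(-d l / 2) exactly when s > a d + q d / 2 =
  d^2/(p+1) + 2 d^2. The regularity error 2^(-a (p+1) l) = 2^(-d l) is then harmless, and p \<ge> d
  - 1 says a \<le> 1, so that the window fits into the box. The obstacle behind all this is that no
  finite box determines the observable: a local field of radius 2^l pays a factor 2^(d l / 2) for
  its dependence, and the rate of approximation has to win against it. On the side of the process
  all variables are bounded, and real cosines with a phase stand for characteristic functions. No
  compactness of laws is invoked: the L^1 size of the interpolation error is bounded uniformly in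
  n.\<close>

lemma power_le_affine:
  fixes u :: real
  assumes "0 \<le> u" "k \<le> n" "0 < n"
  shows "u ^ k \<le> (real k / real n) * u ^ n + (1 - real k / real n)"
proof (cases "u = 0")
  case True
  then show ?thesis using assms by (cases "k = 0") (auto simp: power_0_left divide_simps)
next
  case False
  then have u: "u > 0" using assms by simp
  define t where "t = real k / real n"
  have t: "0 \<le> t" "t \<le> 1" using assms by (auto simp: t_def)
  have "exp ((1 - t) *\<^sub>R 0 + t *\<^sub>R (real n * ln u)) \<le> (1 - t) * exp 0 + t * exp (real n * ln u)"
    using t by (intro convex_onD[OF exp_convex]) auto
  moreover have "t * (real n * ln u) = real k * ln u"
    using assms by (simp add: t_def)
  moreover have "exp (real k * ln u) = u ^ k" "exp (real n * ln u) = u ^ n"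
    using u by (simp_all add: exp_of_nat_mult)
  ultimately show ?thesis by (simp add: t_def algebra_simps)
qed

lemma convex_power_nonneg: "convex_on {0::real..} (\<lambda>x. x ^ n)"
proof (cases "even n")
  case True
  show ?thesis by (rule convex_on_subset[OF convex_power_even[OF True]]) (auto intro: convex_real_interval)
next
  case False
  then show ?thesis by (rule convex_power_odd)
qed

text \<open>Allows a norm bound A to be enlarged to A + e > 0, so that one may divide by it; the
  case A = 0 then comes from the limit e to 0. The slack e can also absorb a vanishing
  remainder.\<close>

lemma le_power_if_le_add_eps:
  fixes x A :: real
  assumes "0 \<le> A" "\<And>e. 0 < e \<Longrightarrow> x \<le> (A + e) ^ k"
  shows "x \<le> A ^ k"
proof (rule tendsto_lowerbound[where F = "at_right (0::real)"])
  have "((\<lambda>e. (A + e) ^ k) \<longlongrightarrow> (A + 0) ^ k) (at_right 0)"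
    by (intro tendsto_intros)
  then show "((\<lambda>e. (A + e) ^ k) \<longlongrightarrow> A ^ k) (at_right 0)" by simp
  show "\<forall>\<^sub>F e in at_right 0. x \<le> (A + e) ^ k"
    using assms(2) by (auto simp: eventually_at_right_field intro: exI[of _ 1])
qed auto

text \<open>Bounded at every point of the space, not merely almost everywhere. Sums, products,
  powers and compositions then stay in the class by pointwise arguments, and on a probability space
  integrability is automatic.\<close>

definition brv :: "'x measure \<Rightarrow> ('x \<Rightarrow> real) \<Rightarrow> bool" where
  "brv M f \<longleftrightarrow> f \<in> borel_measurable M \<and> (\<exists>D. \<forall>x\<in>space M. \<bar>f x\<bar> \<le> D)"

lemma brvI: "f \<in> borel_measurable M \<Longrightarrow> (\<And>x. x \<in> space M \<Longrightarrow> \<bar>f x\<bar> \<le> D) \<Longrightarrow> brv M f"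
  by (auto simp: brv_def)

lemma brv_measurable[measurable_dest]: "brv M f \<Longrightarrow> f \<in> borel_measurable M"
  by (simp add: brv_def)

lemma brv_const[simp]: "brv M (\<lambda>_. c)"
  by (auto simp: brv_def)

lemma brvE:
  assumes "brv M f" obtains D where "0 \<le> D" "\<And>x. x \<in> space M \<Longrightarrow> \<bar>f x\<bar> \<le> D"
proof -
  obtain D where D: "\<And>x. x \<in> space M \<Longrightarrow> \<bar>f x\<bar> \<le> D" using assms by (auto simp: brv_def)
  show thesis
    by (rule that[of "max 0 D"]) (auto intro: max.coboundedI2 D)
qed

lemma brv_add: assumes "brv M f" "brv M g" shows "brv M (\<lambda>x. f x + g x)"
proof -
  obtain C where C: "0 \<le> C" "\<And>x. x \<in> space M \<Longrightarrow> \<bar>f x\<bar> \<le> C" using brvE[OF assms(1)] by blast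
  obtain D where D: "0 \<le> D" "\<And>x. x \<in> space M \<Longrightarrow> \<bar>g x\<bar> \<le> D" using brvE[OF assms(2)] by blast
  show ?thesis
  proof (rule brvI)
    show "(\<lambda>x. f x + g x) \<in> borel_measurable M"
      using assms[THEN brv_measurable] by measurable
    fix x assume x: "x \<in> space M"
    show "\<bar>f x + g x\<bar> \<le> C + D" using C(2)[OF x] D(2)[OF x] by linarith
  qed
qed

lemma brv_mult: assumes "brv M f" "brv M g" shows "brv M (\<lambda>x. f x * g x)"
proof -
  obtain C where C: "0 \<le> C" "\<And>x. x \<in> space M \<Longrightarrow> \<bar>f x\<bar> \<le> C" using brvE[OF assms(1)] by blast
  obtain D where D: "0 \<le> D" "\<And>x. x \<in> space M \<Longrightarrow> \<bar>g x\<bar> \<le> D" using brvE[OF assms(2)] by blast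
  have "\<bar>f x * g x\<bar> \<le> C * D" if "x \<in> space M" for x
    unfolding abs_mult by (rule mult_mono[OF C(2) D(2)]) (use that C in auto)
  then show ?thesis
    using assms[THEN brv_measurable] by (intro brvI[where D = "C * D"]) measurable
qed

lemma brv_minus: "brv M f \<Longrightarrow> brv M (\<lambda>x. - f x)"
  unfolding brv_def by auto

lemma brv_diff: "brv M f \<Longrightarrow> brv M g \<Longrightarrow> brv M (\<lambda>x. f x - g x)"
  using brv_add[of M f "\<lambda>x. - g x"] by (simp add: brv_minus)

lemma brv_abs: "brv M f \<Longrightarrow> brv M (\<lambda>x. \<bar>f x\<bar>)"
  by (auto simp: brv_def)

lemma brv_power: "brv M f \<Longrightarrow> brv M (\<lambda>x. f x ^ n)"
  by (induction n) (simp_all add: brv_mult)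

lemma brv_sum: "(\<And>i. i \<in> I \<Longrightarrow> brv M (f i)) \<Longrightarrow> brv M (\<lambda>x. \<Sum>i\<in>I. f i x)"
  by (induction I rule: infinite_finite_induct) (simp_all add: brv_add)

lemma brv_divide: "brv M f \<Longrightarrow> brv M (\<lambda>x. f x / c)"
  using brv_mult[OF _ brv_const, of M f "inverse c"] by (simp add: divide_inverse)

lemma brv_cos: "brv M f \<Longrightarrow> brv M (\<lambda>x. cos (f x))"
  by (rule brvI[where D = 1]) (simp_all add: brv_measurable)

lemma brv_sin: "brv M f \<Longrightarrow> brv M (\<lambda>x. sin (f x))"
  by (rule brvI[where D = 1]) (simp_all add: brv_measurable)

lemma brv_compose:
  assumes "brv N f" "g \<in> measurable M N" shows "brv M (\<lambda>x. f (g x))"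
proof -
  obtain D where "\<And>x. x \<in> space N \<Longrightarrow> \<bar>f x\<bar> \<le> D" using assms(1) by (auto simp: brv_def)
  then show ?thesis
    by (intro brvI[where D = D] measurable_compose[OF assms(2) brv_measurable[OF assms(1)]])
      (simp add: measurable_space[OF assms(2)])
qed

lemmas brvs = brv_const brv_add brv_mult brv_minus brv_diff brv_abs brv_power brv_sum brv_divide
  brv_cos brv_sin

section \<open>Comparison of moments and Minkowski's inequality, in power form\<close>

context prob_space
begin

lemma brv_integrable: "brv M f \<Longrightarrow> integrable M f"
proof -
  assume f: "brv M f"
  then obtain D where "\<And>x. x \<in> space M \<Longrightarrow> \<bar>f x\<bar> \<le> D" by (auto simp: brv_def)
  then show ?thesis
    by (intro integrable_const_bound[of f D] brv_measurable[OF f] AE_I2) simp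
qed

text \<open>Monotonicity of L^p norms. Norm estimates are kept in the form "the integral of |f|^n is
  at most A^n", which avoids n-th roots. After division by A the affine bound
  \<open>power_le_affine\<close>, an instance of weighted AM-GM, integrates to 1.\<close>

lemma integral_abs_power_le_of_higher:
  assumes f: "brv M f" and k: "k \<le> n" and A: "0 \<le> A" and le: "(\<integral>x. \<bar>f x\<bar> ^ n \<partial>M) \<le> A ^ n"
  shows "(\<integral>x. \<bar>f x\<bar> ^ k \<partial>M) \<le> A ^ k"
proof (cases "n = 0")
  case True
  then show ?thesis using k by (simp add: prob_space)
next
  case n: False
  show ?thesis
  proof (rule le_power_if_le_add_eps[OF A])
    fix e :: real assume "0 < e"
    define B where "B = A + e"
    have B: "B > 0" using A \<open>0 < e\<close> by (simp add: B_def)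
    have "(\<integral>x. (\<bar>f x\<bar> / B) ^ k \<partial>M) \<le>
        (\<integral>x. (real k / real n) * (\<bar>f x\<bar> / B) ^ n + (1 - real k / real n) \<partial>M)"
      using n k B by (intro integral_mono brv_integrable brvs f power_le_affine) auto
    also have "\<dots> = (real k / real n) * (\<integral>x. (\<bar>f x\<bar> / B) ^ n \<partial>M) + (1 - real k / real n)"
      by (subst Bochner_Integration.integral_add) (auto simp: prob_space intro!: brv_integrable brvs f)
    also have "\<dots> \<le> (real k / real n) * 1 + (1 - real k / real n)"
    proof (intro add_mono mult_left_mono)
      have "(\<integral>x. (\<bar>f x\<bar> / B) ^ n \<partial>M) = (\<integral>x. \<bar>f x\<bar> ^ n \<partial>M) / B ^ n"
        by (simp add: power_divide)
      also have "\<dots> \<le> A ^ n / B ^ n"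
        using le B by (intro divide_right_mono) auto
      also have "\<dots> \<le> 1"
        using A B \<open>0 < e\<close> by (auto simp: B_def intro!: power_mono)
      finally show "(\<integral>x. (\<bar>f x\<bar> / B) ^ n \<partial>M) \<le> 1" .
    qed auto
    finally have "(\<integral>x. (\<bar>f x\<bar> / B) ^ k \<partial>M) \<le> 1"
      by simp
    then show "(\<integral>x. \<bar>f x\<bar> ^ k \<partial>M) \<le> (A + e) ^ k"
      using B by (simp add: power_divide B_def[symmetric] divide_le_eq)
  qed
qed

text \<open>(|f| + |g|)/(C + D) is the convex combination of |f|/C and |g|/D with weights C/(C+D)
  and D/(C+D). Convexity of the n-th power bounds its n-th moment by 1, because each of the two
  quotients has n-th moment at most 1.\<close>

lemma Minkowski_brv:
  assumes f: "brv M f" and g: "brv M g" and A: "0 \<le> A" "0 \<le> B"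
    and le: "(\<integral>x. \<bar>f x\<bar> ^ n \<partial>M) \<le> A ^ n" "(\<integral>x. \<bar>g x\<bar> ^ n \<partial>M) \<le> B ^ n"
  shows "(\<integral>x. \<bar>f x + g x\<bar> ^ n \<partial>M) \<le> (A + B) ^ n"
proof (rule le_power_if_le_add_eps)
  fix e :: real assume "0 < e"
  define C where "C = A + e / 2"
  define D where "D = B + e / 2"
  have C: "C > 0" "D > 0" using A \<open>0 < e\<close> by (auto simp: C_def D_def)
  define t where "t = D / (C + D)"
  have t: "0 \<le> t" "t \<le> 1" "1 - t = C / (C + D)" using C by (auto simp: t_def field_simps)
  have "\<bar>f x + g x\<bar> ^ n \<le> (C + D) ^ n * ((1 - t) * (\<bar>f x\<bar> / C) ^ n + t * (\<bar>g x\<bar> / D) ^ n)" for x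
  proof -
    have "((1 - t) *\<^sub>R (\<bar>f x\<bar> / C) + t *\<^sub>R (\<bar>g x\<bar> / D)) ^ n
        \<le> (1 - t) * (\<bar>f x\<bar> / C) ^ n + t * (\<bar>g x\<bar> / D) ^ n"
      using t C by (intro convex_onD[OF convex_power_nonneg]) auto
    moreover have "(1 - t) *\<^sub>R (\<bar>f x\<bar> / C) + t *\<^sub>R (\<bar>g x\<bar> / D) = (\<bar>f x\<bar> + \<bar>g x\<bar>) / (C + D)"
      unfolding t(3) using C by (simp add: t_def add_divide_distrib)
    ultimately have "((\<bar>f x\<bar> + \<bar>g x\<bar>) / (C + D)) ^ n \<le> (1 - t) * (\<bar>f x\<bar> / C) ^ n + t * (\<bar>g x\<bar> / D) ^ n"
      by simp
    then have "(\<bar>f x\<bar> + \<bar>g x\<bar>) ^ n \<le> (C + D) ^ n * ((1 - t) * (\<bar>f x\<bar> / C) ^ n + t * (\<bar>g x\<bar> / D) ^ n)"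
      using C by (simp add: power_divide field_simps)
    moreover have "\<bar>f x + g x\<bar> ^ n \<le> (\<bar>f x\<bar> + \<bar>g x\<bar>) ^ n"
      by (intro power_mono) auto
    ultimately show ?thesis by simp
  qed
  then have "(\<integral>x. \<bar>f x + g x\<bar> ^ n \<partial>M)
      \<le> (\<integral>x. (C + D) ^ n * ((1 - t) * (\<bar>f x\<bar> / C) ^ n + t * (\<bar>g x\<bar> / D) ^ n) \<partial>M)"
    using f g by (intro integral_mono brv_integrable brvs) auto
  also have "\<dots> = (C + D) ^ n * ((1 - t) * ((\<integral>x. \<bar>f x\<bar> ^ n \<partial>M) / C ^ n) + t * ((\<integral>x. \<bar>g x\<bar> ^ n \<partial>M) / D ^ n))"
    by (simp only: integral_mult_right_zero, subst Bochner_Integration.integral_add)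
      (auto intro!: brv_integrable brvs f g simp: power_divide)
  also have "\<dots> \<le> (C + D) ^ n * ((1 - t) * 1 + t * 1)"
  proof -
    have "(\<integral>x. \<bar>f x\<bar> ^ n \<partial>M) \<le> C ^ n" "(\<integral>x. \<bar>g x\<bar> ^ n \<partial>M) \<le> D ^ n"
      using le A \<open>0 < e\<close> power_mono[of A C n] power_mono[of B D n] by (auto simp: C_def D_def)
    then show ?thesis using C t(1,2)
      by (intro mult_left_mono add_mono) (auto simp: divide_le_eq)
  qed
  finally show "(\<integral>x. \<bar>f x + g x\<bar> ^ n \<partial>M) \<le> (A + B + e) ^ n"
    by (simp add: C_def D_def algebra_simps)
qed (use A in auto)

lemma Minkowski_brv_sum:
  assumes "finite I" "0 < n" "\<And>i. i \<in> I \<Longrightarrow> brv M (f i)" "\<And>i. i \<in> I \<Longrightarrow> 0 \<le> A i"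
    and "\<And>i. i \<in> I \<Longrightarrow> (\<integral>x. \<bar>f i x\<bar> ^ n \<partial>M) \<le> A i ^ n"
  shows "(\<integral>x. \<bar>\<Sum>i\<in>I. f i x\<bar> ^ n \<partial>M) \<le> (\<Sum>i\<in>I. A i) ^ n"
  using assms
proof (induction I rule: finite_induct)
  case empty
  then show ?case by (simp add: power_0_left)
next
  case (insert i I)
  then have "(\<integral>x. \<bar>f i x + (\<Sum>i\<in>I. f i x)\<bar> ^ n \<partial>M) \<le> (A i + (\<Sum>i\<in>I. A i)) ^ n"
    by (intro Minkowski_brv brv_sum sum_nonneg) auto
  then show ?case using insert by simp
qed

end

text \<open>Every term with j \<ge> 2 contains B^2; the other factors are at most m^(2h-2) with m =
  max A B, and the binomial coefficients sum to at most 4^h. For B \<le> A one factor A^2 + 4^h B^2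
  splits off; otherwise superadditivity of the h-th power applies. The right-hand side makes squared
  norms add up, as variances do.\<close>

lemma binomial_tail_le:
  fixes A B :: real
  assumes "0 \<le> A" "0 \<le> B" "1 \<le> h"
  shows "A ^ (2*h) + (\<Sum>j=2..2*h. real ((2*h) choose j) * (B ^ j * A ^ (2*h - j))) \<le> (A\<^sup>2 + 4 ^ h * B\<^sup>2) ^ h"
proof -
  define m where "m = max A B"
  have m: "A \<le> m" "B \<le> m" "0 \<le> m" using assms by (auto simp: m_def)
  have tm: "B ^ j * A ^ (2*h - j) \<le> B\<^sup>2 * m ^ (2*h - 2)" if "j \<in> {2..2*h}" for j
  proof -
    have "B ^ j = B\<^sup>2 * B ^ (j - 2)"
      using that by (metis atLeastAtMost_iff le_add_diff_inverse power_add)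
    then have "B ^ j * A ^ (2*h - j) = B\<^sup>2 * (B ^ (j - 2) * A ^ (2*h - j))"
      by simp
    also have "\<dots> \<le> B\<^sup>2 * (m ^ (j - 2) * m ^ (2*h - j))"
      using assms m by (intro mult_left_mono mult_mono power_mono) auto
    also have "m ^ (j - 2) * m ^ (2*h - j) = m ^ (2*h - 2)"
      using that by (simp add: power_add[symmetric])
    finally show ?thesis .
  qed
  have "(\<Sum>j=2..2*h. real ((2*h) choose j) * (B ^ j * A ^ (2*h - j)))
      \<le> (\<Sum>j=2..2*h. real ((2*h) choose j) * (B\<^sup>2 * m ^ (2*h - 2)))"
    by (intro sum_mono mult_left_mono tm) auto
  also have "\<dots> = (\<Sum>j=2..2*h. real ((2*h) choose j)) * (B\<^sup>2 * m ^ (2*h - 2))"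
    by (simp add: sum_distrib_right)
  also have "\<dots> \<le> (\<Sum>j\<le>2*h. real ((2*h) choose j)) * (B\<^sup>2 * m ^ (2*h - 2))"
    using m by (intro mult_right_mono sum_mono2) auto
  also have "(\<Sum>j\<le>2*h. real ((2*h) choose j)) = real (\<Sum>j\<le>2*h. (2*h) choose j)"
    by simp
  also have "\<dots> = 4 ^ h" by (simp only: choose_row_sum) (simp add: power_mult)
  finally have 1: "(\<Sum>j=2..2*h. real ((2*h) choose j) * (B ^ j * A ^ (2*h - j))) \<le> 4 ^ h * (B\<^sup>2 * m ^ (2*h - 2))" .
  have sq: "A ^ (2*h) = (A\<^sup>2) ^ h" by (simp add: power_mult)
  show ?thesis
  proof (cases "B \<le> A")
    case True
    then have "m = A" by (simp add: m_def)
    have "(A\<^sup>2) ^ h + 4 ^ h * B\<^sup>2 * (A\<^sup>2) ^ (h - 1) = (A\<^sup>2 + 4 ^ h * B\<^sup>2) * (A\<^sup>2) ^ (h - 1)"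
      using assms by (cases h) (auto simp: algebra_simps)
    also have "\<dots> \<le> (A\<^sup>2 + 4 ^ h * B\<^sup>2) * (A\<^sup>2 + 4 ^ h * B\<^sup>2) ^ (h - 1)"
      by (intro mult_left_mono power_mono) auto
    also have "\<dots> = (A\<^sup>2 + 4 ^ h * B\<^sup>2) ^ h"
      using assms by (cases h) auto
    finally have "(A\<^sup>2) ^ h + 4 ^ h * B\<^sup>2 * (A\<^sup>2) ^ (h - 1) \<le> (A\<^sup>2 + 4 ^ h * B\<^sup>2) ^ h" .
    moreover have "A ^ (2*h - 2) = (A\<^sup>2) ^ (h - 1)"
      using assms by (simp add: power_mult[symmetric] diff_mult_distrib2)
    ultimately show ?thesis using 1 unfolding \<open>m = A\<close> by (simp add: sq mult.assoc)
  next
    case False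
    then have "m = B" by (simp add: m_def)
    have e: "B\<^sup>2 * B ^ (2*h - 2) = (B\<^sup>2) ^ h"
    proof -
      have "B\<^sup>2 * B ^ (2*h - 2) = B ^ (2 + (2*h - 2))" by (simp only: power_add)
      also have "2 + (2*h - 2) = 2*h" using assms by simp
      finally show ?thesis by (simp only: power_mult)
    qed
    \<comment> \<open>Raises the constant from 4^h to (4^h)^h, so that the sum has the form x^h +
      y^h.\<close>
    have "(4::real) ^ h \<le> (4 ^ h) ^ h"
      using assms power_increasing[of 1 h "(4::real)^h"] by simp
    then have "4 ^ h * (B\<^sup>2) ^ h \<le> (4 ^ h * B\<^sup>2) ^ h"
      by (simp add: power_mult_distrib mult_right_mono)
    moreover have "x ^ k + y ^ k \<le> (x + y) ^ k" if "0 \<le> x" "0 \<le> y" "1 \<le> k" for x y :: real and k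
      using that(3)
    proof (induction k rule: dec_induct)
      case (step k)
      have "x ^ Suc k + y ^ Suc k \<le> (x + y) * (x ^ k + y ^ k)"
        using that by (simp add: algebra_simps)
      also have "\<dots> \<le> (x + y) * (x + y) ^ k"
        using that step by (intro mult_left_mono) auto
      finally show ?case by simp
    qed simp
    from this[of "A\<^sup>2" "4 ^ h * B\<^sup>2" h] have "(A\<^sup>2) ^ h + (4 ^ h * B\<^sup>2) ^ h \<le> (A\<^sup>2 + 4 ^ h * B\<^sup>2) ^ h"
      using assms by auto
    ultimately show ?thesis using 1 unfolding \<open>m = B\<close> e by (simp add: sq)
  qed
qed

text \<open>Expand the binomial: by independence and centering, the linear term vanishes.\<close>

lemma (in prob_space) even_moment_add_indep:
  assumes S: "brv M S" and X: "brv M X" and A: "0 \<le> A" "0 \<le> B" and h: "1 \<le> h"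
    and le: "(\<integral>x. \<bar>S x\<bar> ^ (2*h) \<partial>M) \<le> A ^ (2*h)" "(\<integral>x. \<bar>X x\<bar> ^ (2*h) \<partial>M) \<le> B ^ (2*h)"
    and mean: "(\<integral>x. X x \<partial>M) = 0"
    and indep: "\<And>j k. (\<integral>x. X x ^ j * S x ^ k \<partial>M) = (\<integral>x. X x ^ j \<partial>M) * (\<integral>x. S x ^ k \<partial>M)"
  shows "(\<integral>x. \<bar>S x + X x\<bar> ^ (2*h) \<partial>M) \<le> (sqrt (A\<^sup>2 + 4 ^ h * B\<^sup>2)) ^ (2*h)"
proof -
  have abs_even: "\<bar>x\<bar> ^ (2*h) = x ^ (2*h)" for x :: real
    by (simp add: power_even_abs)
  have "(\<integral>x. (S x + X x) ^ (2*h) \<partial>M) =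
      (\<integral>x. (\<Sum>j\<le>2*h. real ((2*h) choose j) * (X x ^ j * S x ^ (2*h - j))) \<partial>M)"
    by (intro Bochner_Integration.integral_cong refl, subst add.commute) (simp add: binomial_ring mult.assoc)
  also have "\<dots> = (\<Sum>j\<le>2*h. real ((2*h) choose j) * (\<integral>x. X x ^ j * S x ^ (2*h - j) \<partial>M))"
    by (subst Bochner_Integration.integral_sum) (auto intro!: brv_integrable brvs S X)
  also have "\<dots> = (\<Sum>j\<le>2*h. real ((2*h) choose j) * ((\<integral>x. X x ^ j \<partial>M) * (\<integral>x. S x ^ (2*h - j) \<partial>M)))"
    by (simp add: indep)
  also have "{..2*h} = insert 0 (insert 1 {2..2*h})" using h by auto
  also have "(\<Sum>j\<in>\<dots>. real ((2*h) choose j) * ((\<integral>x. X x ^ j \<partial>M) * (\<integral>x. S x ^ (2*h - j) \<partial>M)))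
     = (\<integral>x. S x ^ (2*h) \<partial>M) + (\<Sum>j=2..2*h. real ((2*h) choose j) * ((\<integral>x. X x ^ j \<partial>M) * (\<integral>x. S x ^ (2*h - j) \<partial>M)))"
    by (simp add: mean prob_space)
  also have "\<dots> \<le> A ^ (2*h) + (\<Sum>j=2..2*h. real ((2*h) choose j) * (B ^ j * A ^ (2*h - j)))"
  proof (intro add_mono sum_mono mult_left_mono)
    show "(\<integral>x. S x ^ (2*h) \<partial>M) \<le> A ^ (2*h)" using le(1) by (simp add: abs_even)
    fix j assume j: "j \<in> {2..2*h}"
    have abs_moment: "\<bar>\<integral>x. f x ^ k \<partial>M\<bar> \<le> (\<integral>x. \<bar>f x\<bar> ^ k \<partial>M)" for f :: "'a \<Rightarrow> real" and k
      using integral_abs_bound[of M "\<lambda>x. f x ^ k"] by (simp only: power_abs)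
    have "(\<integral>x. X x ^ j \<partial>M) * (\<integral>x. S x ^ (2*h - j) \<partial>M) \<le> \<bar>\<integral>x. X x ^ j \<partial>M\<bar> * \<bar>\<integral>x. S x ^ (2*h - j) \<partial>M\<bar>"
      by (metis abs_ge_self abs_mult)
    also have "\<dots> \<le> (\<integral>x. \<bar>X x\<bar> ^ j \<partial>M) * (\<integral>x. \<bar>S x\<bar> ^ (2*h - j) \<partial>M)"
      by (rule mult_mono[OF abs_moment abs_moment]) simp_all
    also have "\<dots> \<le> B ^ j * A ^ (2*h - j)"
    proof (rule mult_mono)
      show "(\<integral>x. \<bar>X x\<bar> ^ j \<partial>M) \<le> B ^ j"
        using j by (intro integral_abs_power_le_of_higher[OF X _ A(2) le(2)]) auto
      show "(\<integral>x. \<bar>S x\<bar> ^ (2*h - j) \<partial>M) \<le> A ^ (2*h - j)"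
        by (intro integral_abs_power_le_of_higher[OF S _ A(1) le(1)]) auto
    qed (use A in simp_all)
    finally show "(\<integral>x. X x ^ j \<partial>M) * (\<integral>x. S x ^ (2*h - j) \<partial>M) \<le> B ^ j * A ^ (2*h - j)" .
  qed auto
  also have "\<dots> \<le> (A\<^sup>2 + 4 ^ h * B\<^sup>2) ^ h"
    using A h by (intro binomial_tail_le) auto
  also have "\<dots> = (sqrt (A\<^sup>2 + 4 ^ h * B\<^sup>2)) ^ (2*h)"
    by (subst power_mult, subst real_sqrt_pow2) simp_all
  finally show ?thesis by (simp only: abs_even)
qed

subsection \<open>Product space: splicing, locality, truncation\<close>

text \<open>Resampling outside \<open>A\<close>: for independent \<open>y\<close> and
  \<open>y'\<close> of law \<open>P\<close>, the pair of \<open>y\<close> and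
  \<open>splice A y y'\<close> couples two configurations of law \<open>P\<close> that agree on
  \<open>A\<close>.\<close>

definition splice :: "'i set \<Rightarrow> ('i \<Rightarrow> 'l) \<Rightarrow> ('i \<Rightarrow> 'l) \<Rightarrow> ('i \<Rightarrow> 'l)" where
  "splice A y y' = (\<lambda>j. if j \<in> A then y j else y' j)"

locale iid_space =
  fixes L :: "'l measure" and P :: "(int^'d::finite \<Rightarrow> 'l) measure"
  assumes prob_L: "prob_space L" and P_def: "P = iid_measure L"
begin

lemma P_eq: "P = Pi\<^sub>M UNIV (\<lambda>_. L)"
  by (simp add: P_def iid_measure_def)

sublocale ps: prob_space P
  unfolding P_eq by (intro prob_space_PiM prob_L)

sublocale PP: pair_prob_space P P ..

section \<open>Measurability, and invariance of the product measure under splicing and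
  shifts\<close>

lemma space_P: "space P = {y. \<forall>j. y j \<in> space L}"
  by (auto simp: P_eq space_PiM PiE_def Pi_def)

lemma measurable_into_P:
  assumes "\<And>j. (\<lambda>x. f x j) \<in> measurable M L"
  shows "f \<in> measurable M P"
  unfolding P_eq using assms
  by (intro measurable_PiM_single') (auto intro!: measurable_space[of "\<lambda>x. f x _" M L])

lemma measurable_coord[measurable]: "(\<lambda>y. y j) \<in> measurable P L"
  unfolding P_eq by (rule measurable_component_singleton) simp

lemma measurable_shift[measurable]: "shift i \<in> measurable P P"
  by (intro measurable_into_P) (simp add: shift_def)

lemma measurable_splice[measurable]: "(\<lambda>(y, y'). splice A y y') \<in> measurable (P \<Otimes>\<^sub>M P) P"
  by (intro measurable_into_P) (simp add: splice_def split_beta)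

lemma shift_in_space[simp]: "y \<in> space P \<Longrightarrow> shift i y \<in> space P"
  by (simp add: space_P shift_def)

lemma splice_in_space[simp]: "y \<in> space P \<Longrightarrow> y' \<in> space P \<Longrightarrow> splice A y y' \<in> space P"
  by (simp add: space_P splice_def)

lemma emeasure_cylinder:
  assumes "finite J" "\<And>j. j \<in> J \<Longrightarrow> F j \<in> sets L"
  shows "emeasure P {y\<in>space P. \<forall>j\<in>J. y j \<in> F j} = (\<Prod>j\<in>J. emeasure L (F j))"
proof -
  interpret product_prob_space "\<lambda>_. L" UNIV by (rule product_prob_spaceI) (rule prob_L)
  show ?thesis unfolding P_eq using assms by (intro emeasure_PiM_Collect) auto
qed

text \<open>A product measure is determined by its finite cylinders. A cylinder event for the
  spliced point is a rectangle: the sites in J \<inter> A constrain \<open>y\<close> and those in J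
  - A constrain \<open>y'\<close>. Independence of disjoint blocks
  (\<open>integral_mult_dep\<close>) and preservation of the mean by truncation
  (\<open>integral_trunc\<close>) both rest on this.\<close>

lemma distr_splice: "distr (P \<Otimes>\<^sub>M P) P (\<lambda>(y, y'). splice A y y') = P"
proof -
  interpret product_prob_space "\<lambda>_. L" "UNIV :: (int^'d) set"
    by (rule product_prob_spaceI) (rule prob_L)
  show ?thesis
  proof (subst (3) P_eq, rule PiM_eq)
    show "sets (distr (P \<Otimes>\<^sub>M P) P (\<lambda>(y, y'). splice A y y')) = sets (Pi\<^sub>M UNIV (\<lambda>_. L))"
      by (simp add: P_eq)
  next
    fix J :: "(int^'d) set" and F
    assume J: "finite J" and F: "\<And>j. j \<in> J \<Longrightarrow> F j \<in> sets L"
    have emb: "prod_emb UNIV (\<lambda>_. L) J (\<Pi>\<^sub>E j\<in>J. F j) = {y\<in>space P. \<forall>j\<in>J. y j \<in> F j}"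
      by (auto simp: prod_emb_def P_eq space_PiM PiE_iff)
    have cyl: "{y\<in>space P. \<forall>j\<in>K. y j \<in> F j} \<in> sets P" if "K \<subseteq> J" for K
      using that F finite_subset[OF that J] by (intro sets.sets_Collect_finite_All) (auto intro!: measurable_sets_Collect[OF measurable_coord])
    have "emeasure (distr (P \<Otimes>\<^sub>M P) P (\<lambda>(y, y'). splice A y y')) {y\<in>space P. \<forall>j\<in>J. y j \<in> F j}
      = emeasure (P \<Otimes>\<^sub>M P) ((\<lambda>(y, y'). splice A y y') -` {y\<in>space P. \<forall>j\<in>J. y j \<in> F j} \<inter> space (P \<Otimes>\<^sub>M P))"
      by (intro emeasure_distr cyl) auto
    also have "(\<lambda>(y, y'). splice A y y') -` {y\<in>space P. \<forall>j\<in>J. y j \<in> F j} \<inter> space (P \<Otimes>\<^sub>M P)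
      = {y\<in>space P. \<forall>j\<in>J \<inter> A. y j \<in> F j} \<times> {y\<in>space P. \<forall>j\<in>J - A. y j \<in> F j}"
      by (auto simp: space_pair_measure) (auto simp: splice_def space_P split: if_splits)
    also have "emeasure (P \<Otimes>\<^sub>M P) \<dots> =
        emeasure P {y\<in>space P. \<forall>j\<in>J \<inter> A. y j \<in> F j} * emeasure P {y\<in>space P. \<forall>j\<in>J - A. y j \<in> F j}"
      by (intro ps.emeasure_pair_measure_Times cyl) auto
    also have "\<dots> = (\<Prod>j\<in>J \<inter> A. emeasure L (F j)) * (\<Prod>j\<in>J - A. emeasure L (F j))"
      using J F by (subst (1 2) emeasure_cylinder) auto
    also have "\<dots> = (\<Prod>j\<in>J. emeasure L (F j))"
      using J by (subst prod.union_disjoint[symmetric]) (auto intro!: prod.cong)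
    finally show "emeasure (distr (P \<Otimes>\<^sub>M P) P (\<lambda>(y, y'). splice A y y')) (prod_emb UNIV (\<lambda>_. L) J (\<Pi>\<^sub>E j\<in>J. F j))
       = (\<Prod>j\<in>J. emeasure L (F j))" by (simp add: emb)
  qed
qed

lemma distr_shift: "distr P P (shift i) = P"
proof -
  have "distr (Pi\<^sub>M UNIV (\<lambda>_. L)) (Pi\<^sub>M UNIV (\<lambda>_. L)) (\<lambda>\<omega>. \<lambda>n\<in>UNIV. \<omega> (i + n)) = Pi\<^sub>M UNIV (\<lambda>_. L)"
    by (intro distr_PiM_reindex[where K = UNIV and M = "\<lambda>_. L" and f = "\<lambda>j. i + j"]) (auto simp: prob_L)
  then show ?thesis by (simp add: P_eq shift_def[abs_def] restrict_def)
qed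

lemma integral_shift:
  fixes f :: "_ \<Rightarrow> real"
  assumes "f \<in> borel_measurable P"
  shows "(\<integral>y. f (shift i y) \<partial>P) = (\<integral>y. f y \<partial>P)"
  using integral_distr[OF measurable_shift assms] by (simp add: distr_shift)

lemma brv_shift: "brv P f \<Longrightarrow> brv P (\<lambda>y. f (shift i y))"
  by (rule brv_compose[OF _ measurable_shift])

lemma measurable_splice': "(\<lambda>z. splice A (fst z) (snd z)) \<in> measurable (P \<Otimes>\<^sub>M P) P"
  using measurable_splice[of A] by (simp add: split_beta')

lemma brv_splice: "brv P f \<Longrightarrow> brv (P \<Otimes>\<^sub>M P) (\<lambda>z. f (splice A (fst z) (snd z)))"
  by (rule brv_compose[OF _ measurable_splice'])

lemma brv_fst: "brv P f \<Longrightarrow> brv (P \<Otimes>\<^sub>M P) (\<lambda>z. f (fst z))"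
  by (rule brv_compose[OF _ measurable_fst])

lemma brv_snd: "brv P f \<Longrightarrow> brv (P \<Otimes>\<^sub>M P) (\<lambda>z. f (snd z))"
  by (rule brv_compose[OF _ measurable_snd])

lemma integral_splice:
  assumes "f \<in> borel_measurable P"
  shows "(\<integral>z. f (splice A (fst z) (snd z)) \<partial>(P \<Otimes>\<^sub>M P)) = (\<integral>y. f y \<partial>P :: real)"
  using integral_distr[OF measurable_splice' assms, of A] unfolding distr_splice[unfolded split_beta'] by simp

text \<open>Measurability with respect to the coordinates in \<open>A\<close>, expressed pointwise.
  Closure under algebraic operations and shifts is then immediate, and no generated sigma-algebras
  appear.\<close>

definition dep :: "(int^'d) set \<Rightarrow> ((int^'d \<Rightarrow> 'l) \<Rightarrow> real) \<Rightarrow> bool" where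
  "dep A f \<longleftrightarrow> f \<in> borel_measurable P \<and>
     (\<forall>y\<in>space P. \<forall>y'\<in>space P. (\<forall>j\<in>A. y j = y' j) \<longrightarrow> f y = f y')"

lemma dep_mono: "dep A f \<Longrightarrow> A \<subseteq> B \<Longrightarrow> dep B f"
  unfolding dep_def by blast

lemma dep_eqD: "dep A f \<Longrightarrow> y \<in> space P \<Longrightarrow> y' \<in> space P \<Longrightarrow> (\<And>j. j \<in> A \<Longrightarrow> y j = y' j) \<Longrightarrow> f y = f y'"
  unfolding dep_def by blast

lemma depI: "f \<in> borel_measurable P \<Longrightarrow>
    (\<And>y y'. y \<in> space P \<Longrightarrow> y' \<in> space P \<Longrightarrow> (\<And>j. j \<in> A \<Longrightarrow> y j = y' j) \<Longrightarrow> f y = f y') \<Longrightarrow> dep A f"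
  unfolding dep_def by blast

lemma dep_measurable: "dep A f \<Longrightarrow> f \<in> borel_measurable P"
  by (simp add: dep_def)

lemma dep_compose:
  assumes "dep A f" "g \<in> borel_measurable borel" shows "dep A (\<lambda>y. g (f y))"
proof (rule depI)
  show "(\<lambda>y. g (f y)) \<in> borel_measurable P"
    using assms by (intro measurable_compose[OF dep_measurable]) auto
  fix y y' assume "y \<in> space P" "y' \<in> space P" "\<And>j. j \<in> A \<Longrightarrow> y j = y' j"
  from dep_eqD[OF assms(1) this] show "g (f y) = g (f y')" by simp
qed

lemma dep_compose2:
  assumes "dep A f" "dep A g" "(\<lambda>y. h (f y) (g y)) \<in> borel_measurable P" shows "dep A (\<lambda>y. h (f y) (g y))"
proof (rule depI)
  fix y y' assume "y \<in> space P" "y' \<in> space P" "\<And>j. j \<in> A \<Longrightarrow> y j = y' j"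
  from dep_eqD[OF assms(1) this] dep_eqD[OF assms(2) this] show "h (f y) (g y) = h (f y') (g y')" by simp
qed (rule assms(3))

lemma dep_mult: "dep A f \<Longrightarrow> dep A g \<Longrightarrow> dep A (\<lambda>y. f y * g y)"
  by (rule dep_compose2) (auto intro: borel_measurable_times dep_measurable)

lemma dep_add: "dep A f \<Longrightarrow> dep A g \<Longrightarrow> dep A (\<lambda>y. f y + g y)"
  by (rule dep_compose2) (auto intro: borel_measurable_add dep_measurable)

lemma dep_diff: "dep A f \<Longrightarrow> dep A g \<Longrightarrow> dep A (\<lambda>y. f y - g y)"
  by (rule dep_compose2) (auto intro: borel_measurable_diff dep_measurable)

lemma dep_const: "dep A (\<lambda>_. c)"
  by (simp add: dep_def)

lemma dep_sum: "(\<And>i. i \<in> I \<Longrightarrow> dep A (f i)) \<Longrightarrow> dep A (\<lambda>y. \<Sum>i\<in>I. f i y)"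
  by (induction I rule: infinite_finite_induct) (simp_all add: dep_const dep_add)

lemma dep_shift: assumes "dep A f" shows "dep ((+) i ` A) (\<lambda>y. f (shift i y))"
proof (rule depI)
  show "(\<lambda>y. f (shift i y)) \<in> borel_measurable P"
    by (rule measurable_compose[OF measurable_shift dep_measurable[OF assms]])
  fix y y' assume y: "y \<in> space P" "y' \<in> space P" and eq: "\<And>j. j \<in> (+) i ` A \<Longrightarrow> y j = y' j"
  show "f (shift i y) = f (shift i y')"
  proof (rule dep_eqD[OF assms shift_in_space[OF y(1)] shift_in_space[OF y(2)]])
    fix j assume "j \<in> A"
    then show "shift i y j = shift i y' j" using eq by (simp add: shift_def)
  qed
qed

text \<open>Replace the point by \<open>splice A y y'\<close>, which does not change the law. Then
  \<open>f\<close> reads only \<open>y\<close> and, as \<open>B\<close> avoids \<open>A\<close>,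
  \<open>g\<close> reads only \<open>y'\<close>, so Fubini factors the integral.\<close>

lemma integral_mult_dep:
  assumes f: "brv P f" "dep A f" and g: "brv P g" "dep B g" and disj: "A \<inter> B = {}"
  shows "(\<integral>y. f y * g y \<partial>P) = (\<integral>y. f y \<partial>P) * (\<integral>y. g y \<partial>P)"
proof -
  have "(\<integral>y. f y * g y \<partial>P) = (\<integral>z. f (splice A (fst z) (snd z)) * g (splice A (fst z) (snd z)) \<partial>(P \<Otimes>\<^sub>M P))"
    using f g by (subst integral_splice[of "\<lambda>y. f y * g y", symmetric]) auto
  also have "\<dots> = (\<integral>z. f (fst z) * g (snd z) \<partial>(P \<Otimes>\<^sub>M P))"
  proof (intro Bochner_Integration.integral_cong refl)
    fix z assume "z \<in> space (P \<Otimes>\<^sub>M P)"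
    then have z: "fst z \<in> space P" "snd z \<in> space P" "splice A (fst z) (snd z) \<in> space P"
      by (auto simp: space_pair_measure)
    have "f (splice A (fst z) (snd z)) = f (fst z)"
      by (rule dep_eqD[OF f(2) z(3) z(1)]) (simp add: splice_def)
    moreover have "g (splice A (fst z) (snd z)) = g (snd z)"
      by (rule dep_eqD[OF g(2) z(3) z(2)]) (use disj in \<open>auto simp: splice_def\<close>)
    ultimately show "f (splice A (fst z) (snd z)) * g (splice A (fst z) (snd z)) = f (fst z) * g (snd z)" by simp
  qed
  also have "\<dots> = (\<integral>y. (\<integral>y'. f y * g y' \<partial>P) \<partial>P)"
  proof -
    have "brv (P \<Otimes>\<^sub>M P) (\<lambda>z. f (fst z) * g (snd z))"
      by (intro brvs brv_fst brv_snd f(1) g(1))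
    then show ?thesis
      using PP.integral_fst'[of "\<lambda>z. f (fst z) * g (snd z)"] PP.P.brv_integrable by simp
  qed
  finally show ?thesis by simp
qed

text \<open>Since the coordinates are independent, \<open>trunc A f\<close> is the conditional expectation of \<open>f\<close> given
  the coordinates in \<open>A\<close>.\<close>

definition trunc :: "(int^'d) set \<Rightarrow> ((int^'d \<Rightarrow> 'l) \<Rightarrow> real) \<Rightarrow> (int^'d \<Rightarrow> 'l) \<Rightarrow> real" where
  "trunc A f y = (\<integral>y'. f (splice A y y') \<partial>P)"

section \<open>Boundedness, locality, mean and error of the truncation\<close>

lemma brv_splice_section: assumes "brv P f" "y \<in> space P" shows "brv P (\<lambda>y'. f (splice A y y'))"
  using brv_compose[OF brv_splice[OF assms(1), of A] measurable_Pair1'[OF assms(2)]] by simp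

lemma abs_trunc_le:
  assumes "brv P f" "y \<in> space P" "\<And>y. y \<in> space P \<Longrightarrow> \<bar>f y\<bar> \<le> D"
  shows "\<bar>trunc A f y\<bar> \<le> D"
proof -
  have "\<bar>trunc A f y\<bar> \<le> (\<integral>y'. \<bar>f (splice A y y')\<bar> \<partial>P)"
    unfolding trunc_def by (rule integral_abs_bound)
  also have "\<dots> \<le> (\<integral>y'. D \<partial>P)"
    using assms by (intro integral_mono ps.brv_integrable brvs brv_splice_section) auto
  finally show ?thesis by (simp add: ps.prob_space)
qed

lemma measurable_trunc[measurable]: assumes "brv P f" shows "trunc A f \<in> borel_measurable P"
  using ps.borel_measurable_lebesgue_integral[of "\<lambda>y y'. f (splice A y y')" P]
    brv_measurable[OF brv_splice[OF assms, of A]]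
  by (simp add: trunc_def[abs_def] split_beta')

lemma brv_trunc: assumes "brv P f" shows "brv P (trunc A f)"
proof -
  obtain D where "\<And>x. x \<in> space P \<Longrightarrow> \<bar>f x\<bar> \<le> D" using assms by (auto simp: brv_def)
  then show ?thesis by (intro brvI[OF measurable_trunc[OF assms]] abs_trunc_le[OF assms])
qed

lemma dep_trunc: assumes "brv P f" shows "dep A (trunc A f)"
proof (rule depI[OF measurable_trunc[OF assms]])
  fix y y' :: "int^'d \<Rightarrow> 'l" assume "\<And>j. j \<in> A \<Longrightarrow> y j = y' j"
  then have "splice A y = splice A y'"
    by (auto simp: splice_def fun_eq_iff)
  then show "trunc A f y = trunc A f y'" by (simp add: trunc_def)
qed

lemma integral_trunc: assumes "brv P f" shows "(\<integral>y. trunc A f y \<partial>P) = (\<integral>y. f y \<partial>P)"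
  using PP.integral_fst'[OF PP.P.brv_integrable[OF brv_splice[OF assms, of A]]]
    integral_splice[OF brv_measurable[OF assms], of A]
  by (simp add: trunc_def)

text \<open>Jensen's inequality for the average over the resampled coordinates. It turns the
  distance to a conditional expectation into a comparison of two configurations that agree on
  \<open>A\<close>, which is the situation to which a coding radius applies.\<close>

lemma integral_diff_trunc_le:
  assumes f: "brv P f"
  shows "(\<integral>y. \<bar>f y - trunc A f y\<bar> ^ n \<partial>P) \<le>
    (\<integral>z. \<bar>f (fst z) - f (splice A (fst z) (snd z))\<bar> ^ n \<partial>(P \<Otimes>\<^sub>M P))"
proof -
  have b: "brv (P \<Otimes>\<^sub>M P) (\<lambda>z. \<bar>f (fst z) - f (splice A (fst z) (snd z))\<bar> ^ n)"
    by (intro brvs brv_fst brv_splice f)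
  have "(\<integral>y. \<bar>f y - trunc A f y\<bar> ^ n \<partial>P) \<le> (\<integral>y. (\<integral>y'. \<bar>f y - f (splice A y y')\<bar> ^ n \<partial>P) \<partial>P)"
  proof (intro integral_mono)
    show "integrable P (\<lambda>y. \<bar>f y - trunc A f y\<bar> ^ n)"
      by (intro ps.brv_integrable brvs f brv_trunc)
    show "integrable P (\<lambda>y. \<integral>y'. \<bar>f y - f (splice A y y')\<bar> ^ n \<partial>P)"
      using PP.integrable_fst'[OF PP.P.brv_integrable[OF b]] by simp
    fix y assume y: "y \<in> space P"
    have s: "brv P (\<lambda>y'. f y - f (splice A y y'))"
      by (intro brvs brv_splice_section f y)
    have "f y - trunc A f y = (\<integral>y'. f y - f (splice A y y') \<partial>P)"
      unfolding trunc_def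
      by (subst Bochner_Integration.integral_diff) (auto simp: ps.prob_space intro!: ps.brv_integrable brv_splice_section f y)
    then have "\<bar>f y - trunc A f y\<bar> ^ n \<le> (\<integral>y'. \<bar>f y - f (splice A y y')\<bar> \<partial>P) ^ n"
      using integral_abs_bound[of P "\<lambda>y'. f y - f (splice A y y')"] by (intro power_mono) simp_all
    also have "\<dots> \<le> (\<integral>y'. \<bar>f y - f (splice A y y')\<bar> ^ n \<partial>P)"
    proof (cases "n = 0")
      case False
      \<comment> \<open>An explicit n-th root, because the comparison of moments expects its bound
        as an n-th power.\<close>
      define B where "B = root n (\<integral>y'. \<bar>f y - f (splice A y y')\<bar> ^ n \<partial>P)"
      have B: "B ^ n = (\<integral>y'. \<bar>f y - f (splice A y y')\<bar> ^ n \<partial>P)" "0 \<le> B"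
        using False by (auto simp: B_def intro!: real_root_pow_pos2 real_root_ge_zero integral_nonneg_AE)
      have "(\<integral>y'. \<bar>f y - f (splice A y y')\<bar> ^ 1 \<partial>P) \<le> B ^ 1"
        using False B by (intro ps.integral_abs_power_le_of_higher[OF s, of 1 n]) auto
      then have "(\<integral>y'. \<bar>f y - f (splice A y y')\<bar> \<partial>P) ^ n \<le> B ^ n"
        by (intro power_mono) simp_all
      then show ?thesis by (simp only: B(1))
    qed (simp add: ps.prob_space)
    finally show "\<bar>f y - trunc A f y\<bar> ^ n \<le> (\<integral>y'. \<bar>f y - f (splice A y y')\<bar> ^ n \<partial>P)" .
  qed
  also have "\<dots> = (\<integral>z. \<bar>f (fst z) - f (splice A (fst z) (snd z))\<bar> ^ n \<partial>(P \<Otimes>\<^sub>M P))"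
    using PP.integral_fst'[OF PP.P.brv_integrable[OF b]] by simp
  finally show ?thesis .
qed

end

subsection \<open>Boxes of lattice points\<close>

lemma bij_betw_vec_PiE:
  "bij_betw (\<lambda>i. \<lambda>m. i $ m) {i::'b^'d::finite. \<forall>m. i $ m \<in> A m} (Pi\<^sub>E UNIV A)"
  by (rule bij_betwI[where g = "\<lambda>f. \<chi> m. f m"]) (auto simp: PiE_def)

lemma finite_vec_box:
  assumes "\<And>m. finite (A m)" shows "finite {i::'b^'d::finite. \<forall>m. i $ m \<in> A m}"
  using bij_betw_finite[OF bij_betw_vec_PiE[of A]] assms by (simp add: finite_PiE)

text \<open>Fubini for finite boxes. Counting lattice points, summing weights and the partition of
  unity by hat functions all reduce to one coordinate through this.\<close>

lemma sum_prod_vec: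
  fixes f :: "'d::finite \<Rightarrow> 'b \<Rightarrow> 'c::comm_semiring_1"
  assumes "\<And>m. finite (A m)"
  shows "(\<Sum>i\<in>{i::'b^'d. \<forall>m. i $ m \<in> A m}. \<Prod>m\<in>UNIV. f m (i $ m)) = (\<Prod>m\<in>UNIV. \<Sum>j\<in>A m. f m j)"
proof -
  have "(\<Prod>m\<in>UNIV. \<Sum>j\<in>A m. f m j) = (\<Sum>g\<in>Pi\<^sub>E UNIV A. \<Prod>m\<in>UNIV. f m (g m))"
    by (rule prod_sum_PiE) (auto simp: assms)
  also have "\<dots> = (\<Sum>i\<in>{i::'b^'d. \<forall>m. i $ m \<in> A m}. \<Prod>m\<in>UNIV. f m (i $ m))"
    by (rule sum.reindex_bij_betw[OF bij_betw_vec_PiE, symmetric])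
  finally show ?thesis by simp
qed

lemma card_vec_box:
  assumes "\<And>m. finite (A m)"
  shows "card {i::'b^'d::finite. \<forall>m. i $ m \<in> A m} = (\<Prod>m\<in>UNIV. card (A m))"
  using sum_prod_vec[of A "\<lambda>_ _. 1::nat"] assms by simp

lemma lattice_box_eq: "lattice_box k = {j. \<forall>m. j $ m \<in> {- int k..int k}}"
  by (auto simp: lattice_box_def)

lemma finite_lattice_box[simp]: "finite (lattice_box k :: (int^'d::finite) set)"
  unfolding lattice_box_eq by (rule finite_vec_box) simp

lemma card_lattice_box: "card (lattice_box k :: (int^'d::finite) set) = (2 * k + 1) ^ CARD('d)"
proof -
  have "nat (2 * int k + 1) = 2 * k + 1" by simp
  then show ?thesis unfolding lattice_box_eq by (subst card_vec_box) simp_all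
qed

lemma lattice_box_mono: "k \<le> l \<Longrightarrow> lattice_box k \<subseteq> lattice_box l"
  unfolding lattice_box_def by (auto intro: order_trans) (meson order_trans neg_le_iff_le of_nat_mono)+

lemma lattice_box_iff: "j \<in> lattice_box k \<longleftrightarrow> (\<forall>m. \<bar>j $ m\<bar> \<le> int k)"
  unfolding lattice_box_def by (simp add: abs_le_iff) (metis minus_le_iff)

lemma lattice_box_add: "i \<in> lattice_box k \<Longrightarrow> j \<in> lattice_box l \<Longrightarrow> i + j \<in> lattice_box (k + l)"
  unfolding lattice_box_iff by (auto intro: order_trans[OF abs_triangle_ineq] add_mono)

lemma lattice_box_diff: "i \<in> lattice_box k \<Longrightarrow> j \<in> lattice_box l \<Longrightarrow> i - j \<in> lattice_box (k + l)"
  unfolding lattice_box_iff by (auto intro: order_trans[OF abs_triangle_ineq4] add_mono)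

lemma translates_disjoint:
  fixes i j :: "int^'d::finite"
  assumes "j - i \<notin> lattice_box (k + l)"
  shows "(+) i ` lattice_box k \<inter> (+) j ` lattice_box l = {}"
proof (rule ccontr)
  assume "\<not> ?thesis"
  then obtain a b where ab: "a \<in> lattice_box k" "b \<in> lattice_box l" "i + a = j + b" by auto
  then have "j - i = a - b" by (simp add: algebra_simps)
  with lattice_box_diff[OF ab(1,2)] assms show False by simp
qed

subsection \<open>Moments of weighted sums of a local field\<close>

context iid_space
begin

text \<open>Sites of \<open>C\<close> are more than 2m apart in the sup norm, so a new term reads
  coordinates disjoint from those of all previous terms. Adding one site at a time with
  \<open>even_moment_add_indep\<close> makes squared norms additive, up to the factor 4^h.\<close>

lemma moment_separated:
  assumes U: "brv P U" "dep (lattice_box m) U" "(\<integral>y. U y \<partial>P) = 0"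
    and u: "0 \<le> u" "(\<integral>y. \<bar>U y\<bar> ^ (2*h) \<partial>P) \<le> u ^ (2*h)" and h: "1 \<le> h"
    and "finite C" and sep: "\<And>i j. i \<in> C \<Longrightarrow> j \<in> C \<Longrightarrow> i \<noteq> j \<Longrightarrow> j - i \<notin> lattice_box (m + m)"
  shows "(\<integral>y. \<bar>\<Sum>i\<in>C. a i * U (shift i y)\<bar> ^ (2*h) \<partial>P) \<le> sqrt (\<Sum>i\<in>C. 4 ^ h * (a i * u)\<^sup>2) ^ (2*h)"
  using \<open>finite C\<close> sep
proof (induction C rule: finite_induct)
  case empty
  then show ?case using h by (simp add: power_0_left)
next
  case (insert k C)
  define S where "S = (\<lambda>y. \<Sum>i\<in>C. a i * U (shift i y))"
  define X where "X = (\<lambda>y. a k * U (shift k y))"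
  define A where "A = sqrt (\<Sum>i\<in>C. 4 ^ h * (a i * u)\<^sup>2)"
  have S: "brv P S" unfolding S_def by (intro brv_sum brv_mult brv_const brv_shift U)
  have X: "brv P X" unfolding X_def by (intro brv_mult brv_const brv_shift U)
  have A: "0 \<le> A" by (simp add: A_def sum_nonneg)
  have depS: "dep (\<Union>i\<in>C. (+) i ` lattice_box m) S"
    unfolding S_def
  proof (rule dep_sum)
    fix i assume "i \<in> C"
    then show "dep (\<Union>i\<in>C. (+) i ` lattice_box m) (\<lambda>y. a i * U (shift i y))"
      by (intro dep_mult dep_const dep_mono[OF dep_shift[OF U(2)]]) auto
  qed
  have depX: "dep ((+) k ` lattice_box m) X"
    unfolding X_def by (intro dep_mult dep_const dep_shift U(2))
  have disj: "(+) k ` lattice_box m \<inter> (\<Union>i\<in>C. (+) i ` lattice_box m) = {}"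
  proof -
    have "(+) k ` lattice_box m \<inter> (+) i ` lattice_box m = {}" if "i \<in> C" for i
      using insert that by (intro translates_disjoint) auto
    then show ?thesis by blast
  qed
  have "(\<integral>y. \<bar>S y + X y\<bar> ^ (2*h) \<partial>P) \<le> sqrt (A\<^sup>2 + 4 ^ h * (\<bar>a k\<bar> * u)\<^sup>2) ^ (2*h)"
  proof (rule ps.even_moment_add_indep[OF S X A _ h])
    show "0 \<le> \<bar>a k\<bar> * u" using u by simp
    show "(\<integral>y. \<bar>S y\<bar> ^ (2*h) \<partial>P) \<le> A ^ (2*h)"
      unfolding S_def A_def using insert by simp
    have "(\<integral>y. \<bar>X y\<bar> ^ (2*h) \<partial>P) = (\<integral>y. \<bar>a k\<bar> ^ (2*h) * \<bar>U (shift k y)\<bar> ^ (2*h) \<partial>P)"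
      unfolding X_def by (simp only: abs_mult power_mult_distrib)
    also have "\<dots> = \<bar>a k\<bar> ^ (2*h) * (\<integral>y. \<bar>U y\<bar> ^ (2*h) \<partial>P)"
      using integral_shift[OF brv_measurable[OF brv_power[OF brv_abs[OF U(1)]]], of k "2*h"] by simp
    also have "\<dots> \<le> \<bar>a k\<bar> ^ (2*h) * u ^ (2*h)"
      using u(2) by (intro mult_left_mono) simp_all
    finally show "(\<integral>y. \<bar>X y\<bar> ^ (2*h) \<partial>P) \<le> (\<bar>a k\<bar> * u) ^ (2*h)" by (simp only: power_mult_distrib)
    show "(\<integral>y. X y \<partial>P) = 0"
      unfolding X_def using integral_shift[OF brv_measurable[OF U(1)]] U(3) by simp
    fix j l
    show "(\<integral>y. X y ^ j * S y ^ l \<partial>P) = (\<integral>y. X y ^ j \<partial>P) * (\<integral>y. S y ^ l \<partial>P)"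
      by (rule integral_mult_dep[OF brv_power[OF X] dep_compose[OF depX] brv_power[OF S] dep_compose[OF depS] disj]) simp_all
  qed
  also have "A\<^sup>2 + 4 ^ h * (\<bar>a k\<bar> * u)\<^sup>2 = (\<Sum>i\<in>insert k C. 4 ^ h * (a i * u)\<^sup>2)"
    using insert.hyps by (simp add: A_def sum_nonneg power_mult_distrib)
  finally show ?case using insert.hyps by (simp add: S_def X_def add.commute)
qed

text \<open>Inside a residue class squared norms add. Between classes only Minkowski is available,
  and Cauchy-Schwarz bounds the sum of the class norms at the cost of the square root of the number
  of classes, at most (4m+1)^d. For m of order 2^l this is the factor 2^(d l / 2).\<close>

lemma moment_local:
  assumes U: "brv P U" "dep (lattice_box m) U" "(\<integral>y. U y \<partial>P) = 0"
    and u: "0 \<le> u" "(\<integral>y. \<bar>U y\<bar> ^ (2*h) \<partial>P) \<le> u ^ (2*h)" and h: "1 \<le> h"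
    and fin: "finite I"
  shows "(\<integral>y. \<bar>\<Sum>i\<in>I. a i * U (shift i y)\<bar> ^ (2*h) \<partial>P)
    \<le> (u * sqrt (4 ^ h * real (4 * m + 1) ^ CARD('d)) * sqrt (\<Sum>i\<in>I. (a i)\<^sup>2)) ^ (2*h)"
proof -
  \<comment> \<open>Distinct sites of one class differ by at least N > 2m in some coordinate, so
    their boxes of radius m are disjoint.\<close>
  define N where "N = 4 * int m + 1"
  define r where "r = (\<lambda>i::int^'d. \<chi> k. i $ k mod N)"
  define K where "K c = {i\<in>I. r i = c}" for c
  have N: "N > 0" by (simp add: N_def)
  have card: "card (r ` I) \<le> (4 * m + 1) ^ CARD('d)"
  proof -
    have "r ` I \<subseteq> {j. \<forall>k. j $ k \<in> {0..<N}}"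
      using N by (auto simp: r_def)
    then have "card (r ` I) \<le> card {j::int^'d. \<forall>k. j $ k \<in> {0..<N}}"
      by (intro card_mono finite_vec_box) auto
    also have "\<dots> = nat N ^ CARD('d)" by (subst card_vec_box) auto
    finally show ?thesis by (simp add: N_def nat_add_distrib nat_mult_distrib)
  qed
  define B where "B c = sqrt (\<Sum>i\<in>K c. 4 ^ h * (a i * u)\<^sup>2)" for c
  have "(\<integral>y. \<bar>\<Sum>c\<in>r ` I. \<Sum>i\<in>K c. a i * U (shift i y)\<bar> ^ (2*h) \<partial>P) \<le> (\<Sum>c\<in>r ` I. B c) ^ (2*h)"
  proof (rule ps.Minkowski_brv_sum)
    show "finite (r ` I)" "0 < 2 * h" using fin h by auto
    fix c assume "c \<in> r ` I"
    show "brv P (\<lambda>y. \<Sum>i\<in>K c. a i * U (shift i y))"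
      by (intro brv_sum brv_mult brv_const brv_shift U)
    show "0 \<le> B c" by (simp add: B_def sum_nonneg)
    show "(\<integral>y. \<bar>\<Sum>i\<in>K c. a i * U (shift i y)\<bar> ^ (2*h) \<partial>P) \<le> B c ^ (2*h)"
      unfolding B_def
    proof (rule moment_separated[OF U u h])
      show "finite (K c)" using fin by (simp add: K_def)
      fix i j assume ij: "i \<in> K c" "j \<in> K c" "i \<noteq> j"
      then obtain k where k: "i $ k \<noteq> j $ k" by (auto simp: vec_eq_iff)
      have "r i $ k = r j $ k" using ij by (simp add: K_def)
      then have "(j $ k - i $ k) mod N = 0"
        by (simp add: r_def) (metis mod_eq_dvd_iff dvd_imp_mod_0)
      then have dv: "N dvd j $ k - i $ k" by (simp add: dvd_eq_mod_eq_0)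
      have "\<bar>j $ k - i $ k\<bar> \<ge> N"
        using dvd_imp_le_int[OF _ dv] k N by simp
      then show "j - i \<notin> lattice_box (m + m)"
        unfolding lattice_box_iff N_def by (auto intro!: exI[of _ k])
    qed
  qed
  also have "(\<lambda>y. \<Sum>c\<in>r ` I. \<Sum>i\<in>K c. a i * U (shift i y)) = (\<lambda>y. \<Sum>i\<in>I. a i * U (shift i y))"
    unfolding K_def by (rule ext) (rule sum.image_gen[OF fin, symmetric])
  finally have 1: "(\<integral>y. \<bar>\<Sum>i\<in>I. a i * U (shift i y)\<bar> ^ (2*h) \<partial>P) \<le> (\<Sum>c\<in>r ` I. B c) ^ (2*h)"
    by (simp add: fun_eq_iff)
  have "(\<Sum>c\<in>r ` I. B c)\<^sup>2 = (\<Sum>c\<in>r ` I. 1 * B c)\<^sup>2" by simp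
  also have "\<dots> \<le> (\<Sum>c\<in>r ` I. 1\<^sup>2) * (\<Sum>c\<in>r ` I. (B c)\<^sup>2)"
    by (rule Cauchy_Schwarz_ineq_sum)
  also have "(\<Sum>c\<in>r ` I. (B c)\<^sup>2) = (\<Sum>c\<in>r ` I. \<Sum>i\<in>K c. 4 ^ h * (a i * u)\<^sup>2)"
    by (simp add: B_def sum_nonneg)
  also have "\<dots> = (\<Sum>i\<in>I. 4 ^ h * (a i * u)\<^sup>2)"
    unfolding K_def by (rule sum.image_gen[OF fin, symmetric])
  also have "\<dots> = u\<^sup>2 * 4 ^ h * (\<Sum>i\<in>I. (a i)\<^sup>2)"
    by (simp add: sum_distrib_left power_mult_distrib mult_ac)
  also have "(\<Sum>c\<in>r ` I. 1\<^sup>2) * (u\<^sup>2 * 4 ^ h * (\<Sum>i\<in>I. (a i)\<^sup>2))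
      \<le> real (4 * m + 1) ^ CARD('d) * (u\<^sup>2 * 4 ^ h * (\<Sum>i\<in>I. (a i)\<^sup>2))"
  proof (rule mult_right_mono)
    have "real (card (r ` I)) \<le> real ((4 * m + 1) ^ CARD('d))" using card by (rule of_nat_mono)
    then show "(\<Sum>c\<in>r ` I. 1\<^sup>2) \<le> real (4 * m + 1) ^ CARD('d)" by simp
  qed (simp add: sum_nonneg)
  also have "\<dots> = (u * sqrt (4 ^ h * real (4 * m + 1) ^ CARD('d)) * sqrt (\<Sum>i\<in>I. (a i)\<^sup>2))\<^sup>2"
    by (simp add: power_mult_distrib sum_nonneg mult_ac)
  finally have "(\<Sum>c\<in>r ` I. B c)\<^sup>2 \<le> (u * sqrt (4 ^ h * real (4 * m + 1) ^ CARD('d)) * sqrt (\<Sum>i\<in>I. (a i)\<^sup>2))\<^sup>2" .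
  then have "(\<Sum>c\<in>r ` I. B c) \<le> u * sqrt (4 ^ h * real (4 * m + 1) ^ CARD('d)) * sqrt (\<Sum>i\<in>I. (a i)\<^sup>2)"
    by (rule power2_le_imp_le) (use u in \<open>simp add: sum_nonneg\<close>)
  then have "(\<Sum>c\<in>r ` I. B c) ^ (2*h) \<le> (u * sqrt (4 ^ h * real (4 * m + 1) ^ CARD('d)) * sqrt (\<Sum>i\<in>I. (a i)\<^sup>2)) ^ (2*h)"
    by (rule power_mono) (simp add: B_def sum_nonneg)
  with 1 show ?thesis by simp
qed

end

subsection \<open>Stein's method for the characteristic function\<close>

lemma abs_sin_diff_le: "\<bar>sin x - sin y\<bar> \<le> \<bar>x - y\<bar>" for x y :: real
proof -
  have "\<bar>sin x - sin y\<bar> = 2 * \<bar>sin ((x - y) / 2)\<bar> * \<bar>cos ((x + y) / 2)\<bar>"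
    by (simp add: sin_diff_sin abs_mult)
  also have "\<dots> \<le> 2 * \<bar>(x - y) / 2\<bar> * 1"
    by (intro mult_mono mult_left_mono abs_sin_x_le_abs_x abs_cos_le_one) auto
  finally show ?thesis by simp
qed

lemma abs_cos_diff_le: "\<bar>cos x - cos y\<bar> \<le> \<bar>x - y\<bar>" for x y :: real
  using abs_sin_diff_le[of "pi/2 - x" "pi/2 - y"] by (simp add: sin_diff abs_minus_commute)

text \<open>Mean value theorem together with the Lipschitz bound on the derivative. The constant 1
  instead of 1/2 is sufficient for the error estimates.\<close>

lemma linear_approx_bound:
  fixes f f' :: "real \<Rightarrow> real"
  assumes d: "\<And>x. (f has_real_derivative f' x) (at x)" and lip: "\<And>x y. \<bar>f' x - f' y\<bar> \<le> \<bar>x - y\<bar>"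
  shows "\<bar>f (x + t) - f x - t * f' x\<bar> \<le> t\<^sup>2"
proof (cases "t = 0")
  case False
  have "\<exists>z. \<bar>z - x\<bar> \<le> \<bar>t\<bar> \<and> f (x + t) - f x = t * f' z"
  proof (cases "t > 0")
    case True
    then obtain z where "x < z" "z < x + t" "f (x + t) - f x = (x + t - x) * f' z"
      using MVT2[of x "x + t" f f'] d by auto
    then show ?thesis by (intro exI[of _ z]) auto
  next
    case f: False
    with False obtain z where "x + t < z" "z < x" "f x - f (x + t) = (x - (x + t)) * f' z"
      using MVT2[of "x + t" x f f'] d by auto
    then show ?thesis by (intro exI[of _ z]) (auto simp: algebra_simps)
  qed
  then obtain z where z: "\<bar>z - x\<bar> \<le> \<bar>t\<bar>" "f (x + t) - f x = t * f' z" by blast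
  have "\<bar>f (x + t) - f x - t * f' x\<bar> = \<bar>t\<bar> * \<bar>f' z - f' x\<bar>"
    unfolding z(2) by (simp add: abs_mult[symmetric] algebra_simps)
  also have "\<dots> \<le> \<bar>t\<bar> * \<bar>t\<bar>"
    using lip[of z x] z(1) by (intro mult_left_mono) auto
  finally show ?thesis by (simp add: power2_eq_square)
qed simp

lemma sin_linear_approx: "\<bar>sin (x + t) - sin x - t * cos x\<bar> \<le> t\<^sup>2" for x t :: real
  by (rule linear_approx_bound) (auto intro: abs_cos_diff_le derivative_eq_intros)

lemma cos_linear_approx: "\<bar>cos (x + t) - cos x + t * sin x\<bar> \<le> t\<^sup>2" for x t :: real
proof -
  have "\<bar>cos (x + t) - cos x - t * - sin x\<bar> \<le> t\<^sup>2"
    by (rule linear_approx_bound) (use abs_sin_diff_le in \<open>auto simp: abs_minus_commute intro: DERIV_cos\<close>)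
  then show ?thesis by simp
qed

text \<open>Serves to differentiate under the integral: a quadratic remainder that is uniform over
  the sample space can simply be integrated.\<close>

lemma has_derivative_of_quadratic_bound:
  fixes f :: "real \<Rightarrow> real"
  assumes "\<And>t. \<bar>f (x + t) - f x - t * D\<bar> \<le> K * t\<^sup>2"
  shows "(f has_real_derivative D) (at x)"
proof -
  have "((\<lambda>t. (f (x + t) - f x) / t - D) \<longlongrightarrow> 0) (at 0)"
  proof (rule Lim_null_comparison)
    show "\<forall>\<^sub>F t in at 0. norm ((f (x + t) - f x) / t - D) \<le> K * \<bar>t\<bar>"
    proof (rule eventually_at_topological[THEN iffD2], intro exI[of _ UNIV] conjI ballI impI)
      fix t :: real assume t: "t \<noteq> 0"
      have "norm ((f (x + t) - f x) / t - D) = \<bar>f (x + t) - f x - t * D\<bar> / \<bar>t\<bar>"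
        using t by (simp add: abs_divide[symmetric] diff_divide_distrib)
      also have "\<dots> \<le> K * t\<^sup>2 / \<bar>t\<bar>" by (intro divide_right_mono assms) simp
      also have "\<dots> = K * \<bar>t\<bar>" using t by (simp add: power2_eq_square abs_if)
      finally show "norm ((f (x + t) - f x) / t - D) \<le> K * \<bar>t\<bar>" .
    qed auto
    show "((\<lambda>t. K * \<bar>t\<bar>) \<longlongrightarrow> 0) (at (0::real))"
      by (rule tendsto_eq_intros | simp)+
  qed
  then show ?thesis unfolding DERIV_def by (simp add: LIM_zero_iff)
qed

text \<open>With the integrating factor exp(u^2 v / 2) the derivative contains only the defect c' +
  u v c. On [0,1] this factor is at most exp(v/2), which cancels when the equation is solved for c
  1; hence the final error does not depend on v.\<close>

lemma gaussian_ode: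
  fixes c :: "real \<Rightarrow> real"
  assumes d: "\<And>u. (c has_real_derivative c' u) (at u)"
    and b: "\<And>u. 0 \<le> u \<Longrightarrow> u \<le> 1 \<Longrightarrow> \<bar>c' u + u * v * c u\<bar> \<le> E" and v: "0 \<le> v"
  shows "\<bar>c 1 - exp (- v / 2) * c 0\<bar> \<le> E"
proof -
  define g where "g = (\<lambda>u. exp (u\<^sup>2 * v / 2) * c u)"
  have dg: "(g has_real_derivative exp (u\<^sup>2 * v / 2) * (c' u + u * v * c u)) (at u)" for u
    unfolding g_def by (rule derivative_eq_intros d refl | simp add: field_simps)+
  obtain z where z: "0 < z" "z < 1" "g 1 - g 0 = (1 - 0) * (exp (z\<^sup>2 * v / 2) * (c' z + z * v * c z))"
    using MVT2[of 0 1 g "\<lambda>u. exp (u\<^sup>2 * v / 2) * (c' u + u * v * c u)"] dg by auto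
  have "\<bar>g 1 - g 0\<bar> = exp (z\<^sup>2 * v / 2) * \<bar>c' z + z * v * c z\<bar>"
    using z(3) by (simp add: abs_mult)
  also have "\<dots> \<le> exp (v / 2) * E"
  proof (rule mult_mono)
    have "z\<^sup>2 * v \<le> 1 * v" using z v by (intro mult_right_mono) (auto simp: power_le_one)
    then show "exp (z\<^sup>2 * v / 2) \<le> exp (v / 2)" by simp
  qed (use z b[of z] in auto)
  finally have "exp (- v / 2) * \<bar>g 1 - g 0\<bar> \<le> exp (- v / 2) * (exp (v / 2) * E)"
    by (intro mult_left_mono) simp_all
  also have "\<dots> = E" by (simp add: mult.assoc[symmetric] exp_add[symmetric])
  also have "exp (- v / 2) * \<bar>g 1 - g 0\<bar> = \<bar>exp (- v / 2) * (g 1 - g 0)\<bar>"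
    by (simp add: abs_mult)
  also have "exp (- v / 2) * (g 1 - g 0) = c 1 - exp (- v / 2) * c 0"
    unfolding g_def by (simp add: right_diff_distrib mult.assoc[symmetric] exp_add[symmetric])
  finally show ?thesis .
qed

context iid_space
begin

lemma abs_integral_le: "brv P f \<Longrightarrow> (\<And>y. y \<in> space P \<Longrightarrow> \<bar>f y\<bar> \<le> B) \<Longrightarrow> \<bar>\<integral>y. f y \<partial>P\<bar> \<le> B"
  using integral_abs_bound[of P f] ps.integral_le_const[OF ps.brv_integrable[OF brv_abs], of f B]
  by (meson AE_I2 order_trans)

text \<open>For c(u) = E cos(u S + b) one has c' = - sum a_i E[x_i sin(u S + b)]. Removing from S
  the sites near i leaves a part independent of the centred x_i, so the leading term is u
  E[x_i T cos(u S1 + b)], with T the removed part; removing a second layer decouples x_i T from the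
  cosine. What remains is c' = - u v c up to an error. The phase b covers real and imaginary parts
  of the characteristic function at once, and t bounds the sum over one neighbourhood of at most
  (8m+1)^d sites.\<close>

lemma char_local:
  assumes U: "brv P U" "dep (lattice_box m) U" "(\<integral>y. U y \<partial>P) = 0"
    and D: "\<And>y. y \<in> space P \<Longrightarrow> \<bar>U y\<bar> \<le> D" and D0: "0 \<le> D"
    and fin: "finite I" and a: "\<And>i. i \<in> I \<Longrightarrow> \<bar>a i\<bar> \<le> \<alpha>" and al: "0 \<le> \<alpha>"
    and S_def: "S = (\<lambda>y. \<Sum>i\<in>I. a i * U (shift i y))"
  shows "\<bar>(\<integral>y. cos (S y + b) \<partial>P) - exp (- (\<integral>y. (S y)\<^sup>2 \<partial>P) / 2) * cos b\<bar>
    \<le> 3 * real (card I) * \<alpha> * D * (real ((8 * m + 1) ^ CARD('d)) * \<alpha> * D)\<^sup>2"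
proof -
  define x where "x i = (\<lambda>y. U (shift i y))" for i
  define SS where "SS J = (\<lambda>y. \<Sum>i\<in>J. a i * x i y)" for J
  \<comment> \<open>Sites outside \<open>N1 i\<close> have boxes disjoint from that of i. The
    product of \<open>x i\<close> with the sum over \<open>N1 i\<close> reads the box of radius 2m +
    m = 3m around i, which is disjoint from the boxes of sites outside \<open>N2 i\<close>.\<close>
  define N1 where "N1 i = {j\<in>I. j - i \<in> lattice_box (2 * m)}" for i
  define N2 where "N2 i = {j\<in>I. j - i \<in> lattice_box (4 * m)}" for i
  define t where "t = real ((8 * m + 1) ^ CARD('d)) * \<alpha> * D"
  have t: "0 \<le> t" using D0 al by (simp add: t_def)
  have xb: "brv P (x i)" for i unfolding x_def by (rule brv_shift[OF U(1)])
  have SSb: "brv P (SS J)" for J unfolding SS_def by (intro brv_sum brv_mult brv_const xb)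
  have xD: "\<bar>x i y\<bar> \<le> D" if "y \<in> space P" for i y
    unfolding x_def by (rule D) (simp add: that)
  have x0: "(\<integral>y. x i y \<partial>P) = 0" for i
    unfolding x_def using integral_shift[OF brv_measurable[OF U(1)]] U(3) by simp
  have S_eq: "S = SS I" by (simp add: S_def SS_def x_def)
  have Sx: "(\<Sum>i\<in>I. a i * (x i y * z)) = S y * z" for y z
    unfolding S_def x_def by (simp add: sum_distrib_right mult.assoc)
  have dx: "dep ((+) i ` lattice_box m) (x i)" for i
    unfolding x_def by (rule dep_shift[OF U(2)])
  have dSS: "dep A (SS J)" if "\<And>j. j \<in> J \<Longrightarrow> (+) j ` lattice_box m \<subseteq> A" for A J
    unfolding SS_def using that by (intro dep_sum dep_mult dep_const dep_mono[OF dx]) auto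
  have N2_card: "card J \<le> (8 * m + 1) ^ CARD('d)" if "J \<subseteq> N2 i" for i J
  proof -
    have "card J \<le> card ((\<lambda>j. i + j) ` (lattice_box (4 * m)))"
    proof (rule card_mono)
      show "J \<subseteq> (\<lambda>j. i + j) ` lattice_box (4 * m)"
      proof
        fix j assume "j \<in> J"
        with that have "j - i \<in> lattice_box (4 * m)" by (auto simp: N2_def)
        then show "j \<in> (\<lambda>j. i + j) ` lattice_box (4 * m)"
          by (intro image_eqI[of _ _ "j - i"]) auto
      qed
    qed simp
    also have "\<dots> \<le> card (lattice_box (4 * m) :: (int^'d) set)" by (rule card_image_le) simp
    finally show ?thesis by (simp add: card_lattice_box)
  qed
  have N12: "N1 i \<subseteq> N2 i" for i
    using lattice_box_mono[of "2*m" "4*m"] by (auto simp: N1_def N2_def)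
  have SSt: "\<bar>SS J y\<bar> \<le> t" if "J \<subseteq> N2 i" "y \<in> space P" for i J y
  proof -
    have JI: "J \<subseteq> I" using that by (auto simp: N2_def)
    have "\<bar>SS J y\<bar> \<le> (\<Sum>j\<in>J. \<bar>a j * x j y\<bar>)" unfolding SS_def by (rule sum_abs)
    also have "\<dots> \<le> (\<Sum>j\<in>J. \<alpha> * D)"
      unfolding abs_mult using JI that(2) al by (intro sum_mono mult_mono a xD) auto
    also have "\<dots> = real (card J) * (\<alpha> * D)" by simp
    also have "\<dots> \<le> real ((8 * m + 1) ^ CARD('d)) * (\<alpha> * D)"
      using N2_card[OF that(1)] al D0 by (intro mult_right_mono of_nat_mono) auto
    finally show ?thesis by (simp add: t_def mult.assoc)
  qed
  have split1: "S y = SS (I - N1 i) y + SS (N1 i) y" for i y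
    unfolding S_eq SS_def using fin by (subst sum.subset_diff[of "N1 i" I]) (auto simp: N1_def)
  have split2: "SS (I - N1 i) y = SS (I - N2 i) y + SS (N2 i - N1 i) y" for i y
  proof -
    have "I - N1 i = (I - N2 i) \<union> (N2 i - N1 i)" using N12[of i] by (auto simp: N2_def)
    moreover have "finite (N2 i)" using fin by (simp add: N2_def)
    ultimately show ?thesis unfolding SS_def
      using fin by (simp only:) (subst sum.union_disjoint, auto)
  qed
  have disj1: "(+) i ` lattice_box m \<inter> (\<Union>j\<in>I - N1 i. (+) j ` lattice_box m) = {}" for i
  proof -
    have "(+) i ` lattice_box m \<inter> (+) j ` lattice_box m = {}" if "j \<in> I - N1 i" for j
      using that by (intro translates_disjoint) (auto simp: N1_def mult_2)
    then show ?thesis by blast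
  qed
  have disj2: "(+) i ` lattice_box (3 * m) \<inter> (\<Union>j\<in>I - N2 i. (+) j ` lattice_box m) = {}" for i
  proof -
    have "(+) i ` lattice_box (3 * m) \<inter> (+) j ` lattice_box m = {}" if "j \<in> I - N2 i" for j
    proof (rule translates_disjoint)
      show "j - i \<notin> lattice_box (3 * m + m)" using that by (auto simp: N2_def)
    qed
    then show ?thesis by blast
  qed
  have dxT: "dep ((+) i ` lattice_box (3 * m)) (\<lambda>y. x i y * SS (N1 i) y)" for i
  proof (rule dep_mult)
    show "dep ((+) i ` lattice_box (3 * m)) (x i)"
      using lattice_box_mono[of m "3 * m"] by (intro dep_mono[OF dx]) auto
    show "dep ((+) i ` lattice_box (3 * m)) (SS (N1 i))"
    proof (rule dSS)
      fix j assume j: "j \<in> N1 i"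
      show "(+) j ` lattice_box m \<subseteq> (+) i ` lattice_box (3 * m)"
      proof safe
        fix l :: "int^'d" assume "l \<in> lattice_box m"
        then have "(j - i) + l \<in> lattice_box (2 * m + m)"
          using j by (intro lattice_box_add) (auto simp: N1_def)
        then show "j + l \<in> (+) i ` lattice_box (3 * m)"
          by (intro image_eqI[of _ _ "(j - i) + l"]) auto
      qed
    qed
  qed
  define v where "v = (\<integral>y. (S y)\<^sup>2 \<partial>P)"
  define w where "w i = (\<integral>y. x i y * SS (N1 i) y \<partial>P)" for i
  have Sb: "brv P S" unfolding S_eq by (rule SSb)
  \<comment> \<open>x_i is uncorrelated with the part of S outside \<open>N1 i\<close>, so the
    variance is a sum of local covariances; this is what lets the coefficients \<open>w i\<close>
    recombine to v in the differential equation.\<close>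
  have v_eq: "v = (\<Sum>i\<in>I. a i * w i)"
  proof -
    have "v = (\<integral>y. (\<Sum>i\<in>I. a i * (x i y * S y)) \<partial>P)"
      unfolding v_def by (simp only: Sx power2_eq_square)
    also have "\<dots> = (\<Sum>i\<in>I. a i * (\<integral>y. x i y * S y \<partial>P))"
      by (subst Bochner_Integration.integral_sum) (auto intro!: ps.brv_integrable brvs xb Sb)
    also have "\<dots> = (\<Sum>i\<in>I. a i * w i)"
    proof (intro sum.cong refl arg_cong2[where f = "(*)"])
      fix i assume "i \<in> I"
      have "(\<integral>y. x i y * S y \<partial>P) = (\<integral>y. x i y * SS (I - N1 i) y + x i y * SS (N1 i) y \<partial>P)"
        by (simp only: split1[of _ i] distrib_left)
      also have "\<dots> = (\<integral>y. x i y * SS (I - N1 i) y \<partial>P) + w i"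
        unfolding w_def by (intro Bochner_Integration.integral_add ps.brv_integrable brv_mult xb SSb)
      also have "(\<integral>y. x i y * SS (I - N1 i) y \<partial>P) = (\<integral>y. x i y \<partial>P) * (\<integral>y. SS (I - N1 i) y \<partial>P)"
        by (rule integral_mult_dep[OF xb dx SSb dSS disj1]) auto
      finally show "(\<integral>y. x i y * S y \<partial>P) = w i" by (simp add: x0)
    qed
    finally show ?thesis .
  qed
  define c where "c u = (\<integral>y. cos (u * S y + b) \<partial>P)" for u
  define A where "A i u = (\<integral>y. x i y * sin (u * S y + b) \<partial>P)" for i u
  \<comment> \<open>Three replacements, each costing at most D t^2: the Taylor expansion of the sine
    at S1, passing from S1 to S2 in the cosine, and going back from S2 to the full S, where the
    factor |w i| \<le> D t enters.\<close>
  have key: "\<bar>A i u - u * w i * c u\<bar> \<le> 3 * D * t\<^sup>2" if u: "0 \<le> u" "u \<le> 1" for i u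
  proof -
    define T where "T = SS (N1 i)"
    define S1 where "S1 = SS (I - N1 i)"
    define S2 where "S2 = SS (I - N2 i)"
    note brv' = brvs xb SSb[of "N1 i", folded T_def] SSb[of "I - N1 i", folded S1_def] SSb[of "I - N2 i", folded S2_def] Sb
    have T: "\<bar>T y\<bar> \<le> t" if "y \<in> space P" for y unfolding T_def by (rule SSt[OF N12 that])
    have S1S2: "\<bar>S1 y - S2 y\<bar> \<le> t" if "y \<in> space P" for y
      using SSt[of "N2 i - N1 i" i y] that unfolding S1_def S2_def split2 by auto
    have SS2: "\<bar>S y - S2 y\<bar> \<le> t" if "y \<in> space P" for y
    proof -
      have "S y - S2 y = SS (N2 i) y"
        unfolding S_eq S2_def SS_def using fin by (subst sum.subset_diff[of "N2 i" I]) (auto simp: N2_def)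
      then show ?thesis using SSt[of "N2 i" i y] that by simp
    qed
    have ut: "u * z \<le> t" if "z \<le> t" "0 \<le> z" for z
      using mult_mono[of u 1 z t] u t that by simp
    have e1: "\<bar>(\<integral>y. x i y * sin (u * S y + b) - x i y * sin (u * S1 y + b) - u * (x i y * T y * cos (u * S1 y + b)) \<partial>P)\<bar> \<le> D * t\<^sup>2"
    proof (rule abs_integral_le)
      fix y assume y: "y \<in> space P"
      have "u * S y + b = (u * S1 y + b) + u * T y"
        by (simp add: split1[of y i] S1_def T_def algebra_simps)
      then have "\<bar>sin (u * S y + b) - sin (u * S1 y + b) - u * T y * cos (u * S1 y + b)\<bar> \<le> (u * T y)\<^sup>2"
        using sin_linear_approx[of "u * S1 y + b" "u * T y"] by (simp only:)
      also have "\<dots> = \<bar>u * T y\<bar>\<^sup>2" by simp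
      also have "\<dots> \<le> t\<^sup>2" using ut[of "\<bar>T y\<bar>"] T[OF y] u by (intro power_mono) (auto simp: abs_mult)
      finally have "\<bar>x i y\<bar> * \<bar>sin (u * S y + b) - sin (u * S1 y + b) - u * T y * cos (u * S1 y + b)\<bar> \<le> D * t\<^sup>2"
        using xD[OF y] D0 by (intro mult_mono) auto
      then show "\<bar>x i y * sin (u * S y + b) - x i y * sin (u * S1 y + b) - u * (x i y * T y * cos (u * S1 y + b))\<bar> \<le> D * t\<^sup>2"
        unfolding abs_mult[symmetric] by (simp add: algebra_simps)
    qed (intro brv')
    have e2: "\<bar>(\<integral>y. x i y * T y * cos (u * S1 y + b) - x i y * T y * cos (u * S2 y + b) \<partial>P)\<bar> \<le> D * t\<^sup>2"
    proof (rule abs_integral_le)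
      fix y assume y: "y \<in> space P"
      have "\<bar>cos (u * S1 y + b) - cos (u * S2 y + b)\<bar> \<le> \<bar>(u * S1 y + b) - (u * S2 y + b)\<bar>"
        by (rule abs_cos_diff_le)
      also have "\<dots> = u * \<bar>S1 y - S2 y\<bar>" using u by (simp add: abs_mult right_diff_distrib[symmetric])
      also have "\<dots> \<le> t" using S1S2[OF y] by (intro ut) auto
      finally have "\<bar>x i y\<bar> * (\<bar>T y\<bar> * \<bar>cos (u * S1 y + b) - cos (u * S2 y + b)\<bar>) \<le> D * (t * t)"
        using xD[OF y] D0 T[OF y] t by (intro mult_mono) auto
      then show "\<bar>x i y * T y * cos (u * S1 y + b) - x i y * T y * cos (u * S2 y + b)\<bar> \<le> D * t\<^sup>2"
        unfolding abs_mult[symmetric] by (simp add: algebra_simps power2_eq_square)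
    qed (intro brv')
    have e3: "\<bar>(\<integral>y. cos (u * S2 y + b) - cos (u * S y + b) \<partial>P)\<bar> \<le> t"
    proof (rule abs_integral_le)
      fix y assume y: "y \<in> space P"
      have "\<bar>cos (u * S2 y + b) - cos (u * S y + b)\<bar> \<le> \<bar>(u * S2 y + b) - (u * S y + b)\<bar>"
        by (rule abs_cos_diff_le)
      also have "\<dots> = u * \<bar>S y - S2 y\<bar>" using u by (simp add: abs_mult right_diff_distrib[symmetric] abs_minus_commute)
      also have "\<dots> \<le> t" using SS2[OF y] by (intro ut) auto
      finally show "\<bar>cos (u * S2 y + b) - cos (u * S y + b)\<bar> \<le> t" .
    qed (intro brv')
    have wD: "\<bar>w i\<bar> \<le> D * t"
      unfolding w_def
    proof (rule abs_integral_le)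
      fix y assume y: "y \<in> space P"
      show "\<bar>x i y * SS (N1 i) y\<bar> \<le> D * t"
        unfolding abs_mult using xD[OF y] D0 T[OF y] by (intro mult_mono) (auto simp: T_def)
    qed (intro brvs xb SSb)
    have i1: "(\<integral>y. x i y * sin (u * S1 y + b) \<partial>P) = 0"
    proof -
      have "(\<integral>y. x i y * sin (u * S1 y + b) \<partial>P) = (\<integral>y. x i y \<partial>P) * (\<integral>y. sin (u * S1 y + b) \<partial>P)"
      proof (rule integral_mult_dep[OF xb dx _ _ disj1])
        show "brv P (\<lambda>y. sin (u * S1 y + b))" by (intro brv')
        show "dep (\<Union>j\<in>I - N1 i. (+) j ` lattice_box m) (\<lambda>y. sin (u * S1 y + b))"
          unfolding S1_def by (rule dep_compose[OF dSS, of _ _ "\<lambda>z. sin (u * z + b)"]) auto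
      qed
      then show ?thesis by (simp add: x0)
    qed
    have i2: "(\<integral>y. x i y * T y * cos (u * S2 y + b) \<partial>P) = w i * (\<integral>y. cos (u * S2 y + b) \<partial>P)"
      unfolding w_def T_def
    proof (rule integral_mult_dep[OF _ dxT _ _ disj2])
      show "brv P (\<lambda>y. x i y * SS (N1 i) y)" by (intro brvs xb SSb)
      show "brv P (\<lambda>y. cos (u * S2 y + b))" by (intro brv')
      show "dep (\<Union>j\<in>I - N2 i. (+) j ` lattice_box m) (\<lambda>y. cos (u * S2 y + b))"
        unfolding S2_def by (rule dep_compose[OF dSS, of _ _ "\<lambda>z. cos (u * z + b)"]) auto
    qed
    have f1: "\<bar>A i u - u * (\<integral>y. x i y * T y * cos (u * S1 y + b) \<partial>P)\<bar> \<le> D * t\<^sup>2"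
      using e1 i1 unfolding A_def
      by (subst (asm) Bochner_Integration.integral_diff, intro ps.brv_integrable brv', intro ps.brv_integrable brv',
          subst (asm) Bochner_Integration.integral_diff, intro ps.brv_integrable brv', intro ps.brv_integrable brv') simp
    have f2: "\<bar>(\<integral>y. x i y * T y * cos (u * S1 y + b) \<partial>P) - w i * (\<integral>y. cos (u * S2 y + b) \<partial>P)\<bar> \<le> D * t\<^sup>2"
      using e2 i2
      by (subst (asm) Bochner_Integration.integral_diff, intro ps.brv_integrable brv', intro ps.brv_integrable brv') simp
    have "\<bar>(\<integral>y. cos (u * S2 y + b) \<partial>P) - c u\<bar> \<le> t"
      using e3 unfolding c_def
      by (subst (asm) Bochner_Integration.integral_diff, intro ps.brv_integrable brv', intro ps.brv_integrable brv') simp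
    then have f3: "\<bar>w i\<bar> * \<bar>(\<integral>y. cos (u * S2 y + b) \<partial>P) - c u\<bar> \<le> D * t * t"
      using wD by (intro mult_mono) auto
    have f23: "\<bar>(\<integral>y. x i y * T y * cos (u * S1 y + b) \<partial>P) - w i * c u\<bar> \<le> 2 * D * t\<^sup>2"
    proof -
      have "\<bar>w i * (\<integral>y. cos (u * S2 y + b) \<partial>P) - w i * c u\<bar> \<le> D * t\<^sup>2"
        using f3 unfolding abs_mult[symmetric] by (simp add: right_diff_distrib power2_eq_square mult.assoc)
      with f2 show ?thesis by linarith
    qed
    have "u * \<bar>(\<integral>y. x i y * T y * cos (u * S1 y + b) \<partial>P) - w i * c u\<bar> \<le> 1 * (2 * D * t\<^sup>2)"
      using u f23 by (intro mult_mono) auto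
    then have "\<bar>u * (\<integral>y. x i y * T y * cos (u * S1 y + b) \<partial>P) - u * w i * c u\<bar> \<le> 2 * D * t\<^sup>2"
      using u by (simp add: abs_mult right_diff_distrib[symmetric] mult.assoc)
    with f1 show ?thesis by linarith
  qed
  obtain KS where KS: "\<And>y. y \<in> space P \<Longrightarrow> \<bar>S y\<bar> \<le> KS" using brvE[OF Sb] by blast
  have der: "(c has_real_derivative - (\<Sum>i\<in>I. a i * A i u)) (at u)" for u
  proof (rule has_derivative_of_quadratic_bound)
    fix s
    have "c (u + s) - c u - s * - (\<Sum>i\<in>I. a i * A i u)
       = (\<integral>y. cos ((u + s) * S y + b) - cos (u * S y + b) + s * (S y * sin (u * S y + b)) \<partial>P)"
    proof -
      have "(\<Sum>i\<in>I. a i * A i u) = (\<integral>y. (\<Sum>i\<in>I. a i * (x i y * sin (u * S y + b))) \<partial>P)"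
        unfolding A_def by (subst Bochner_Integration.integral_sum) (auto intro!: ps.brv_integrable brvs xb Sb)
      also have "\<dots> = (\<integral>y. S y * sin (u * S y + b) \<partial>P)"
        by (simp only: Sx)
      finally have "(\<Sum>i\<in>I. a i * A i u) = (\<integral>y. S y * sin (u * S y + b) \<partial>P)" .
      then show ?thesis unfolding c_def
        by (subst Bochner_Integration.integral_add, intro ps.brv_integrable brvs Sb, intro ps.brv_integrable brvs Sb,
            subst Bochner_Integration.integral_diff, intro ps.brv_integrable brvs Sb, intro ps.brv_integrable brvs Sb) simp
    qed
    also have "\<bar>\<dots>\<bar> \<le> KS\<^sup>2 * s\<^sup>2"
    proof (rule abs_integral_le)
      fix y assume y: "y \<in> space P"
      have "\<bar>cos ((u + s) * S y + b) - cos (u * S y + b) + s * S y * sin (u * S y + b)\<bar> \<le> (s * S y)\<^sup>2"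
        using cos_linear_approx[of "u * S y + b" "s * S y"] by (simp add: algebra_simps)
      also have "\<dots> = \<bar>S y\<bar>\<^sup>2 * s\<^sup>2" by (simp add: power_mult_distrib)
      also have "\<dots> \<le> KS\<^sup>2 * s\<^sup>2" using KS[OF y] by (intro mult_right_mono power_mono) auto
      finally show "\<bar>cos ((u + s) * S y + b) - cos (u * S y + b) + s * (S y * sin (u * S y + b))\<bar> \<le> KS\<^sup>2 * s\<^sup>2"
        by (simp add: mult.assoc)
    qed (intro brvs Sb)
    finally show "\<bar>c (u + s) - c u - s * - (\<Sum>i\<in>I. a i * A i u)\<bar> \<le> KS\<^sup>2 * s\<^sup>2" .
  qed
  have "\<bar>c 1 - exp (- v / 2) * c 0\<bar> \<le> 3 * real (card I) * \<alpha> * D * t\<^sup>2"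
  proof (rule gaussian_ode[OF der])
    show "0 \<le> v" by (simp add: v_def)
    fix u :: real assume u: "0 \<le> u" "u \<le> 1"
    have "- (\<Sum>i\<in>I. a i * A i u) + u * v * c u = - (\<Sum>i\<in>I. a i * (A i u - u * w i * c u))"
      unfolding v_eq by (simp add: sum_subtractf sum_distrib_left sum_distrib_right right_diff_distrib mult_ac)
    then have "\<bar>- (\<Sum>i\<in>I. a i * A i u) + u * v * c u\<bar> \<le> (\<Sum>i\<in>I. \<bar>a i * (A i u - u * w i * c u)\<bar>)"
      by simp
    also have "\<dots> \<le> (\<Sum>i\<in>I. \<alpha> * (3 * D * t\<^sup>2))"
      unfolding abs_mult using key[OF u] a al by (intro sum_mono mult_mono) auto
    also have "\<dots> = 3 * real (card I) * \<alpha> * D * t\<^sup>2" by simp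
    finally show "\<bar>- (\<Sum>i\<in>I. a i * A i u) + u * v * c u\<bar> \<le> 3 * real (card I) * \<alpha> * D * t\<^sup>2" .
  qed
  moreover have "c 0 = cos b" by (simp add: c_def ps.prob_space)
  ultimately show ?thesis by (simp add: c_def[of 1] v_def t_def)
qed

end

subsection \<open>Fields with geometrically good local approximations\<close>

lemma exp_neg_diff_le:
  fixes x y :: real
  assumes "0 \<le> x" "0 \<le> y" shows "\<bar>exp (- x) - exp (- y)\<bar> \<le> \<bar>x - y\<bar>"
proof -
  have *: "exp (- a) - exp (- b) \<le> b - a" if "0 \<le> a" "a \<le> b" for a b :: real
  proof -
    have "exp (- a) - exp (- b) = exp (- a) * (1 - exp (- (b - a)))"
      by (simp add: right_diff_distrib exp_add[symmetric])
    also have "\<dots> \<le> 1 * (b - a)"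
    proof (rule mult_mono)
      show "1 - exp (- (b - a)) \<le> b - a" using exp_ge_add_one_self[of "- (b - a)"] by linarith
    qed (use that in auto)
    finally show ?thesis by simp
  qed
  show ?thesis
  proof (cases "x \<le> y")
    case True
    moreover have "exp (- y) \<le> exp (- x)" using True by simp
    ultimately show ?thesis using *[of x y] assms by simp
  next
    case False
    moreover have "exp (- x) \<le> exp (- y)" using False by simp
    ultimately show ?thesis using *[of y x] assms by simp
  qed
qed

text \<open>Young's inequality 2 |f| |f - g| \<le> t f^2 + (f - g)^2 / t. The free parameter t is
  later taken as a power of the approximation rate.\<close>

lemma (in prob_space) integral_square_diff_le:
  assumes f: "brv M f" and g: "brv M g"
    and t: "0 < t" and fg: "(\<integral>x. (f x - g x)\<^sup>2 \<partial>M) \<le> e"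
  shows "\<bar>(\<integral>x. (f x)\<^sup>2 \<partial>M) - (\<integral>x. (g x)\<^sup>2 \<partial>M)\<bar> \<le> (1 + 1 / t) * e + t * (\<integral>x. (f x)\<^sup>2 \<partial>M)"
proof -
  note i = brv_integrable brvs f g
  have "\<bar>(\<integral>x. (f x)\<^sup>2 \<partial>M) - (\<integral>x. (g x)\<^sup>2 \<partial>M)\<bar> = \<bar>\<integral>x. (f x)\<^sup>2 - (g x)\<^sup>2 \<partial>M\<bar>"
    by (subst Bochner_Integration.integral_diff, intro i, intro i) simp
  also have "\<dots> \<le> (\<integral>x. \<bar>(f x)\<^sup>2 - (g x)\<^sup>2\<bar> \<partial>M)" by (rule integral_abs_bound)
  also have "\<dots> \<le> (\<integral>x. (1 + 1 / t) * (f x - g x)\<^sup>2 + t * (f x)\<^sup>2 \<partial>M)"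
  proof (rule integral_mono)
    fix x
    define a where "a = f x - g x"
    have "(f x)\<^sup>2 - (g x)\<^sup>2 = 2 * f x * a - a\<^sup>2" by (simp add: a_def power2_eq_square algebra_simps)
    then have "\<bar>(f x)\<^sup>2 - (g x)\<^sup>2\<bar> \<le> 2 * \<bar>f x\<bar> * \<bar>a\<bar> + a\<^sup>2"
      using abs_triangle_ineq4[of "2 * f x * a" "a\<^sup>2"] by (simp add: abs_mult)
    moreover have "2 * \<bar>f x\<bar> * \<bar>a\<bar> \<le> t * (f x)\<^sup>2 + a\<^sup>2 / t"
    proof -
      have "0 \<le> (t * \<bar>f x\<bar> - \<bar>a\<bar>)\<^sup>2 / t" using t by simp
      also have "\<dots> = t * (f x)\<^sup>2 + a\<^sup>2 / t - 2 * \<bar>f x\<bar> * \<bar>a\<bar>"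
        using t by (simp add: power2_diff power_mult_distrib field_simps power2_eq_square)
      finally show ?thesis by simp
    qed
    ultimately show "\<bar>(f x)\<^sup>2 - (g x)\<^sup>2\<bar> \<le> (1 + 1 / t) * (f x - g x)\<^sup>2 + t * (f x)\<^sup>2"
      unfolding a_def[symmetric] by (simp add: algebra_simps)
  qed (intro i)+
  also have "\<dots> = (1 + 1 / t) * (\<integral>x. (f x - g x)\<^sup>2 \<partial>M) + t * (\<integral>x. (f x)\<^sup>2 \<partial>M)"
    by (subst Bochner_Integration.integral_add, intro i, intro i) simp
  also have "\<dots> \<le> (1 + 1 / t) * e + t * (\<integral>x. (f x)\<^sup>2 \<partial>M)"
    using fg t by (intro add_right_mono mult_left_mono) auto
  finally show ?thesis .
qed

text \<open>Isolates what the probabilistic part needs from the factor map. The inequality \<rho>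
  sqrt(2^d) < 1 says that approximation beats the cost of dependence; the radius 2 * 2^l leaves room
  for a window and a coding radius of at most 2^l each. The exponent 4d is written as 2h with h = 2d
  to fit the even-moment lemmas.\<close>

locale approx_field = iid_space L P
  for L :: "'l measure" and P :: "(int^'d::finite \<Rightarrow> 'l) measure" +
  fixes Z :: "(int^'d \<Rightarrow> 'l) \<Rightarrow> real" and C \<rho> :: real and m :: "nat \<Rightarrow> nat"
  assumes Z: "brv P Z" and Z0: "(\<integral>y. Z y \<partial>P) = 0"
    and C: "0 \<le> C" and \<rho>: "0 < \<rho>" "\<rho> * sqrt (2 ^ CARD('d)) < 1"
    and m: "\<And>l. m l \<le> 2 * 2 ^ l"
    and approx: "\<And>l. (\<integral>y. \<bar>Z y - trunc (lattice_box (m l)) Z y\<bar> ^ (2 * (2 * CARD('d))) \<partial>P) \<le> (C * \<rho> ^ l) ^ (2 * (2 * CARD('d)))"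
begin

abbreviation T :: "nat \<Rightarrow> (int^'d \<Rightarrow> 'l) \<Rightarrow> real" where
  "T l \<equiv> trunc (lattice_box (m l)) Z"

definition wsum :: "((int^'d \<Rightarrow> 'l) \<Rightarrow> real) \<Rightarrow> (int^'d) set \<Rightarrow> (int^'d \<Rightarrow> real) \<Rightarrow> (int^'d \<Rightarrow> 'l) \<Rightarrow> real" where
  "wsum f I a y = (\<Sum>i\<in>I. a i * f (shift i y))"

lemma brv_wsum: "brv P f \<Longrightarrow> brv P (wsum f I a)"
  unfolding wsum_def[abs_def] by (intro brv_sum brv_mult brv_const brv_shift)

lemma wsum_diff: "wsum (\<lambda>y. f y - g y) I a y = wsum f I a y - wsum g I a y"
  by (simp add: wsum_def right_diff_distrib sum_subtractf)

text \<open>Ratio between consecutive levels: the gain \<rho> in approximation times the loss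
  sqrt(2^d) from doubling the box radius.\<close>

definition "\<theta> = \<rho> * sqrt (2 ^ CARD('d))"

text \<open>An increment has norm at most 2 C \<rho>^l. It reads a box of radius m = 4 * 2^l, for
  which 4m + 1 \<le> 17 * 2^l bounds the number of residues per coordinate.\<close>

definition "K1 = 2 * C * sqrt (4 ^ (2 * CARD('d)) * 17 ^ CARD('d))"

lemma \<theta>: "0 < \<theta>" "\<theta> < 1"
  using \<rho> by (auto simp: \<theta>_def)

lemma K1: "0 \<le> K1"
  using C by (simp add: K1_def)

lemma \<rho>_lt_1: "\<rho> < 1"
proof -
  have "1 \<le> sqrt (2 ^ CARD('d))" by (simp add: one_le_power)
  then have "\<rho> * 1 \<le> \<rho> * sqrt (2 ^ CARD('d))" using \<rho>(1) by (intro mult_left_mono) simp_all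
  then show ?thesis using \<rho>(2) by linarith
qed

lemma brv_T: "brv P (T l)"
  by (rule brv_trunc[OF Z])

text \<open>The increment of two consecutive truncations is local at the scale of the finer one, is
  centred because truncation preserves the mean, and is small as a difference of two approximation
  errors. Thus \<open>moment_local\<close> applies.\<close>

lemma moment_level:
  assumes "finite I"
  shows "(\<integral>y. \<bar>wsum (\<lambda>y. T (Suc l) y - T l y) I a y\<bar> ^ (2 * (2 * CARD('d))) \<partial>P)
    \<le> (K1 * \<theta> ^ l * sqrt (\<Sum>i\<in>I. (a i)\<^sup>2)) ^ (2 * (2 * CARD('d)))"
proof -
  define U where "U = (\<lambda>y. T (Suc l) y - T l y)"
  have U: "brv P U" unfolding U_def by (intro brvs brv_T)
  have "dep (lattice_box (4 * 2 ^ l)) U"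
    unfolding U_def
  proof (rule dep_diff)
    show "dep (lattice_box (4 * 2 ^ l)) (T (Suc l))"
      using m[of "Suc l"] by (intro dep_mono[OF dep_trunc[OF Z]] lattice_box_mono) simp
    show "dep (lattice_box (4 * 2 ^ l)) (T l)"
      using m[of l] by (intro dep_mono[OF dep_trunc[OF Z]] lattice_box_mono) simp
  qed
  moreover have "(\<integral>y. U y \<partial>P) = 0"
    unfolding U_def
    by (subst Bochner_Integration.integral_diff, intro ps.brv_integrable brv_T, intro ps.brv_integrable brv_T)
      (simp add: integral_trunc[OF Z])
  moreover have "(\<integral>y. \<bar>U y\<bar> ^ (2 * (2 * CARD('d))) \<partial>P) \<le> (2 * C * \<rho> ^ l) ^ (2 * (2 * CARD('d)))"
  proof -
    have "(\<integral>y. \<bar>(Z y - T l y) + - (Z y - T (Suc l) y)\<bar> ^ (2 * (2 * CARD('d))) \<partial>P) \<le> (C * \<rho> ^ l + C * \<rho> ^ l) ^ (2 * (2 * CARD('d)))"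
    proof (rule ps.Minkowski_brv)
      show "0 \<le> C * \<rho> ^ l" "0 \<le> C * \<rho> ^ l" using C \<rho> by auto
      show "(\<integral>y. \<bar>Z y - T l y\<bar> ^ (2 * (2 * CARD('d))) \<partial>P) \<le> (C * \<rho> ^ l) ^ (2 * (2 * CARD('d)))" by (rule approx)
      have "C * \<rho> ^ Suc l \<le> C * \<rho> ^ l"
        using C \<rho>(1) \<rho>_lt_1 by (intro mult_left_mono power_decreasing) auto
      then have "(C * \<rho> ^ Suc l) ^ (2 * (2 * CARD('d))) \<le> (C * \<rho> ^ l) ^ (2 * (2 * CARD('d)))"
        by (rule power_mono) (use C \<rho> in simp)
      then show "(\<integral>y. \<bar>- (Z y - T (Suc l) y)\<bar> ^ (2 * (2 * CARD('d))) \<partial>P) \<le> (C * \<rho> ^ l) ^ (2 * (2 * CARD('d)))"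
        using approx[of "Suc l"] by (simp only: abs_minus_cancel)
    qed (intro brvs Z brv_T)+
    moreover have "Z y - T l y + - (Z y - T (Suc l) y) = U y" for y by (simp add: U_def)
    moreover have "C * \<rho> ^ l + C * \<rho> ^ l = 2 * C * \<rho> ^ l" by simp
    ultimately show ?thesis by (simp only:)
  qed
  ultimately have "(\<integral>y. \<bar>\<Sum>i\<in>I. a i * U (shift i y)\<bar> ^ (2 * (2 * CARD('d))) \<partial>P) \<le>
      ((2 * C * \<rho> ^ l) * sqrt (4 ^ (2 * CARD('d)) * real (4 * (4 * 2 ^ l) + 1) ^ CARD('d)) * sqrt (\<Sum>i\<in>I. (a i)\<^sup>2)) ^ (2 * (2 * CARD('d)))"
    using C \<rho> assms by (intro moment_local U) auto
  also have "\<dots> \<le> (K1 * \<theta> ^ l * sqrt (\<Sum>i\<in>I. (a i)\<^sup>2)) ^ (2 * (2 * CARD('d)))"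
  proof (intro power_mono mult_right_mono)
    have "real (4 * (4 * 2 ^ l) + 1) \<le> 17 * 2 ^ l" by simp
    then have "real (4 * (4 * 2 ^ l) + 1) ^ CARD('d) \<le> (17 * 2 ^ l) ^ CARD('d)" by (intro power_mono) auto
    then have "sqrt (4 ^ (2 * CARD('d)) * real (4 * (4 * 2 ^ l) + 1) ^ CARD('d))
        \<le> sqrt (4 ^ (2 * CARD('d)) * (17 * 2 ^ l) ^ CARD('d))"
      by (intro real_sqrt_le_mono mult_left_mono) auto
    also have "\<dots> = sqrt (4 ^ (2 * CARD('d)) * 17 ^ CARD('d)) * sqrt (2 ^ CARD('d)) ^ l"
      by (simp add: real_sqrt_mult power_mult_distrib real_sqrt_power power_mult[symmetric] mult.commute)
    finally have "2 * C * \<rho> ^ l * sqrt (4 ^ (2 * CARD('d)) * real (4 * (4 * 2 ^ l) + 1) ^ CARD('d))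
        \<le> 2 * C * \<rho> ^ l * (sqrt (4 ^ (2 * CARD('d)) * 17 ^ CARD('d)) * sqrt (2 ^ CARD('d)) ^ l)"
      using C \<rho> by (intro mult_left_mono) auto
    then show "2 * C * \<rho> ^ l * sqrt (4 ^ (2 * CARD('d)) * real (4 * (4 * 2 ^ l) + 1) ^ CARD('d)) \<le> K1 * \<theta> ^ l"
      by (simp add: K1_def \<theta>_def power_mult_distrib mult_ac)
  qed (use C \<rho> in \<open>auto simp: sum_nonneg\<close>)
  finally show ?thesis by (simp only: U_def wsum_def)
qed

lemma moment_tail_finite:
  assumes "finite I"
  shows "(\<integral>y. \<bar>wsum (\<lambda>y. T (l + k) y - T l y) I a y\<bar> ^ (2 * (2 * CARD('d))) \<partial>P)
    \<le> (K1 * \<theta> ^ l / (1 - \<theta>) * sqrt (\<Sum>i\<in>I. (a i)\<^sup>2)) ^ (2 * (2 * CARD('d)))"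
proof -
  define s where "s = sqrt (\<Sum>i\<in>I. (a i)\<^sup>2)"
  have s: "0 \<le> s" by (simp add: s_def sum_nonneg)
  have "wsum (\<lambda>y. T (l + k) y - T l y) I a y = (\<Sum>j<k. wsum (\<lambda>y. T (Suc (l + j)) y - T (l + j) y) I a y)" for y
    unfolding wsum_diff by (induction k) simp_all
  then have "(\<integral>y. \<bar>wsum (\<lambda>y. T (l + k) y - T l y) I a y\<bar> ^ (2 * (2 * CARD('d))) \<partial>P)
      = (\<integral>y. \<bar>\<Sum>j<k. wsum (\<lambda>y. T (Suc (l + j)) y - T (l + j) y) I a y\<bar> ^ (2 * (2 * CARD('d))) \<partial>P)" by simp
  also have "\<dots> \<le> (\<Sum>j<k. K1 * \<theta> ^ (l + j) * s) ^ (2 * (2 * CARD('d)))"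
  proof (rule ps.Minkowski_brv_sum)
    fix j
    show "(\<integral>y. \<bar>wsum (\<lambda>y. T (Suc (l + j)) y - T (l + j) y) I a y\<bar> ^ (2 * (2 * CARD('d))) \<partial>P) \<le> (K1 * \<theta> ^ (l + j) * s) ^ (2 * (2 * CARD('d)))"
      unfolding s_def by (rule moment_level[OF assms])
    show "0 \<le> K1 * \<theta> ^ (l + j) * s" using K1 \<theta> s by simp
    show "brv P (\<lambda>y. wsum (\<lambda>y. T (Suc (l + j)) y - T (l + j) y) I a y)"
      by (intro brv_wsum brvs brv_T)
  qed auto
  also have "\<dots> \<le> (K1 * \<theta> ^ l / (1 - \<theta>) * s) ^ (2 * (2 * CARD('d)))"
  proof (rule power_mono)
    have "(\<Sum>j<k. K1 * \<theta> ^ (l + j) * s) = K1 * \<theta> ^ l * s * (\<Sum>j<k. \<theta> ^ j)"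
      by (simp add: sum_distrib_left power_add mult_ac)
    also have "(\<Sum>j<k. \<theta> ^ j) \<le> 1 / (1 - \<theta>)"
    proof -
      have "(\<Sum>j<k. \<theta> ^ j) = (1 - \<theta> ^ k) / (1 - \<theta>)"
        using \<theta> by (subst sum_gp_strict) auto
      also have "\<dots> \<le> 1 / (1 - \<theta>)" using \<theta> by (intro divide_right_mono) auto
      finally show ?thesis .
    qed
    then have "K1 * \<theta> ^ l * s * (\<Sum>j<k. \<theta> ^ j) \<le> K1 * \<theta> ^ l * s * (1 / (1 - \<theta>))"
      using K1 \<theta> s by (intro mult_left_mono) auto
    finally show "(\<Sum>j<k. K1 * \<theta> ^ (l + j) * s) \<le> K1 * \<theta> ^ l / (1 - \<theta>) * s" by simp
    show "0 \<le> (\<Sum>j<k. K1 * \<theta> ^ (l + j) * s)" using K1 \<theta> s by (intro sum_nonneg) auto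
  qed
  finally show ?thesis by (simp only: s_def)
qed

text \<open>Telescoping reaches any finite level l + k with a constant independent of k. For fixed
  weights the rest is at most the l^1 norm of the weights times C \<rho>^(l+k), which vanishes as k
  grows; this avoids any discussion of convergence of the infinite series.\<close>

lemma moment_tail:
  assumes "finite I"
  shows "(\<integral>y. \<bar>wsum (\<lambda>y. Z y - T l y) I a y\<bar> ^ (2 * (2 * CARD('d))) \<partial>P)
    \<le> (K1 * \<theta> ^ l / (1 - \<theta>) * sqrt (\<Sum>i\<in>I. (a i)\<^sup>2)) ^ (2 * (2 * CARD('d)))"
proof (rule le_power_if_le_add_eps)
  define s where "s = sqrt (\<Sum>i\<in>I. (a i)\<^sup>2)"
  define r where "r = (\<Sum>i\<in>I. \<bar>a i\<bar>)"
  have s: "0 \<le> s" "0 \<le> r" by (auto simp: s_def r_def sum_nonneg)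
  show "0 \<le> K1 * \<theta> ^ l / (1 - \<theta>) * sqrt (\<Sum>i\<in>I. (a i)\<^sup>2)"
    using K1 \<theta> s by (auto simp: s_def)
  fix e :: real assume e: "0 < e"
  have "(\<lambda>N. r * C * \<rho> ^ N) \<longlonglongrightarrow> r * C * 0"
    using \<rho> \<rho>_lt_1 by (intro tendsto_mult tendsto_const LIMSEQ_realpow_zero) auto
  then have "\<forall>\<^sub>F N in sequentially. r * C * \<rho> ^ N < e"
    using e by (intro order_tendstoD) auto
  then obtain N0 where N0: "r * C * \<rho> ^ N < e" if "N \<ge> N0" for N
    by (auto simp: eventually_sequentially)
  define k where "k = N0"
  have "(\<integral>y. \<bar>wsum (\<lambda>y. T (l + k) y - T l y) I a y + wsum (\<lambda>y. Z y - T (l + k) y) I a y\<bar> ^ (2 * (2 * CARD('d))) \<partial>P)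
     \<le> (K1 * \<theta> ^ l / (1 - \<theta>) * s + r * (C * \<rho> ^ (l + k))) ^ (2 * (2 * CARD('d)))"
  proof (rule ps.Minkowski_brv)
    show "(\<integral>y. \<bar>wsum (\<lambda>y. T (l + k) y - T l y) I a y\<bar> ^ (2 * (2 * CARD('d))) \<partial>P) \<le> (K1 * \<theta> ^ l / (1 - \<theta>) * s) ^ (2 * (2 * CARD('d)))"
      unfolding s_def by (rule moment_tail_finite[OF assms])
    have "(\<integral>y. \<bar>\<Sum>i\<in>I. a i * (Z (shift i y) - T (l + k) (shift i y))\<bar> ^ (2 * (2 * CARD('d))) \<partial>P) \<le> (\<Sum>i\<in>I. \<bar>a i\<bar> * (C * \<rho> ^ (l + k))) ^ (2 * (2 * CARD('d)))"
    proof (rule ps.Minkowski_brv_sum[OF assms])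
      fix i
      show "brv P (\<lambda>y. a i * (Z (shift i y) - T (l + k) (shift i y)))"
        by (intro brvs brv_shift Z brv_T)
      show "0 \<le> \<bar>a i\<bar> * (C * \<rho> ^ (l + k))" using C \<rho> by simp
      have "(\<integral>y. \<bar>a i * (Z (shift i y) - T (l + k) (shift i y))\<bar> ^ (2 * (2 * CARD('d))) \<partial>P)
          = \<bar>a i\<bar> ^ (2 * (2 * CARD('d))) * (\<integral>y. \<bar>Z (shift i y) - T (l + k) (shift i y)\<bar> ^ (2 * (2 * CARD('d))) \<partial>P)"
        by (simp only: abs_mult power_mult_distrib integral_mult_right_zero)
      also have "(\<integral>y. \<bar>Z (shift i y) - T (l + k) (shift i y)\<bar> ^ (2 * (2 * CARD('d))) \<partial>P) = (\<integral>y. \<bar>Z y - T (l + k) y\<bar> ^ (2 * (2 * CARD('d))) \<partial>P)"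
        by (rule integral_shift[of "\<lambda>y. \<bar>Z y - T (l + k) y\<bar> ^ (2 * (2 * CARD('d)))"]) (intro brv_measurable brvs Z brv_T)
      also have "\<bar>a i\<bar> ^ (2 * (2 * CARD('d))) * \<dots> \<le> \<bar>a i\<bar> ^ (2 * (2 * CARD('d))) * (C * \<rho> ^ (l + k)) ^ (2 * (2 * CARD('d)))"
        by (intro mult_left_mono approx) simp
      finally show "(\<integral>y. \<bar>a i * (Z (shift i y) - T (l + k) (shift i y))\<bar> ^ (2 * (2 * CARD('d))) \<partial>P) \<le> (\<bar>a i\<bar> * (C * \<rho> ^ (l + k))) ^ (2 * (2 * CARD('d)))"
        by (simp only: power_mult_distrib)
    qed simp
    then show "(\<integral>y. \<bar>wsum (\<lambda>y. Z y - T (l + k) y) I a y\<bar> ^ (2 * (2 * CARD('d))) \<partial>P) \<le> (r * (C * \<rho> ^ (l + k))) ^ (2 * (2 * CARD('d)))"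
      by (simp only: wsum_def r_def sum_distrib_right)
    show "0 \<le> K1 * \<theta> ^ l / (1 - \<theta>) * s" using K1 \<theta> s by simp
    show "0 \<le> r * (C * \<rho> ^ (l + k))" using C \<rho> s by simp
    show "brv P (wsum (\<lambda>y. T (l + k) y - T l y) I a)" "brv P (wsum (\<lambda>y. Z y - T (l + k) y) I a)"
      by (intro brv_wsum brvs Z brv_T)+
  qed
  also have "(\<lambda>y. wsum (\<lambda>y. T (l + k) y - T l y) I a y + wsum (\<lambda>y. Z y - T (l + k) y) I a y)
    = wsum (\<lambda>y. Z y - T l y) I a"
    by (rule ext) (simp add: wsum_diff)
  finally have "(\<integral>y. \<bar>wsum (\<lambda>y. Z y - T l y) I a y\<bar> ^ (2 * (2 * CARD('d))) \<partial>P)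
     \<le> (K1 * \<theta> ^ l / (1 - \<theta>) * s + r * (C * \<rho> ^ (l + k))) ^ (2 * (2 * CARD('d)))" by (simp add: fun_eq_iff)
  also have "\<dots> \<le> (K1 * \<theta> ^ l / (1 - \<theta>) * s + e) ^ (2 * (2 * CARD('d)))"
    using N0[of "l + k"] K1 \<theta> s C \<rho> by (intro power_mono add_left_mono add_nonneg_nonneg) (auto simp: k_def mult_ac)
  finally show "(\<integral>y. \<bar>wsum (\<lambda>y. Z y - T l y) I a y\<bar> ^ (2 * (2 * CARD('d))) \<partial>P)
     \<le> (K1 * \<theta> ^ l / (1 - \<theta>) * sqrt (\<Sum>i\<in>I. (a i)\<^sup>2) + e) ^ (2 * (2 * CARD('d)))" by (simp only: s_def)
qed

text \<open>The coarsest truncation \<open>T 0\<close> is itself a bounded centred local field of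
  fixed radius; the remainder is the tail at level 0.\<close>

lemma moment_bound:
  obtains K where "0 \<le> K"
    "\<And>I a. finite I \<Longrightarrow> (\<integral>y. \<bar>wsum Z I a y\<bar> ^ (2 * (2 * CARD('d))) \<partial>P) \<le> (K * sqrt (\<Sum>i\<in>I. (a i)\<^sup>2)) ^ (2 * (2 * CARD('d)))"
proof -
  obtain D where D: "0 \<le> D" "\<And>y. y \<in> space P \<Longrightarrow> \<bar>Z y\<bar> \<le> D" using brvE[OF Z] by blast
  define B where "B = sqrt (4 ^ (2 * CARD('d)) * real (4 * m 0 + 1) ^ CARD('d))"
  have "0 \<le> B" by (simp add: B_def)
  show thesis
  proof (rule that[of "D * B + K1 / (1 - \<theta>)"])
    show "0 \<le> D * B + K1 / (1 - \<theta>)" using D K1 \<theta> \<open>0 \<le> B\<close> by simp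
    fix I :: "(int^'d) set" and a :: "int^'d \<Rightarrow> real" assume I: "finite I"
    define s where "s = sqrt (\<Sum>i\<in>I. (a i)\<^sup>2)"
    have s: "0 \<le> s" by (simp add: s_def sum_nonneg)
    have "(\<integral>y. \<bar>wsum (T 0) I a y + wsum (\<lambda>y. Z y - T 0 y) I a y\<bar> ^ (2 * (2 * CARD('d))) \<partial>P) \<le> (D * B * s + K1 / (1 - \<theta>) * s) ^ (2 * (2 * CARD('d)))"
    proof (rule ps.Minkowski_brv)
      show "(\<integral>y. \<bar>wsum (\<lambda>y. Z y - T 0 y) I a y\<bar> ^ (2 * (2 * CARD('d))) \<partial>P) \<le> (K1 / (1 - \<theta>) * s) ^ (2 * (2 * CARD('d)))"
        using moment_tail[OF I, of 0 a] by (simp add: s_def)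
      have "(\<integral>y. \<bar>T 0 y\<bar> ^ (2 * (2 * CARD('d))) \<partial>P) \<le> D ^ (2 * (2 * CARD('d)))"
      proof (rule ps.integral_le_const)
        show "integrable P (\<lambda>y. \<bar>T 0 y\<bar> ^ (2 * (2 * CARD('d))))" by (intro ps.brv_integrable brvs brv_T)
        show "AE y in P. \<bar>T 0 y\<bar> ^ (2 * (2 * CARD('d))) \<le> D ^ (2 * (2 * CARD('d)))"
          by (rule AE_I2) (intro power_mono abs_trunc_le[OF Z] D, auto)
      qed
      then show "(\<integral>y. \<bar>wsum (T 0) I a y\<bar> ^ (2 * (2 * CARD('d))) \<partial>P) \<le> (D * B * s) ^ (2 * (2 * CARD('d)))"
        unfolding wsum_def s_def B_def
        by (intro moment_local brv_T dep_trunc[OF Z] D I) (auto simp: integral_trunc[OF Z] Z0)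
      show "0 \<le> D * B * s" "0 \<le> K1 / (1 - \<theta>) * s" using D K1 \<theta> \<open>0 \<le> B\<close> s by auto
      show "brv P (wsum (T 0) I a)" "brv P (wsum (\<lambda>y. Z y - T 0 y) I a)"
        by (intro brv_wsum brvs Z brv_T)+
    qed
    also have "(\<lambda>y. wsum (T 0) I a y + wsum (\<lambda>y. Z y - T 0 y) I a y) = wsum Z I a"
      by (rule ext) (simp add: wsum_diff)
    finally show "(\<integral>y. \<bar>wsum Z I a y\<bar> ^ (2 * (2 * CARD('d))) \<partial>P) \<le> ((D * B + K1 / (1 - \<theta>)) * sqrt (\<Sum>i\<in>I. (a i)\<^sup>2)) ^ (2 * (2 * CARD('d)))"
      by (simp add: s_def distrib_right fun_eq_iff)
  qed
qed

text \<open>The level l is a free parameter. The first error term, from replacing the field by its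
  truncation in the cosine and in the variance, is uniform in the shape of the weights. The second
  comes from Stein's method; \<open>c l\<close> grows with the box, so in applications the weights
  shrink for fixed l before l is sent to infinity.\<close>

lemma char_bound:
  obtains K \<eta> and c :: "nat \<Rightarrow> real" where "0 \<le> K" "0 < \<eta>" "\<eta> < 1" "\<And>l. 0 \<le> c l"
    "\<And>l I a \<alpha> b. finite I \<Longrightarrow> 0 \<le> \<alpha> \<Longrightarrow> (\<And>i. i \<in> I \<Longrightarrow> \<bar>a i\<bar> \<le> \<alpha>) \<Longrightarrow>
      \<bar>(\<integral>y. cos (wsum Z I a y + b) \<partial>P) - exp (- (\<integral>y. (wsum Z I a y)\<^sup>2 \<partial>P) / 2) * cos b\<bar>
        \<le> K * \<eta> ^ l * (1 + (\<Sum>i\<in>I. (a i)\<^sup>2)) + c l * real (card I) * \<alpha> ^ 3"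
proof -
  obtain D where D: "0 \<le> D" "\<And>y. y \<in> space P \<Longrightarrow> \<bar>Z y\<bar> \<le> D" using brvE[OF Z] by blast
  obtain K0 where K0: "0 \<le> K0"
    "\<And>I a. finite I \<Longrightarrow> (\<integral>y. \<bar>wsum Z I a y\<bar> ^ (2 * (2 * CARD('d))) \<partial>P) \<le> (K0 * sqrt (\<Sum>i\<in>I. (a i)\<^sup>2)) ^ (2 * (2 * CARD('d)))"
    using moment_bound by blast
  define K2 where "K2 = K1 / (1 - \<theta>)"
  have K2: "0 \<le> K2" using K1 \<theta> by (simp add: K2_def)
  define c where "c l = 3 * D * (real ((8 * m l + 1) ^ CARD('d)) * D)\<^sup>2" for l
  have q2: "2 \<le> 2 * (2 * CARD('d))" "1 \<le> 2 * (2 * CARD('d))"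
  proof -
    have "0 < CARD('d)" by simp
    then show "2 \<le> 2 * (2 * CARD('d))" "1 \<le> 2 * (2 * CARD('d))" by linarith+
  qed
  show thesis
  proof (rule that[of "K2 + 2 * K2\<^sup>2 + K0\<^sup>2" \<theta> c])
    fix l and I :: "(int^'d) set" and a :: "int^'d \<Rightarrow> real" and \<alpha> b :: real
    assume I: "finite I" and al: "0 \<le> \<alpha>" "\<And>i. i \<in> I \<Longrightarrow> \<bar>a i\<bar> \<le> \<alpha>"
    define S where "S = wsum Z I a"
    define S' where "S' = wsum (T l) I a"
    define r where "r = (\<Sum>i\<in>I. (a i)\<^sup>2)"
    have r: "0 \<le> r" by (simp add: r_def sum_nonneg)
    have Sb: "brv P S" "brv P S'" unfolding S_def S'_def by (intro brv_wsum Z brv_T)+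
    have dq: "(\<integral>y. \<bar>S y - S' y\<bar> ^ (2 * (2 * CARD('d))) \<partial>P) \<le> (K2 * \<theta> ^ l * sqrt r) ^ (2 * (2 * CARD('d)))"
      using moment_tail[OF I, of l a] by (simp add: S_def S'_def wsum_diff K2_def r_def)
    have pos: "0 \<le> K2 * \<theta> ^ l * sqrt r" using K2 \<theta> r by simp
    have d1: "(\<integral>y. \<bar>S y - S' y\<bar> \<partial>P) \<le> K2 * \<theta> ^ l * sqrt r"
      using ps.integral_abs_power_le_of_higher[OF brv_diff[OF Sb] q2(2) pos dq] by simp
    have d2: "(\<integral>y. (S y - S' y)\<^sup>2 \<partial>P) \<le> (K2 * \<theta> ^ l * sqrt r)\<^sup>2"
      using ps.integral_abs_power_le_of_higher[OF brv_diff[OF Sb] q2(1) pos dq] by simp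
    have s2: "(\<integral>y. (S y)\<^sup>2 \<partial>P) \<le> (K0 * sqrt r)\<^sup>2"
      using ps.integral_abs_power_le_of_higher[OF Sb(1) q2(1), of "K0 * sqrt r"] K0(2)[OF I, of a] K0(1) r
      by (simp add: S_def r_def)
    have e1: "\<bar>(\<integral>y. cos (S y + b) \<partial>P) - (\<integral>y. cos (S' y + b) \<partial>P)\<bar> \<le> K2 * \<theta> ^ l * (1 + r)"
    proof -
      have "\<bar>(\<integral>y. cos (S y + b) \<partial>P) - (\<integral>y. cos (S' y + b) \<partial>P)\<bar> = \<bar>\<integral>y. cos (S y + b) - cos (S' y + b) \<partial>P\<bar>"
        by (subst Bochner_Integration.integral_diff, intro ps.brv_integrable brvs Sb, intro ps.brv_integrable brvs Sb) simp
      also have "\<dots> \<le> (\<integral>y. \<bar>cos (S y + b) - cos (S' y + b)\<bar> \<partial>P)" by (rule integral_abs_bound)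
      also have "\<dots> \<le> (\<integral>y. \<bar>S y - S' y\<bar> \<partial>P)"
      proof (rule integral_mono)
        show "\<bar>cos (S y + b) - cos (S' y + b)\<bar> \<le> \<bar>S y - S' y\<bar>" for y
          using abs_cos_diff_le[of "S y + b" "S' y + b"] by simp
      qed (intro ps.brv_integrable brvs Sb)+
      also note d1
      also have "K2 * \<theta> ^ l * sqrt r \<le> K2 * \<theta> ^ l * (1 + r)"
      proof (rule mult_left_mono)
        have "0 \<le> (sqrt r - 1)\<^sup>2" by simp
        then have "2 * sqrt r \<le> 1 + r" using r by (simp add: power2_diff)
        moreover have "0 \<le> sqrt r" using r by simp
        ultimately show "sqrt r \<le> 1 + r" by linarith
      qed (use K2 \<theta> in simp)
      finally show ?thesis .
    qed
    have e2: "\<bar>(\<integral>y. cos (S' y + b) \<partial>P) - exp (- (\<integral>y. (S' y)\<^sup>2 \<partial>P) / 2) * cos b\<bar> \<le> c l * real (card I) * \<alpha> ^ 3"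
    proof -
      have "\<bar>(\<integral>y. cos (S' y + b) \<partial>P) - exp (- (\<integral>y. (S' y)\<^sup>2 \<partial>P) / 2) * cos b\<bar>
        \<le> 3 * real (card I) * \<alpha> * D * (real ((8 * m l + 1) ^ CARD('d)) * \<alpha> * D)\<^sup>2"
      proof (rule char_local[OF brv_T dep_trunc[OF Z] _ _ D(1) I al(2,1)])
        show "(\<integral>y. T l y \<partial>P) = 0" by (simp add: integral_trunc[OF Z] Z0)
        show "\<bar>T l y\<bar> \<le> D" if "y \<in> space P" for y by (rule abs_trunc_le[OF Z that D(2)])
        show "S' = (\<lambda>y. \<Sum>i\<in>I. a i * T l (shift i y))" by (simp add: S'_def wsum_def[abs_def])
      qed
      also have "\<dots> = c l * real (card I) * \<alpha> ^ 3"
        by (simp add: c_def power_mult_distrib power3_eq_cube power2_eq_square mult_ac)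
      finally show ?thesis .
    qed
    have "\<bar>exp (- (\<integral>y. (S y)\<^sup>2 \<partial>P) / 2) * cos b - exp (- (\<integral>y. (S' y)\<^sup>2 \<partial>P) / 2) * cos b\<bar>
        \<le> (2 * K2\<^sup>2 + K0\<^sup>2) * \<theta> ^ l * r"
    proof -
      \<comment> \<open>Taking \<theta>^l as the Young parameter balances the terms: the squared
        distance is of order \<theta>^(2l), and division by \<theta>^l leaves order
        \<theta>^l.\<close>
      have t: "0 < \<theta> ^ l" using \<theta> by simp
      have t1: "\<theta> ^ l \<le> 1" using \<theta> by (simp add: power_le_one)
      have sq: "(K2 * \<theta> ^ l * sqrt r)\<^sup>2 = K2\<^sup>2 * \<theta> ^ l * \<theta> ^ l * r" "(K0 * sqrt r)\<^sup>2 = K0\<^sup>2 * r"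
        using r by (simp_all add: power_mult_distrib power2_eq_square[of "\<theta> ^ l"])
      have "\<bar>exp (- (\<integral>y. (S y)\<^sup>2 \<partial>P) / 2) * cos b - exp (- (\<integral>y. (S' y)\<^sup>2 \<partial>P) / 2) * cos b\<bar>
         = \<bar>exp (- ((\<integral>y. (S y)\<^sup>2 \<partial>P) / 2)) - exp (- ((\<integral>y. (S' y)\<^sup>2 \<partial>P) / 2))\<bar> * \<bar>cos b\<bar>"
        by (simp add: abs_mult[symmetric] left_diff_distrib)
      also have "\<dots> \<le> \<bar>(\<integral>y. (S y)\<^sup>2 \<partial>P) / 2 - (\<integral>y. (S' y)\<^sup>2 \<partial>P) / 2\<bar> * 1"
        by (intro mult_mono exp_neg_diff_le abs_cos_le_one) auto
      also have "\<dots> \<le> \<bar>(\<integral>y. (S y)\<^sup>2 \<partial>P) - (\<integral>y. (S' y)\<^sup>2 \<partial>P)\<bar>"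
        by (simp add: diff_divide_distrib[symmetric])
      also have "\<dots> \<le> (1 + 1 / \<theta> ^ l) * (K2\<^sup>2 * \<theta> ^ l * \<theta> ^ l * r) + \<theta> ^ l * (\<integral>y. (S y)\<^sup>2 \<partial>P)"
        using d2 unfolding sq by (intro ps.integral_square_diff_le Sb t)
      also have "\<dots> \<le> (1 + 1 / \<theta> ^ l) * (K2\<^sup>2 * \<theta> ^ l * \<theta> ^ l * r) + \<theta> ^ l * (K0\<^sup>2 * r)"
        using s2 t unfolding sq by (intro add_left_mono mult_left_mono) auto
      also have "(1 + 1 / \<theta> ^ l) * (K2\<^sup>2 * \<theta> ^ l * \<theta> ^ l * r) = (\<theta> ^ l + 1) * (K2\<^sup>2 * \<theta> ^ l * r)"
        using t by (simp add: field_simps)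
      also have "\<dots> \<le> 2 * (K2\<^sup>2 * \<theta> ^ l * r)"
        using t t1 r by (intro mult_right_mono) auto
      finally show ?thesis by (simp add: algebra_simps)
    qed
    also have "(2 * K2\<^sup>2 + K0\<^sup>2) * \<theta> ^ l * r \<le> (2 * K2\<^sup>2 + K0\<^sup>2) * \<theta> ^ l * (1 + r)"
      using \<theta> by (intro mult_left_mono) auto
    finally have e3': "\<bar>exp (- (\<integral>y. (S y)\<^sup>2 \<partial>P) / 2) * cos b - exp (- (\<integral>y. (S' y)\<^sup>2 \<partial>P) / 2) * cos b\<bar>
        \<le> (2 * K2\<^sup>2 + K0\<^sup>2) * \<theta> ^ l * (1 + r)" .
    have "(K2 + 2 * K2\<^sup>2 + K0\<^sup>2) * \<theta> ^ l * (1 + r) = K2 * \<theta> ^ l * (1 + r) + (2 * K2\<^sup>2 + K0\<^sup>2) * \<theta> ^ l * (1 + r)"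
      by (simp add: algebra_simps)
    with e1 e2 e3' have "\<bar>(\<integral>y. cos (S y + b) \<partial>P) - exp (- (\<integral>y. (S y)\<^sup>2 \<partial>P) / 2) * cos b\<bar>
        \<le> (K2 + 2 * K2\<^sup>2 + K0\<^sup>2) * \<theta> ^ l * (1 + r) + c l * real (card I) * \<alpha> ^ 3" by linarith
    then show "\<bar>(\<integral>y. cos (wsum Z I a y + b) \<partial>P) - exp (- (\<integral>y. (wsum Z I a y)\<^sup>2 \<partial>P) / 2) * cos b\<bar>
        \<le> (K2 + 2 * K2\<^sup>2 + K0\<^sup>2) * \<theta> ^ l * (1 + (\<Sum>i\<in>I. (a i)\<^sup>2)) + c l * real (card I) * \<alpha> ^ 3"
      by (simp only: S_def r_def)
  qed (use K2 \<theta> D in \<open>auto simp: c_def\<close>)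
qed

end

subsection \<open>The observable of a finitary factor as a local field\<close>

locale finitary_setup =
  fixes X :: "(int^'d::finite \<Rightarrow> 'a::{finite, discrete_topology}) set"
    and \<mu> :: "(int^'d \<Rightarrow> 'a) measure"
    and \<tau> :: "'l topology" and L :: "'l measure"
    and Y :: "(int^'d \<Rightarrow> 'l) set"
    and \<pi> :: "(int^'d \<Rightarrow> 'l) \<Rightarrow> (int^'d \<Rightarrow> 'a)"
    and R :: "(int^'d \<Rightarrow> 'l) \<Rightarrow> nat"
    and v :: "(int^'d \<Rightarrow> 'a) \<Rightarrow> real"
    and p s :: real
  assumes X: "subshift X" and inv: "invariant_prob X \<mu>"
    and ff: "finitary_factor \<tau> L Y \<mu> \<pi> R"
    and v: "continuous_on X v" and v0: "(\<integral>x. v x \<partial>\<mu>) = 0"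
    and p: "p \<ge> real CARD('d) - 1"
    and s: "s > 2 * (real CARD('d))^2 + (real CARD('d))^2 / (p + 1)"
    and reg: "p_regular X p v"
    and mom: "(\<integral>\<^sup>+y. ennreal (real (R y) powr s) \<partial>(restrict_space (iid_measure L) Y)) < \<infinity>"
begin

definition P :: "(int^'d \<Rightarrow> 'l) measure" where "P = iid_measure L"

sublocale iid_space L P
proof (rule iid_space.intro)
  show "prob_space L" using ff unfolding finitary_factor_def standard_borel_prob_def by (elim conjE)
qed (rule P_def)

section \<open>Consequences of the data: continuity, compactness, full measure, equivariance\<close>

sublocale mu: prob_space \<mu>
  using inv by (simp add: invariant_prob_def)

lemma space_mu: "space \<mu> = X" and sets_mu: "sets \<mu> = sets (restrict_space borel X)"
  using inv by (auto simp: invariant_prob_def)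

lemma measurable_mu_continuous:
  fixes f :: "_ \<Rightarrow> real"
  assumes "continuous_on X f" shows "f \<in> borel_measurable \<mu>"
  using borel_measurable_continuous_on_restrict[OF assms] measurable_cong_sets[OF sets_mu refl] by blast

lemma shift_X: "x \<in> X \<Longrightarrow> shift i x \<in> X"
  using X by (auto simp: subshift_def shift_invariant_def)

lemma continuous_shift: "continuous_on A (shift i)"
  unfolding shift_def[abs_def]
  by (intro continuous_on_coordinatewise_then_product continuous_on_subset[OF continuous_on_product_coordinates]) auto

lemma continuous_v_shift: "continuous_on X (\<lambda>x. v (shift i x))"
  by (rule continuous_on_compose2[OF v continuous_shift]) (auto simp: shift_X)

lemma measurable_v_shift[measurable]: "(\<lambda>x. v (shift i x)) \<in> borel_measurable \<mu>"
  by (rule measurable_mu_continuous[OF continuous_v_shift])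

text \<open>Tychonoff's theorem for a finite alphabet. Compactness makes \<open>v\<close>
  bounded.\<close>

lemma compact_X: "compact X"
proof -
  have "compact_space (euclidean :: 'a topology)"
    unfolding compact_space_def by (simp add: finite_imp_compact)
  then have "compact_space (product_topology (\<lambda>_::int^'d. euclidean :: 'a topology) UNIV)"
    by (simp add: compact_space_product_topology)
  then have "compact (UNIV :: (int^'d \<Rightarrow> 'a) set)"
    by (simp add: euclidean_product_topology compact_space_def)
  moreover have "closed X" using X by (simp add: subshift_def)
  ultimately show ?thesis using compact_Int_closed by fastforce
qed

lemma v_bounded: obtains D where "0 \<le> D" "\<And>x. x \<in> X \<Longrightarrow> \<bar>v x\<bar> \<le> D"
proof -
  have "bounded (v ` X)"
    by (intro compact_imp_bounded compact_continuous_image v compact_X)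
  then obtain D where "\<And>x. x \<in> X \<Longrightarrow> norm (v x) \<le> D" by (auto simp: bounded_iff)
  then show thesis by (intro that[of "max 0 D"]) (auto intro: max.coboundedI2)
qed

lemma brv_v_shift: "brv \<mu> (\<lambda>x. v (shift i x))"
proof -
  obtain D where "\<And>x. x \<in> X \<Longrightarrow> \<bar>v x\<bar> \<le> D" using v_bounded by blast
  then show ?thesis by (intro brvI[of _ _ D] measurable_v_shift) (auto simp: space_mu shift_X)
qed

lemma Y_sets: "Y \<in> sets P" and Y1: "emeasure P Y = 1"
proof -
  show 1: "emeasure P Y = 1" using ff unfolding finitary_factor_def P_def by (elim conjE)
  \<comment> \<open>A non-measurable set has \<open>emeasure\<close> 0 by convention, so measure 1
    entails measurability.\<close>
  show "Y \<in> sets P" using emeasure_notin_sets[of Y P] 1 by auto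
qed

lemma Y_space: "Y \<subseteq> space P"
  using sets.sets_into_space[OF Y_sets] .

lemma AE_Y: "AE y in P. y \<in> Y"
  using ps.AE_in_set_eq_1[OF Y_sets] Y1 by (simp add: measure_def)

lemma pi_measurable: "\<pi> \<in> measurable (restrict_space P Y) \<mu>"
  and pi_distr: "distr (restrict_space P Y) \<mu> \<pi> = \<mu>"
  and pi_shift: "y \<in> Y \<Longrightarrow> shift i (\<pi> y) = \<pi> (shift i y)"
  and R_measurable: "R \<in> measurable (restrict_space P Y) (count_space UNIV)"
  and coding: "y \<in> Y \<Longrightarrow> y' \<in> Y \<Longrightarrow> (\<And>j. j \<in> lattice_box (R y) \<Longrightarrow> y j = y' j) \<Longrightarrow> \<pi> y 0 = \<pi> y' 0"
proof -
  show "\<pi> \<in> measurable (restrict_space P Y) \<mu>" "distr (restrict_space P Y) \<mu> \<pi> = \<mu>"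
    "R \<in> measurable (restrict_space P Y) (count_space UNIV)"
    using ff unfolding finitary_factor_def P_def by - (elim conjE, assumption)+
  have "\<forall>i. \<forall>y\<in>Y. shift i (\<pi> y) = \<pi> (shift i y)"
    "\<forall>y\<in>Y. \<forall>y'\<in>Y. (\<forall>j\<in>lattice_box (R y). y j = y' j) \<longrightarrow> \<pi> y 0 = \<pi> y' 0"
    using ff unfolding finitary_factor_def by - (elim conjE, assumption)+
  then show "y \<in> Y \<Longrightarrow> shift i (\<pi> y) = \<pi> (shift i y)"
    "y \<in> Y \<Longrightarrow> y' \<in> Y \<Longrightarrow> (\<And>j. j \<in> lattice_box (R y) \<Longrightarrow> y j = y' j) \<Longrightarrow> \<pi> y 0 = \<pi> y' 0"
    by - blast+
qed

lemma space_restrict_Y: "space (restrict_space P Y) = Y"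
  using Y_space by (auto simp: space_restrict_space)

lemma pi_X: "y \<in> Y \<Longrightarrow> \<pi> y \<in> X"
  using measurable_space[OF pi_measurable] by (simp add: space_restrict_Y space_mu)

lemma shift_Y: "y \<in> Y \<Longrightarrow> shift i y \<in> Y"
proof -
  have "shift_invariant Y" using ff unfolding finitary_factor_def by (elim conjE)
  then show "y \<in> Y \<Longrightarrow> shift i y \<in> Y" unfolding shift_invariant_def by blast
qed

text \<open>Extended by 0 off \<open>Y\<close>, because splicing two points of \<open>Y\<close> may
  leave \<open>Y\<close>; in this way the observable is defined on the whole product space.\<close>

definition Z :: "(int^'d \<Rightarrow> 'l) \<Rightarrow> real" where
  "Z y = (if y \<in> Y then v (\<pi> y) else 0)"

lemma measurable_v: "v \<in> borel_measurable \<mu>"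
  by (rule measurable_mu_continuous[OF v])

lemma brv_Z: "brv P Z"
proof -
  obtain D where D: "0 \<le> D" "\<And>x. x \<in> X \<Longrightarrow> \<bar>v x\<bar> \<le> D" using v_bounded by blast
  have Yc: "{y \<in> space P. y \<in> Y} = Y" using Y_space by auto
  have "Z \<in> borel_measurable P"
    unfolding Z_def[abs_def]
  proof (subst measurable_If_restrict_space_iff)
    show "{y \<in> space P. y \<in> Y} \<in> sets P" using Y_sets by (simp add: Yc)
    show "(\<lambda>y. v (\<pi> y)) \<in> borel_measurable (restrict_space P {y. y \<in> Y}) \<and> (\<lambda>_. 0::real) \<in> borel_measurable (restrict_space P {y. y \<notin> Y})"
      using measurable_compose[OF pi_measurable measurable_v] by simp
  qed
  then show ?thesis
    by (rule brvI[where D = D]) (use D pi_X in \<open>auto simp: Z_def\<close>)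
qed

lemma Z_shift: "y \<in> Y \<Longrightarrow> Z (shift i y) = v (shift i (\<pi> y))"
  by (simp add: Z_def shift_Y pi_shift)

text \<open>The function on the product space has to represent \<Phi> only on \<open>Y\<close>,
  which has full measure. Every statement about \<mu> that is needed passes to the iid system along
  this identity.\<close>

lemma transfer:
  fixes \<Phi> :: "_ \<Rightarrow> real"
  assumes "\<Phi> \<in> borel_measurable \<mu>" "f \<in> borel_measurable P" "\<And>y. y \<in> Y \<Longrightarrow> f y = \<Phi> (\<pi> y)"
  shows "(\<integral>x. \<Phi> x \<partial>\<mu>) = (\<integral>y. f y \<partial>P)"
proof -
  have "(\<integral>x. \<Phi> x \<partial>\<mu>) = (\<integral>x. \<Phi> x \<partial>distr (restrict_space P Y) \<mu> \<pi>)" by (simp add: pi_distr)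
  also have "\<dots> = (\<integral>y. \<Phi> (\<pi> y) \<partial>restrict_space P Y)"
    by (rule integral_distr[OF pi_measurable assms(1)])
  also have "\<dots> = (\<integral>y. indicator Y y *\<^sub>R \<Phi> (\<pi> y) \<partial>P)"
    by (rule integral_restrict_space) (use Y_sets Y_space in \<open>simp add: Int_absorb2\<close>)
  also have "\<dots> = (\<integral>y. f y \<partial>P)"
  proof (rule integral_cong_AE)
    have "(\<lambda>y. indicator Y y *\<^sub>R \<Phi> (\<pi> y)) = (\<lambda>y. indicator Y y * f y)"
      by (auto simp: indicator_def assms(3))
    then show "(\<lambda>y. indicator Y y *\<^sub>R \<Phi> (\<pi> y)) \<in> borel_measurable P"
      using assms(2) Y_sets by simp
    show "AE y in P. indicator Y y *\<^sub>R \<Phi> (\<pi> y) = f y"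
      using AE_Y by eventually_elim (simp add: assms(3))
  qed (rule assms(2))
  finally show ?thesis .
qed

lemma transfer_sum:
  fixes \<Psi> :: "real \<Rightarrow> real"
  assumes [measurable]: "\<Psi> \<in> borel_measurable borel"
  shows "(\<integral>x. \<Psi> (\<Sum>i\<in>I. a i * v (shift i x)) \<partial>\<mu>) = (\<integral>y. \<Psi> (\<Sum>i\<in>I. a i * Z (shift i y)) \<partial>P)"
proof (rule transfer)
  show "(\<lambda>x. \<Psi> (\<Sum>i\<in>I. a i * v (shift i x))) \<in> borel_measurable \<mu>" by measurable
  have [measurable]: "(\<lambda>y. Z (shift i y)) \<in> borel_measurable P" for i
    by (rule brv_measurable[OF brv_shift[OF brv_Z]])
  show "(\<lambda>y. \<Psi> (\<Sum>i\<in>I. a i * Z (shift i y))) \<in> borel_measurable P" by measurable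
qed (simp add: Z_shift)

lemma mean_Z: "(\<integral>y. Z y \<partial>P) = 0"
  using transfer[OF measurable_v brv_measurable[OF brv_Z]] v0 by (simp add: Z_def)

section \<open>Variation of the observable and its decay\<close>

lemma variation_bdd:
  "bdd_above {\<bar>v x - v x'\<bar> | x x'. x \<in> X \<and> x' \<in> X \<and> (\<forall>j\<in>lattice_box k. x j = x' j)}"
proof -
  obtain D where D: "0 \<le> D" "\<And>x. x \<in> X \<Longrightarrow> \<bar>v x\<bar> \<le> D" using v_bounded by blast
  have "\<bar>v x - v x'\<bar> \<le> D + D" if "x \<in> X" "x' \<in> X" for x x'
    using D(2)[OF that(1)] D(2)[OF that(2)] by linarith
  then show ?thesis by (intro bdd_aboveI[of _ "D + D"]) auto
qed

lemma variation_upper: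
  "x \<in> X \<Longrightarrow> x' \<in> X \<Longrightarrow> (\<And>j. j \<in> lattice_box k \<Longrightarrow> x j = x' j) \<Longrightarrow> \<bar>v x - v x'\<bar> \<le> variation X k v"
  unfolding variation_def by (rule cSup_upper[OF _ variation_bdd]) blast

lemma X_nonempty: "X \<noteq> {}"
  using mu.not_empty by (simp add: space_mu)

lemma variation_nonneg: "0 \<le> variation X k v"
proof -
  obtain x where "x \<in> X" using X_nonempty by blast
  then show ?thesis using variation_upper[of x x k] by simp
qed

lemma variation_antimono:
  assumes "k \<le> l" shows "variation X l v \<le> variation X k v"
  unfolding variation_def
proof (rule cSup_subset_mono[OF _ variation_bdd])
  show "{\<bar>v x - v x'\<bar> |x x'. x \<in> X \<and> x' \<in> X \<and> (\<forall>j\<in>lattice_box l. x j = x' j)} \<noteq> {}"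
    using X_nonempty by auto
  show "{\<bar>v x - v x'\<bar> |x x'. x \<in> X \<and> x' \<in> X \<and> (\<forall>j\<in>lattice_box l. x j = x' j)}
      \<subseteq> {\<bar>v x - v x'\<bar> |x x'. x \<in> X \<and> x' \<in> X \<and> (\<forall>j\<in>lattice_box k. x j = x' j)}"
    using lattice_box_mono[OF assms, where 'a = 'd] by blast
qed

lemma p_nonneg: "0 \<le> p"
proof -
  have "1 \<le> CARD('d)" by (simp add: Suc_leI)
  then have "1 \<le> real CARD('d)" by linarith
  with p show ?thesis by linarith
qed

text \<open>The variations are nonincreasing, so the block of indices between n/2 and n alone
  contributes at least (n/2)^(p+1) times the variation at n to a convergent series.\<close>

lemma variation_decay:
  obtains C where "0 \<le> C" "\<And>n. 1 \<le> n \<Longrightarrow> variation X n v \<le> C * real n powr (- (p + 1))"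
proof -
  define f where "f = (\<lambda>k. real (Suc k) powr p * variation X (Suc k) v)"
  have sm: "summable f" using reg by (simp add: p_regular_def f_def)
  have f0: "0 \<le> f k" for k by (simp add: f_def variation_nonneg)
  show thesis
  proof (rule that[of "suminf f * 2 powr (p + 1)"])
    show "0 \<le> suminf f * 2 powr (p + 1)" using suminf_nonneg[OF sm f0] by simp
    fix n :: nat assume n: "1 \<le> n"
    have "(real n / 2) * (real n / 2) powr p * variation X n v
        \<le> real (card {n div 2..<n}) * ((real n / 2) powr p * variation X n v)"
    proof -
      \<comment> \<open>The block has at least n/2 terms. Its index k stands for radius k + 1, which
        is at most n and at least n/2.\<close>
      have "real n / 2 \<le> real (n - n div 2)" by linarith
      then have "(real n / 2) * ((real n / 2) powr p * variation X n v)
          \<le> real (n - n div 2) * ((real n / 2) powr p * variation X n v)"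
        by (rule mult_right_mono) (simp add: variation_nonneg)
      then show ?thesis by (simp only: mult.assoc card_atLeastLessThan)
    qed
    also have "\<dots> = (\<Sum>k\<in>{n div 2..<n}. (real n / 2) powr p * variation X n v)" by simp
    also have "\<dots> \<le> (\<Sum>k\<in>{n div 2..<n}. f k)"
      unfolding f_def
    proof (intro sum_mono mult_mono variation_antimono)
      fix k assume k: "k \<in> {n div 2..<n}"
      then have "n \<le> 2 * Suc k" by auto
      then have "real n \<le> 2 * real (Suc k)" by linarith
      then show "(real n / 2) powr p \<le> real (Suc k) powr p"
        using p_nonneg by (intro powr_mono2) auto
    qed (auto simp: variation_nonneg)
    also have "\<dots> \<le> suminf f" by (rule sum_le_suminf[OF sm]) (auto simp: f0)
    finally have "(real n / 2) * (real n / 2) powr p * variation X n v \<le> suminf f" .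
    also have "(real n / 2) * (real n / 2) powr p = (real n / 2) powr (p + 1)"
      using n by (simp add: powr_add)
    also have "\<dots> = real n powr (p + 1) / 2 powr (p + 1)"
      using n by (simp add: powr_divide)
    finally have "variation X n v \<le> suminf f * 2 powr (p + 1) / real n powr (p + 1)"
      using n by (simp add: field_simps)
    then show "variation X n v \<le> suminf f * 2 powr (p + 1) * real n powr (- (p + 1))"
      by (simp only: powr_minus divide_inverse)
  qed
qed

section \<open>Tail of the coding radius and the truncation error\<close>

definition bad :: "nat \<Rightarrow> (int^'d \<Rightarrow> 'l) set" where
  "bad r = {y \<in> Y. r < R y}"

lemma bad_sets: "bad r \<in> sets P"
proof -
  have "R -` {r<..} \<inter> space (restrict_space P Y) \<in> sets (restrict_space P Y)"
    by (rule measurable_sets[OF R_measurable]) simp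
  moreover have "R -` {r<..} \<inter> space (restrict_space P Y) = bad r"
    by (auto simp: space_restrict_Y bad_def)
  ultimately show ?thesis
    using Y_sets Y_space by (subst (asm) sets_restrict_space_iff) (auto simp: Int_absorb2)
qed

text \<open>Markov's inequality for the s-th power of the coding radius.\<close>

lemma bad_prob:
  obtains B where "0 \<le> B" "\<And>r. 1 \<le> r \<Longrightarrow> measure P (bad r) \<le> B * real r powr (- s)"
proof -
  define u where "u y = ennreal (real (R y) powr s)" for y
  define B where "B = enn2real (\<integral>\<^sup>+y. u y \<partial>restrict_space P Y)"
  have sp: "0 \<le> s"
  proof -
    have "0 \<le> 2 * (real CARD('d))^2 + (real CARD('d))^2 / (p + 1)"
      using p_nonneg by (intro add_nonneg_nonneg divide_nonneg_nonneg) auto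
    then show ?thesis using s by linarith
  qed
  have uB: "(\<integral>\<^sup>+y. u y \<partial>restrict_space P Y) = ennreal B"
    using mom by (simp add: B_def u_def P_def)
  have [measurable]: "u \<in> borel_measurable (restrict_space P Y)"
    unfolding u_def using measurable_compose[OF R_measurable, of "\<lambda>n. ennreal (real n powr s)" borel] by simp
  show thesis
  proof (rule that[of B])
    show "0 \<le> B" by (simp add: B_def)
    fix r :: nat assume r: "1 \<le> r"
    have "ennreal (real r powr s) * emeasure P (bad r) = ennreal (real r powr s) * emeasure (restrict_space P Y) (bad r)"
      using Y_sets Y_space by (subst emeasure_restrict_space) (auto simp: Int_absorb2 bad_def)
    also have "\<dots> = (\<integral>\<^sup>+y. ennreal (real r powr s) * indicator (bad r) y \<partial>restrict_space P Y)"
    proof (rule nn_integral_cmult_indicator[symmetric])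
      show "bad r \<in> sets (restrict_space P Y)"
        using bad_sets Y_sets Y_space by (subst sets_restrict_space_iff) (auto simp: Int_absorb2 bad_def)
    qed
    also have "\<dots> \<le> (\<integral>\<^sup>+y. u y \<partial>restrict_space P Y)"
    proof (rule nn_integral_mono)
      fix y
      have "real r powr s \<le> real (R y) powr s" if "r < R y"
        using that sp by (intro powr_mono2) auto
      then show "ennreal (real r powr s) * indicator (bad r) y \<le> u y"
        by (auto simp: u_def indicator_def bad_def intro!: ennreal_leI)
    qed
    finally have "ennreal (real r powr s * measure P (bad r)) \<le> ennreal B"
      unfolding uB by (simp add: ps.emeasure_eq_measure ennreal_mult)
    then have "real r powr s * measure P (bad r) \<le> B" by (simp add: B_def)
    then show "measure P (bad r) \<le> B * real r powr (- s)"
      using r by (simp add: powr_minus field_simps)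
  qed
qed

text \<open>Equivariance moves site j to the origin, where the coding radius of
  \<open>shift j y\<close> applies. Only the radii of \<open>y\<close> are consulted, so only one of
  the two configurations has to be well behaved.\<close>

lemma coding_box:
  assumes y: "y \<in> Y" "y' \<in> Y" and R: "\<And>j. j \<in> lattice_box k \<Longrightarrow> R (shift j y) \<le> r"
    and agree: "\<And>j. j \<in> lattice_box (k + r) \<Longrightarrow> y j = y' j"
    and j: "j \<in> lattice_box k"
  shows "\<pi> y j = \<pi> y' j"
proof -
  have "\<pi> (shift j y) 0 = \<pi> (shift j y') 0"
  proof (rule coding)
    show "shift j y \<in> Y" "shift j y' \<in> Y" using y by (auto intro: shift_Y)
    fix l :: "int^'d" assume "l \<in> lattice_box (R (shift j y))"
    then have "l \<in> lattice_box r" using lattice_box_mono[OF R[OF j]] by blast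
    then have "j + l \<in> lattice_box (k + r)" using j by (rule lattice_box_add[rotated])
    then show "shift j y l = shift j y' l" using agree by (simp add: shift_def)
  qed
  then show ?thesis
    unfolding pi_shift[OF y(1), symmetric] pi_shift[OF y(2), symmetric] by (simp add: shift_def)
qed

lemma integral_fst_P: "brv P f \<Longrightarrow> (\<integral>z. f (fst z) \<partial>(P \<Otimes>\<^sub>M P)) = (\<integral>y. f y \<partial>P)"
  using PP.integral_fst'[OF PP.P.brv_integrable[OF brv_fst[of f]]] by (simp add: ps.prob_space)

text \<open>Compare \<open>y\<close> with its resampled copy, which agrees with it on the box of
  radius k + r. If all coding radii of \<open>y\<close> in the window of radius k are at most r, the
  two images agree on the window and the values of \<open>v\<close> differ by at most its variation.
  Otherwise the trivial bound 2D is used, with a union bound over the (2k+1)^d sites of the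
  window.\<close>

lemma trunc_error:
  assumes D: "0 \<le> D" "\<And>x. x \<in> X \<Longrightarrow> \<bar>v x\<bar> \<le> D" and n: "0 < n"
  shows "(\<integral>y. \<bar>Z y - trunc (lattice_box (k + r)) Z y\<bar> ^ n \<partial>P)
    \<le> variation X k v ^ n + (2 * D) ^ n * real ((2 * k + 1) ^ CARD('d)) * measure P (bad r)"
proof -
  define A where "A = (lattice_box (k + r) :: (int^'d) set)"
  define nY where "nY = (indicator (space P - Y) :: _ \<Rightarrow> real)"
  \<comment> \<open>The terms with \<open>nY\<close> have integral 0. They make the domination hold
    at every point, also where \<open>y\<close> or its copy lies outside \<open>Y\<close>.\<close>
  define G where "G z = variation X k v ^ n + (2 * D) ^ n * (nY (fst z) + nY (splice A (fst z) (snd z))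
     + (\<Sum>j\<in>lattice_box k. indicator (bad r) (shift j (fst z))))" for z
  have nYb: "brv P nY"
    unfolding nY_def using Y_sets by (intro brvI[where D = 1]) (auto simp: indicator_def)
  have badb: "brv P (indicator (bad r) :: _ \<Rightarrow> real)"
    using bad_sets by (intro brvI[where D = 1]) (auto simp: indicator_def)
  have badb': "brv P (\<lambda>y. indicator (bad r) (shift j y) :: real)" for j by (rule brv_shift[OF badb])
  note bs = brvs brv_fst[OF nYb] brv_splice[OF nYb] brv_fst[OF badb']
  have ZD: "\<bar>Z y\<bar> \<le> D" for y using D pi_X by (auto simp: Z_def)
  have nY0: "(\<integral>y. nY y \<partial>P) = 0"
  proof -
    have "measure P (space P - Y) = 0"
      using ps.prob_compl[OF Y_sets] Y1 by (simp add: measure_def)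
    then show ?thesis using Y_sets by (simp add: nY_def)
  qed
  have "(\<integral>y. \<bar>Z y - trunc A Z y\<bar> ^ n \<partial>P) \<le> (\<integral>z. \<bar>Z (fst z) - Z (splice A (fst z) (snd z))\<bar> ^ n \<partial>(P \<Otimes>\<^sub>M P))"
    by (rule integral_diff_trunc_le[OF brv_Z])
  also have "\<dots> \<le> (\<integral>z. G z \<partial>(P \<Otimes>\<^sub>M P))"
  proof (rule integral_mono)
    show "integrable (P \<Otimes>\<^sub>M P) (\<lambda>z. \<bar>Z (fst z) - Z (splice A (fst z) (snd z))\<bar> ^ n)"
      by (intro PP.P.brv_integrable brvs brv_fst brv_splice brv_Z)
    show "integrable (P \<Otimes>\<^sub>M P) G"
      unfolding G_def by (intro PP.P.brv_integrable bs)
    fix z assume "z \<in> space (P \<Otimes>\<^sub>M P)"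
    then obtain y y' where z: "z = (y, y')" "y \<in> space P" "y' \<in> space P" by (auto simp: space_pair_measure)
    define y2 where "y2 = splice A y y'"
    have y2: "y2 \<in> space P" by (simp add: y2_def z)
    define b where "b = (\<Sum>j\<in>lattice_box k. indicator (bad r) (shift j y) :: real)"
    have b0: "0 \<le> b" by (simp add: b_def sum_nonneg)
    have nYn: "0 \<le> nY y" "0 \<le> nY y2" by (simp_all add: nY_def)
    have vn: "0 \<le> variation X k v ^ n" by (simp add: variation_nonneg)
    have "\<bar>Z y - Z y2\<bar> ^ n \<le> variation X k v ^ n + (2 * D) ^ n * (nY y + nY y2 + b)"
    proof (cases "y \<in> Y \<and> y2 \<in> Y \<and> (\<forall>j\<in>lattice_box k. R (shift j y) \<le> r)")
      case True
      have "\<bar>Z y - Z y2\<bar> \<le> variation X k v"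
      proof -
        have "\<pi> y j = \<pi> y2 j" if "j \<in> lattice_box k" for j
          by (rule coding_box[OF _ _ _ _ that, of y y2 r]) (use True in \<open>auto simp: y2_def splice_def A_def\<close>)
        then have "\<bar>v (\<pi> y) - v (\<pi> y2)\<bar> \<le> variation X k v"
          using True by (intro variation_upper pi_X) auto
        then show ?thesis using True by (simp add: Z_def)
      qed
      then have "\<bar>Z y - Z y2\<bar> ^ n \<le> variation X k v ^ n" by (intro power_mono) auto
      moreover have "0 \<le> (2 * D) ^ n * (nY y + nY y2 + b)" using D b0 nYn by simp
      ultimately show ?thesis by linarith
    next
      case False
      have "1 \<le> nY y + nY y2 + b"
      proof (cases "y \<in> Y \<and> y2 \<in> Y")
        case True
        with False obtain j where j: "j \<in> lattice_box k" "r < R (shift j y)" by fastforce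
        then have "shift j y \<in> bad r" using True shift_Y by (simp add: bad_def)
        then have "1 \<le> b" unfolding b_def
          using member_le_sum[OF j(1), of "\<lambda>j. indicator (bad r) (shift j y) :: real"] by simp
        then show ?thesis using nYn by linarith
      next
        case False
        then have "nY y = 1 \<or> nY y2 = 1" using z y2 by (auto simp: nY_def)
        then show ?thesis using nYn b0 by linarith
      qed
      then have "(2 * D) ^ n * 1 \<le> (2 * D) ^ n * (nY y + nY y2 + b)"
        using D by (intro mult_left_mono) auto
      moreover have "\<bar>Z y - Z y2\<bar> ^ n \<le> (2 * D) ^ n"
        using ZD[of y] ZD[of y2] by (intro power_mono) auto
      ultimately show ?thesis using vn by linarith
    qed
    then show "\<bar>Z (fst z) - Z (splice A (fst z) (snd z))\<bar> ^ n \<le> G z"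
      by (simp add: G_def z y2_def b_def)
  qed
  also have "(\<integral>z. G z \<partial>(P \<Otimes>\<^sub>M P)) = variation X k v ^ n + (2 * D) ^ n * ((\<integral>y. nY y \<partial>P) + (\<integral>y. nY y \<partial>P)
     + (\<Sum>j\<in>lattice_box k. \<integral>y. indicator (bad r) (shift j y) \<partial>P))"
  proof -
    have "(\<integral>z. G z \<partial>(P \<Otimes>\<^sub>M P)) = variation X k v ^ n + (2 * D) ^ n * (\<integral>z. nY (fst z) + nY (splice A (fst z) (snd z))
     + (\<Sum>j\<in>lattice_box k. indicator (bad r) (shift j (fst z))) \<partial>(P \<Otimes>\<^sub>M P))"
      unfolding G_def
      by (subst Bochner_Integration.integral_add, intro PP.P.brv_integrable bs, intro PP.P.brv_integrable bs)
        (simp add: PP.P.prob_space)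
    also have "(\<integral>z. nY (fst z) + nY (splice A (fst z) (snd z))
       + (\<Sum>j\<in>lattice_box k. indicator (bad r) (shift j (fst z))) \<partial>(P \<Otimes>\<^sub>M P))
      = (\<integral>z. nY (fst z) \<partial>(P \<Otimes>\<^sub>M P)) + (\<integral>z. nY (splice A (fst z) (snd z)) \<partial>(P \<Otimes>\<^sub>M P))
       + (\<Sum>j\<in>lattice_box k. \<integral>z. indicator (bad r) (shift j (fst z)) \<partial>(P \<Otimes>\<^sub>M P))"
      by (subst Bochner_Integration.integral_add, intro PP.P.brv_integrable bs, intro PP.P.brv_integrable bs,
          subst Bochner_Integration.integral_add, intro PP.P.brv_integrable bs, intro PP.P.brv_integrable bs,
          subst Bochner_Integration.integral_sum, intro PP.P.brv_integrable bs) simp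
    also have "(\<integral>z. nY (fst z) \<partial>(P \<Otimes>\<^sub>M P)) = (\<integral>y. nY y \<partial>P)" by (rule integral_fst_P[OF nYb])
    also have "(\<integral>z. nY (splice A (fst z) (snd z)) \<partial>(P \<Otimes>\<^sub>M P)) = (\<integral>y. nY y \<partial>P)"
      by (rule integral_splice[OF brv_measurable[OF nYb]])
    also have "(\<Sum>j\<in>lattice_box k. \<integral>z. indicator (bad r) (shift j (fst z)) \<partial>(P \<Otimes>\<^sub>M P))
       = (\<Sum>j\<in>lattice_box k. (\<integral>y. indicator (bad r) (shift j y) \<partial>P) :: real)"
      by (intro sum.cong refl integral_fst_P[OF badb'])
    finally show ?thesis .
  qed
  also have "(\<Sum>j\<in>lattice_box k. \<integral>y. indicator (bad r) (shift j y) \<partial>P)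
      = (\<Sum>j\<in>(lattice_box k :: (int^'d) set). measure P (bad r))"
    using bad_sets integral_shift[OF brv_measurable[OF badb]] by simp
  also have "\<dots> = real ((2 * k + 1) ^ CARD('d)) * measure P (bad r)" by (simp add: card_lattice_box)
  finally show ?thesis by (simp add: nY0 A_def mult.assoc)
qed

lemma approx_field_Z: obtains C \<rho> m where "approx_field L P Z C \<rho> m"
proof -
  define d where "d = real CARD('d)"
  have d: "1 \<le> d"
  proof -
    have "1 \<le> CARD('d)" by (simp add: Suc_leI)
    then show ?thesis unfolding d_def by linarith
  qed
  define q where "q = 2 * (2 * CARD('d))"
  have q: "real q = 4 * d" "0 < q" by (auto simp: q_def d_def)
  \<comment> \<open>Chosen so that a window of radius 2^(a l) has variation of order 2^(-a (p+1) l)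
    = 2^(-d l).\<close>
  define a where "a = d / (p + 1)"
  have a: "0 < a" "a \<le> 1" "a * (p + 1) = d"
    using d p p_nonneg by (auto simp: a_def d_def divide_simps)
  obtain D where D: "0 \<le> D" "\<And>x. x \<in> X \<Longrightarrow> \<bar>v x\<bar> \<le> D" using v_bounded by blast
  obtain C1 where C1: "0 \<le> C1" "\<And>n. 1 \<le> n \<Longrightarrow> variation X n v \<le> C1 * real n powr (- (p + 1))"
    using variation_decay by blast
  obtain B where B: "0 \<le> B" "\<And>r. 1 \<le> r \<Longrightarrow> measure P (bad r) \<le> B * real r powr (- s)"
    using bad_prob by blast
  \<comment> \<open>The worse of two rates: d from regularity, and (s - a d)/q from the probability
    of a bad window after taking the q-th root. Both exceed d/2, the second by the hypothesis on s
    with q = 4d.\<close>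
  define \<gamma> where "\<gamma> = min d ((s - a * d) / q)"
  define \<rho> where "\<rho> = 2 powr (- \<gamma>)"
  \<comment> \<open>Rounding down loses at most a factor 2, because 2^(a l) \<ge> 1; this produces
    the factor 2^(p+1) in \<open>E1\<close>.\<close>
  define k where "k l = nat \<lfloor>2 powr (a * real l)\<rfloor>" for l :: nat
  define m where "m l = k l + 2 ^ l" for l :: nat
  have s': "s > 2 * d\<^sup>2 + a * d" using s by (simp add: d_def a_def power2_eq_square)
  have \<gamma>: "d / 2 < \<gamma>" "\<gamma> \<le> d" "\<gamma> * q \<le> s - a * d"
  proof -
    have "d / 2 < (s - a * d) / q"
      using s' d q by (simp add: field_simps power2_eq_square)
    then show "d / 2 < \<gamma>" using d by (simp add: \<gamma>_def)
    show "\<gamma> \<le> d" by (simp add: \<gamma>_def)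
    have "\<gamma> \<le> (s - a * d) / q" by (simp add: \<gamma>_def)
    then show "\<gamma> * q \<le> s - a * d" using q by (simp add: field_simps)
  qed
  have x1: "1 \<le> 2 powr (a * real l)" for l using a by (simp add: ge_one_powr_ge_zero)
  have k_le: "real (k l) \<le> 2 powr (a * real l)" for l
    using x1[of l] unfolding k_def by (simp add: of_nat_nat)
  have k_ge: "2 powr (a * real l) / 2 \<le> real (k l)" "1 \<le> k l" for l
  proof -
    have f1: "1 \<le> \<lfloor>2 powr (a * real l)\<rfloor>" using x1[of l] by (simp add: le_floor_iff)
    then show "1 \<le> k l" unfolding k_def by linarith
    have "2 powr (a * real l) < real_of_int \<lfloor>2 powr (a * real l)\<rfloor> + 1" by linarith
    moreover have "real (k l) = real_of_int \<lfloor>2 powr (a * real l)\<rfloor>" using f1 by (simp add: k_def)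
    ultimately show "2 powr (a * real l) / 2 \<le> real (k l)" using f1 by linarith
  qed
  define E1 where "E1 = C1 * 2 powr (p + 1)"
  define E2 where "E2 = (2 * D) ^ q * 3 ^ CARD('d) * B"
  \<comment> \<open>The maximum with 1 gives C \<le> C^q, which spares the q-th root of the sum of
    the two error constants.\<close>
  define C where "C = max 1 (E1 ^ q + E2)"
  have E: "0 \<le> E1" "0 \<le> E2" using C1 D B by (auto simp: E1_def E2_def)
  have \<rho>l: "\<rho> ^ l = 2 powr (- \<gamma> * real l)" for l
    by (simp add: \<rho>_def powr_realpow[symmetric] powr_powr)
  have var: "variation X (k l) v \<le> E1 * \<rho> ^ l" for l
  proof -
    have "variation X (k l) v \<le> C1 * real (k l) powr (- (p + 1))" by (rule C1(2)[OF k_ge(2)])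
    also have "\<dots> \<le> C1 * (2 powr (a * real l) / 2) powr (- (p + 1))"
    proof -
      have "(2 powr (a * real l) / 2) powr (p + 1) \<le> real (k l) powr (p + 1)"
        using k_ge(1)[of l] p_nonneg by (intro powr_mono2) auto
      then have "real (k l) powr (- (p + 1)) \<le> (2 powr (a * real l) / 2) powr (- (p + 1))"
        unfolding powr_minus by (intro le_imp_inverse_le) auto
      then show ?thesis using C1 by (intro mult_left_mono) auto
    qed
    also have "(2 powr (a * real l) / 2) powr (- (p + 1)) = 2 powr ((a * real l - 1) * (- (p + 1)))"
      by (simp add: powr_diff[of 2 "a * real l" 1, simplified, symmetric] powr_powr)
    also have "(a * real l - 1) * (- (p + 1)) = (p + 1) - d * real l"
      unfolding a(3)[symmetric] by (simp add: algebra_simps)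
    also have "2 powr ((p + 1) - d * real l) = 2 powr (p + 1) * 2 powr (- d * real l)"
      by (simp add: powr_add[symmetric])
    also have "C1 * (2 powr (p + 1) * 2 powr (- d * real l)) \<le> C1 * (2 powr (p + 1) * \<rho> ^ l)"
      unfolding \<rho>l using C1 \<gamma> by (intro mult_left_mono powr_mono mult_right_mono) auto
    finally show ?thesis by (simp add: E1_def mult.assoc)
  qed
  have badl: "real ((2 * k l + 1) ^ CARD('d)) * measure P (bad (2 ^ l)) \<le> 3 ^ CARD('d) * B * (\<rho> ^ l) ^ q" for l
  proof -
    have "real (2 * k l + 1) \<le> 3 * 2 powr (a * real l)"
      using k_le[of l] x1[of l] by simp
    then have "real (2 * k l + 1) ^ CARD('d) \<le> (3 * 2 powr (a * real l)) ^ CARD('d)"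
      by (intro power_mono) auto
    also have "\<dots> = 3 ^ CARD('d) * 2 powr (a * real l * d)"
      by (simp add: power_mult_distrib powr_realpow[symmetric] powr_powr d_def)
    finally have "real ((2 * k l + 1) ^ CARD('d)) \<le> 3 ^ CARD('d) * 2 powr (a * real l * d)"
      by simp
    moreover have "measure P (bad (2 ^ l)) \<le> B * 2 powr (- s * real l)"
    proof -
      have "real (2 ^ l) powr (- s) = 2 powr (- s * real l)"
        by (simp add: powr_realpow[symmetric] powr_powr mult.commute)
      then show ?thesis using B(2)[of "2 ^ l"] by simp
    qed
    ultimately have "real ((2 * k l + 1) ^ CARD('d)) * measure P (bad (2 ^ l))
        \<le> (3 ^ CARD('d) * 2 powr (a * real l * d)) * (B * 2 powr (- s * real l))"
      by (intro mult_mono) auto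
    also have "\<dots> = 3 ^ CARD('d) * B * 2 powr ((a * d - s) * real l)"
      by (simp add: powr_add[symmetric] algebra_simps)
    also have "\<dots> \<le> 3 ^ CARD('d) * B * 2 powr ((- \<gamma> * q) * real l)"
      using B \<gamma>(3) by (intro mult_left_mono powr_mono mult_right_mono) auto
    also have "2 powr ((- \<gamma> * q) * real l) = (\<rho> ^ l) ^ q"
      unfolding \<rho>l by (simp add: powr_realpow[symmetric] powr_powr mult_ac)
    finally show ?thesis .
  qed
  have "approx_field L P Z C \<rho> m"
  proof (unfold_locales)
    show "brv P Z" by (rule brv_Z)
    show "(\<integral>y. Z y \<partial>P) = 0" by (rule mean_Z)
    show "0 \<le> C" by (simp add: C_def)
    show "0 < \<rho>" by (simp add: \<rho>_def)
    have "sqrt (2 ^ CARD('d)) = 2 powr (d / 2)"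
      by (simp add: d_def powr_half_sqrt[symmetric] powr_realpow[symmetric] powr_powr)
    then have "\<rho> * sqrt (2 ^ CARD('d)) = 2 powr (d / 2 - \<gamma>)"
      by (simp add: \<rho>_def powr_add[symmetric])
    also have "\<dots> < 2 powr 0" using \<gamma> by (intro powr_less_mono) auto
    finally show "\<rho> * sqrt (2 ^ CARD('d)) < 1" by simp
    fix l
    show "m l \<le> 2 * 2 ^ l"
    proof -
      have "real (k l) \<le> 2 powr (a * real l)" by (rule k_le)
      also have "\<dots> \<le> 2 powr (real l)" using a by (intro powr_mono mult_left_le_one_le) auto
      also have "\<dots> = real (2 ^ l)" by (simp add: powr_realpow)
      finally have "k l \<le> 2 ^ l" by (simp only: of_nat_le_iff)
      then show ?thesis by (simp add: m_def)
    qed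
    have \<rho>q: "0 \<le> (\<rho> ^ l) ^ q" by (simp add: \<rho>_def)
    have "(\<integral>y. \<bar>Z y - trunc (lattice_box (m l)) Z y\<bar> ^ q \<partial>P)
      \<le> variation X (k l) v ^ q + (2 * D) ^ q * real ((2 * k l + 1) ^ CARD('d)) * measure P (bad (2 ^ l))"
      unfolding m_def by (rule trunc_error[OF D q(2)])
    also have "\<dots> \<le> (E1 * \<rho> ^ l) ^ q + (2 * D) ^ q * (3 ^ CARD('d) * B * (\<rho> ^ l) ^ q)"
      unfolding mult.assoc[of "(2 * D) ^ q"]
      using D by (intro add_mono power_mono var variation_nonneg mult_left_mono badl) auto
    also have "\<dots> = (E1 ^ q + E2) * (\<rho> ^ l) ^ q"
      by (simp add: E2_def power_mult_distrib algebra_simps)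
    also have "\<dots> \<le> C ^ q * (\<rho> ^ l) ^ q"
    proof (rule mult_right_mono[OF _ \<rho>q])
      have "E1 ^ q + E2 \<le> C" by (simp add: C_def)
      also have "\<dots> \<le> C ^ q" using q by (intro self_le_power) (auto simp: C_def)
      finally show "E1 ^ q + E2 \<le> C ^ q" .
    qed
    finally show "(\<integral>y. \<bar>Z y - trunc (lattice_box (m l)) Z y\<bar> ^ (2 * (2 * CARD('d))) \<partial>P) \<le> (C * \<rho> ^ l) ^ (2 * (2 * CARD('d)))"
      by (simp only: q_def power_mult_distrib)
  qed
  then show thesis by (rule that)
qed

end

subsection \<open>The weights of the partial-sum process\<close>

text \<open>For j \<ge> 1 and x \<ge> 0 this is the length of [0, x] \<inter> (j - 1, j]. The
  clipped formula makes sense for all real x, so that a shift of the index can be traded for a shift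
  of x.\<close>

definition ramp :: "real \<Rightarrow> int \<Rightarrow> real" where
  "ramp x j = max 0 (min 1 (x - real_of_int j + 1))"

definition weight :: "nat \<Rightarrow> real^'d::finite \<Rightarrow> int^'d \<Rightarrow> real" where
  "weight n t i = (\<Prod>m\<in>UNIV. ramp (real n * t $ m) (i $ m))"

definition index_cube :: "nat \<Rightarrow> (int^'d::finite) set" where
  "index_cube n = {i. \<forall>m. i $ m \<in> {1..int n}}"

lemma finite_index_cube[simp]: "finite (index_cube n)"
  unfolding index_cube_def by (rule finite_vec_box) simp

lemma card_index_cube: "card (index_cube n :: (int^'d::finite) set) = n ^ CARD('d)"
  unfolding index_cube_def by (subst card_vec_box) simp_all

lemma ramp_range: "0 \<le> ramp x j" "ramp x j \<le> 1"
  by (auto simp: ramp_def)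

lemma ramp_mono: "x \<le> y \<Longrightarrow> ramp x j \<le> ramp y j"
  by (auto simp: ramp_def)

lemma ramp_shift: "ramp x (j + k) = ramp (x - real_of_int k) j"
  by (simp add: ramp_def algebra_simps)

lemma ramp_lipschitz: "\<bar>ramp x j - ramp y j\<bar> \<le> \<bar>x - y\<bar>"
  by (auto simp: ramp_def max_def min_def)

lemma sum_ramp: "(\<Sum>j\<in>{1..int n}. ramp x j) = max 0 (min (real n) x)"
proof (induction n)
  case 0
  then show ?case by simp
next
  case (Suc n)
  have "{1..int (Suc n)} = insert (int n + 1) {1..int n}" by auto
  then have "(\<Sum>j\<in>{1..int (Suc n)}. ramp x j) = ramp x (int n + 1) + max 0 (min (real n) x)"
    using Suc by simp
  also have "\<dots> = max 0 (min (real (Suc n)) x)"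
    by (auto simp: ramp_def max_def min_def)
  finally show ?case .
qed

text \<open>\<open>ramp\<close> is monotone in x, so all differences have the same sign and their
  sum is a difference of clipped identities.\<close>

lemma sum_ramp_diff: "(\<Sum>j\<in>{1..int n}. \<bar>ramp x j - ramp y j\<bar>) \<le> \<bar>x - y\<bar>"
proof -
  have *: "(\<Sum>j\<in>{1..int n}. \<bar>ramp x j - ramp y j\<bar>) \<le> \<bar>x - y\<bar>" if "x \<le> y" for x y
  proof -
    have "(\<Sum>j\<in>{1..int n}. \<bar>ramp x j - ramp y j\<bar>) = (\<Sum>j\<in>{1..int n}. ramp y j - ramp x j)"
      using ramp_mono[OF that] by (intro sum.cong) auto
    also have "\<dots> = max 0 (min (real n) y) - max 0 (min (real n) x)"
      by (simp add: sum_subtractf sum_ramp)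
    also have "\<dots> \<le> \<bar>x - y\<bar>" using that by (auto simp: max_def min_def)
    finally show ?thesis .
  qed
  show ?thesis
    using *[of x y] *[of y x] by (cases "x \<le> y") (simp_all add: abs_minus_commute)
qed

section \<open>Weights in d dimensions and their identification with volumes\<close>

lemma weight_range: "0 \<le> weight n t i" "weight n t i \<le> 1"
  unfolding weight_def by (auto intro!: prod_nonneg prod_le_1 simp: ramp_range)

lemma weight_diff_le: "\<bar>weight n t i - weight n s i\<bar> \<le> (\<Sum>m\<in>UNIV. \<bar>ramp (real n * t $ m) (i $ m) - ramp (real n * s $ m) (i $ m)\<bar>)"
proof -
  have "norm (weight n t i - weight n s i) \<le> (\<Sum>m\<in>UNIV. norm (ramp (real n * t $ m) (i $ m) - ramp (real n * s $ m) (i $ m)))"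
    unfolding weight_def by (rule norm_prod_diff) (simp_all add: ramp_range)
  then show ?thesis by simp
qed

text \<open>Squares are at most absolute values, since weights lie in [0,1]. In the coordinate
  carrying the difference the sum gives n |t_m - s_m|, and each other coordinate gives n. The bound
  is linear in t - s, which is the variance scaling of Brownian increments.\<close>

lemma sum_weight_diff_sq:
  fixes t s :: "real^'d::finite"
  shows "(\<Sum>i\<in>index_cube n. (weight n t i - weight n s i)\<^sup>2) \<le> real n ^ CARD('d) * (\<Sum>m\<in>UNIV. \<bar>t $ m - s $ m\<bar>)"
proof -
  have "(\<Sum>i\<in>index_cube n. (weight n t i - weight n s i)\<^sup>2)
      \<le> (\<Sum>i\<in>index_cube n. \<Sum>m\<in>UNIV. \<bar>ramp (real n * t $ m) (i $ m) - ramp (real n * s $ m) (i $ m)\<bar>)"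
  proof (rule sum_mono)
    fix i :: "int^'d"
    define x where "x = weight n t i - weight n s i"
    have "\<bar>x\<bar> \<le> 1" using weight_range[of n t i] weight_range[of n s i] by (auto simp: x_def)
    then have "\<bar>x\<bar> * \<bar>x\<bar> \<le> \<bar>x\<bar> * 1" by (intro mult_left_mono) auto
    then have "x\<^sup>2 \<le> \<bar>x\<bar>" by (simp add: power2_eq_square)
    also have "\<bar>x\<bar> \<le> (\<Sum>m\<in>UNIV. \<bar>ramp (real n * t $ m) (i $ m) - ramp (real n * s $ m) (i $ m)\<bar>)"
      unfolding x_def by (rule weight_diff_le)
    finally show "(weight n t i - weight n s i)\<^sup>2 \<le> (\<Sum>m\<in>UNIV. \<bar>ramp (real n * t $ m) (i $ m) - ramp (real n * s $ m) (i $ m)\<bar>)"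
      by (simp only: x_def)
  qed
  also have "\<dots> = (\<Sum>m\<in>UNIV. \<Sum>i\<in>index_cube n. \<bar>ramp (real n * t $ m) (i $ m) - ramp (real n * s $ m) (i $ m)\<bar>)"
    by (rule sum.swap)
  also have "\<dots> \<le> (\<Sum>m\<in>UNIV. real n ^ CARD('d) * \<bar>t $ m - s $ m\<bar>)"
  proof (rule sum_mono)
    fix m :: 'd
    define f where "f k j = (if k = m then \<bar>ramp (real n * t $ m) j - ramp (real n * s $ m) j\<bar> else 1)" for k j
    have "(\<Sum>i\<in>index_cube n. \<bar>ramp (real n * t $ m) (i $ m) - ramp (real n * s $ m) (i $ m)\<bar>)
       = (\<Sum>i\<in>index_cube n. \<Prod>k\<in>UNIV. f k (i $ k))"
      by (simp add: f_def)
    also have "\<dots> = (\<Prod>k\<in>UNIV. \<Sum>j\<in>{1..int n}. f k j)"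
      unfolding index_cube_def by (rule sum_prod_vec) simp
    also have "\<dots> = (\<Sum>j\<in>{1..int n}. f m j) * (\<Prod>k\<in>UNIV - {m}. \<Sum>j\<in>{1..int n}. f k j)"
      by (rule prod.remove) auto
    also have "(\<Prod>k\<in>UNIV - {m}. \<Sum>j\<in>{1..int n}. f k j) = real n ^ (CARD('d) - 1)"
      by (simp add: f_def)
    also have "(\<Sum>j\<in>{1..int n}. f m j) * real n ^ (CARD('d) - 1) \<le> \<bar>real n * t $ m - real n * s $ m\<bar> * real n ^ (CARD('d) - 1)"
      unfolding f_def by (intro mult_right_mono) (simp_all add: sum_ramp_diff)
    also have "\<dots> = real n ^ CARD('d) * \<bar>t $ m - s $ m\<bar>"
    proof -
      have "real n ^ CARD('d) = real n * real n ^ (CARD('d) - 1)"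
        by (subst power_Suc[symmetric]) simp
      then show ?thesis by (simp add: right_diff_distrib[symmetric] abs_mult)
    qed
    finally show "(\<Sum>i\<in>index_cube n. \<bar>ramp (real n * t $ m) (i $ m) - ramp (real n * s $ m) (i $ m)\<bar>) \<le> real n ^ CARD('d) * \<bar>t $ m - s $ m\<bar>" .
  qed
  finally show ?thesis by (simp add: sum_distrib_left)
qed

text \<open>The intersection lies between the open and the closed box with corners \<open>lo\<close>
  and \<open>hi\<close>, which have equal volume. As i \<ge> 1 in every coordinate, the lower faces
  of n A_t never cut a cell. If some side length is negative, the cell is missed and the
  corresponding factor of the weight is 0.\<close>

lemma measure_cell:
  fixes t :: "real^'d::finite"
  assumes t: "\<And>m. 0 \<le> t $ m" and n: "0 < n" and i: "i \<in> index_cube n"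
  shows "measure lborel ((\<lambda>u. real n *\<^sub>R u) ` cbox 0 t \<inter> unit_cell i) = weight n t i"
proof -
  define A where "A = (\<lambda>u. real n *\<^sub>R u) ` cbox 0 t \<inter> unit_cell i"
  define lo :: "real^'d" where "lo = (\<chi> m. real_of_int (i $ m) - 1)"
  define hi :: "real^'d" where "hi = (\<chi> m. min (real n * t $ m) (real_of_int (i $ m)))"
  have i1: "1 \<le> i $ m" for m using i by (simp add: index_cube_def)
  have "(\<lambda>u. real n *\<^sub>R u) ` cbox 0 t = cbox 0 (real n *\<^sub>R t)"
  proof -
    have "cbox 0 t \<noteq> {}" using t by (simp add: interval_ne_empty_cart)
    then show ?thesis by (simp add: image_smult_cbox)
  qed
  then have A: "A = {u. \<forall>m. lo $ m < u $ m \<and> u $ m \<le> hi $ m}"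
  proof -
    have "0 \<le> u $ m" if "lo $ m < u $ m" for u :: "real^'d" and m
      using that i1[of m] by (simp add: lo_def)
    then show ?thesis unfolding A_def unit_cell_def \<open>_ = cbox 0 (real n *\<^sub>R t)\<close>
      by (auto simp: mem_box_cart lo_def hi_def)
  qed
  show ?thesis
  proof (cases "\<forall>m. lo $ m \<le> hi $ m")
    case True
    have r: "ramp (real n * t $ m) (i $ m) = hi $ m - lo $ m" for m
      using True[rule_format, of m] by (auto simp: ramp_def lo_def hi_def max_def min_def)
    have cb: "measure lborel (cbox lo hi) = weight n t i"
      using True by (subst content_cbox_cart) (auto simp: weight_def r interval_ne_empty_cart)
    have "measure lborel (box lo hi) = measure lborel (cbox lo hi)"
      by (simp add: measure_lborel_box_eq measure_lborel_cbox_eq)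
    moreover have "box lo hi \<subseteq> A" "A \<subseteq> cbox lo hi" by (auto simp: A mem_box_cart less_imp_le)
    moreover have "A \<in> sets lborel"
    proof -
      have "A = (\<Inter>m\<in>UNIV. {u. u $ m > lo $ m} \<inter> {u. u $ m \<le> hi $ m})" by (auto simp: A)
      also have "\<dots> \<in> sets borel"
        by (intro sets.finite_INT sets.Int borel_open borel_closed open_halfspace_component_gt_cart
            closed_halfspace_component_le_cart) auto
      finally show ?thesis by simp
    qed
    ultimately show ?thesis
      using measure_mono_fmeasurable[of "box lo hi" A lborel] measure_mono_fmeasurable[of A "cbox lo hi" lborel]
        fmeasurableI2[of "cbox lo hi" lborel A] cb
      unfolding A_def[symmetric] by (simp add: fmeasurable_cbox)
  next
    case False
    then obtain m where m: "hi $ m < lo $ m" by (auto simp: not_le)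
    then have "A = {}" by (auto simp: A intro!: exI[of _ m])
    moreover have "ramp (real n * t $ m) (i $ m) = 0"
      using m by (auto simp: ramp_def lo_def hi_def max_def min_def split: if_splits)
    then have "weight n t i = 0" unfolding weight_def by (intro prod_zero) auto
    ultimately show ?thesis by (simp add: A_def[symmetric])
  qed
qed

lemma W_proc_eq:
  fixes t :: "real^'d::finite"
  assumes t: "t \<in> unit_cube"
  shows "W_proc v n t x = (\<Sum>i\<in>index_cube n. weight n t i * v (shift i x))"
proof -
  have t0: "0 \<le> t $ m" for m using t by (simp add: mem_box_cart)
  have I: "{i::int^'d. \<forall>m. 1 \<le> i $ m \<and> i $ m \<le> int n} = index_cube n"
    by (simp add: index_cube_def)
  show ?thesis
  proof (cases "n = 0")
    case True
    then have "(index_cube n :: (int^'d) set) = {}" by (auto simp: index_cube_def)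
    then show ?thesis unfolding W_proc_def I by simp
  next
    case False
    then show ?thesis unfolding W_proc_def I
      by (intro sum.cong refl arg_cong2[where f = "(*)"] measure_cell t0) auto
  qed
qed

text \<open>For k = 0 the product of the two ramps differs from the ramp of min x y only around its
  last cell, an error of at most 1. Shifting one index by k costs |k|, and confining both indices to
  {1..n} drops at most 2|k| terms.\<close>

lemma ramp_correlation:
  assumes x: "0 \<le> x" "x \<le> real n" and y: "0 \<le> y" "y \<le> real n"
  shows "\<bar>(\<Sum>j\<in>{j\<in>{1..int n}. j + k \<in> {1..int n}}. ramp x j * ramp y (j + k)) - min x y\<bar> \<le> 3 * real_of_int \<bar>k\<bar> + 1"
proof -
  define J where "J = {1..int n}"
  define A where "A = {j\<in>J. j + k \<in> J}"
  define z where "z = min x y"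
  have J: "finite J" "A \<subseteq> J" by (auto simp: J_def A_def)
  have a: "\<bar>(\<Sum>j\<in>J. ramp x j * ramp y j) - z\<bar> \<le> 1"
  proof -
    have term0: "0 \<le> ramp z j - ramp x j * ramp y j" for j
    proof -
      have "ramp x j * ramp y j \<le> ramp x j" "ramp x j * ramp y j \<le> ramp y j"
        using ramp_range[of x j] ramp_range[of y j] by (auto intro: mult_left_le mult_left_le_one_le)
      then show ?thesis by (auto simp: z_def min_def)
    qed
    have aux: "ramp w j - ramp w j * ramp u j \<le> ramp w j - ramp w (j + 1)" if "w \<le> u" for w u :: real and j
    proof -
      \<comment> \<open>If the ramp at j + 1 is positive, the ramp at j already equals 1.\<close>
      have "ramp w (j + 1) \<le> ramp w j * ramp w j"
        by (auto simp: ramp_def max_def min_def)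
      also have "\<dots> \<le> ramp w j * ramp u j"
        using ramp_mono[OF that] ramp_range by (intro mult_left_mono) auto
      finally show ?thesis by simp
    qed
    have term1: "ramp z j - ramp x j * ramp y j \<le> ramp z j - ramp z (j + 1)" for j
      using aux[of x y j] aux[of y x j] by (cases "x \<le> y") (auto simp: z_def min_def mult.commute)
    have zs: "(\<Sum>j\<in>J. ramp z j) = z"
      unfolding J_def sum_ramp using x y by (auto simp: z_def)
    have "0 \<le> (\<Sum>j\<in>J. ramp z j - ramp x j * ramp y j)" by (rule sum_nonneg) (rule term0)
    moreover have "(\<Sum>j\<in>J. ramp z j - ramp x j * ramp y j) \<le> (\<Sum>j\<in>J. ramp z j - ramp z (j + 1))"
      by (rule sum_mono) (rule term1)
    moreover have "(\<Sum>j\<in>J. ramp z j - ramp z (j + 1)) \<le> (\<Sum>j\<in>J. \<bar>ramp z j - ramp (z - 1) j\<bar>)"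
      by (rule sum_mono) (simp add: ramp_shift)
    moreover have "\<dots> \<le> 1" unfolding J_def using sum_ramp_diff[of z "z - 1" n] by simp
    ultimately show ?thesis by (simp add: sum_subtractf zs)
  qed
  have b: "\<bar>(\<Sum>j\<in>J. ramp x j * ramp y (j + k)) - (\<Sum>j\<in>J. ramp x j * ramp y j)\<bar> \<le> real_of_int \<bar>k\<bar>"
  proof -
    have "\<bar>(\<Sum>j\<in>J. ramp x j * ramp y (j + k)) - (\<Sum>j\<in>J. ramp x j * ramp y j)\<bar>
       = \<bar>\<Sum>j\<in>J. ramp x j * (ramp (y - real_of_int k) j - ramp y j)\<bar>"
      by (simp add: sum_subtractf[symmetric] right_diff_distrib ramp_shift)
    also have "\<dots> \<le> (\<Sum>j\<in>J. \<bar>ramp x j * (ramp (y - real_of_int k) j - ramp y j)\<bar>)" by (rule sum_abs)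
    also have "\<dots> \<le> (\<Sum>j\<in>J. \<bar>ramp (y - real_of_int k) j - ramp y j\<bar>)"
      unfolding abs_mult by (intro sum_mono mult_left_le_one_le) (auto simp: ramp_range)
    also have "\<dots> \<le> \<bar>(y - real_of_int k) - y\<bar>" unfolding J_def by (rule sum_ramp_diff)
    finally show ?thesis by simp
  qed
  have c: "\<bar>(\<Sum>j\<in>A. ramp x j * ramp y (j + k)) - (\<Sum>j\<in>J. ramp x j * ramp y (j + k))\<bar> \<le> 2 * real_of_int \<bar>k\<bar>"
  proof -
    have "(\<Sum>j\<in>J. ramp x j * ramp y (j + k)) = (\<Sum>j\<in>J - A. ramp x j * ramp y (j + k)) + (\<Sum>j\<in>A. ramp x j * ramp y (j + k))"
      using J by (intro sum.subset_diff) auto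
    then have "\<bar>(\<Sum>j\<in>A. ramp x j * ramp y (j + k)) - (\<Sum>j\<in>J. ramp x j * ramp y (j + k))\<bar> = (\<Sum>j\<in>J - A. ramp x j * ramp y (j + k))"
      by (simp add: sum_nonneg ramp_range)
    also have "\<dots> \<le> (\<Sum>j\<in>J - A. 1)"
      by (intro sum_mono mult_le_one) (auto simp: ramp_range)
    also have "\<dots> = real (card (J - A))" by simp
    also have "card (J - A) \<le> card ({1..\<bar>k\<bar>} \<union> {int n - \<bar>k\<bar> + 1..int n})"
      by (intro card_mono) (auto simp: J_def A_def)
    also have "\<dots> \<le> card {1..\<bar>k\<bar>} + card {int n - \<bar>k\<bar> + 1..int n}" by (rule card_Un_le)
    also have "\<dots> = 2 * nat \<bar>k\<bar>" by simp
    finally show ?thesis by simp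
  qed
  show ?thesis using a b c unfolding A_def J_def z_def by linarith
qed

text \<open>The condition that both i and i + k lie in the cube is a condition on each coordinate
  separately, so the correlation is a product of one-dimensional ones. The limit does not depend on
  k, hence all covariances enter the limiting variance with the same factor.\<close>

lemma weight_correlation_limit:
  fixes s t :: "real^'d::finite"
  assumes s: "s \<in> unit_cube" and t: "t \<in> unit_cube"
  shows "(\<lambda>n. (\<Sum>i\<in>{i\<in>index_cube n. i + k \<in> index_cube n}. weight n s i * weight n t (i + k)) / real n ^ CARD('d))
    \<longlonglongrightarrow> (\<Prod>m\<in>UNIV. min (s $ m) (t $ m))"
proof -
  define c where "c n m = (\<Sum>j\<in>{j\<in>{1..int n}. j + k $ m \<in> {1..int n}}. ramp (real n * s $ m) j * ramp (real n * t $ m) (j + k $ m))" for n m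
  have st: "0 \<le> s $ m" "s $ m \<le> 1" "0 \<le> t $ m" "t $ m \<le> 1" for m
    using s t by (auto simp: mem_box_cart)
  have eq: "(\<Sum>i\<in>{i\<in>index_cube n. i + k \<in> index_cube n}. weight n s i * weight n t (i + k)) / real n ^ CARD('d)
     = (\<Prod>m\<in>UNIV. c n m / real n)" for n
  proof -
    have set: "{i\<in>index_cube n. i + k \<in> index_cube n} = {i::int^'d. \<forall>m. i $ m \<in> {j\<in>{1..int n}. j + k $ m \<in> {1..int n}}}"
      by (auto simp: index_cube_def)
    have "(\<Sum>i\<in>{i\<in>index_cube n. i + k \<in> index_cube n}. weight n s i * weight n t (i + k))
      = (\<Sum>i\<in>{i\<in>index_cube n. i + k \<in> index_cube n}. \<Prod>m\<in>UNIV. ramp (real n * s $ m) (i $ m) * ramp (real n * t $ m) (i $ m + k $ m))"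
      by (simp add: weight_def prod.distrib)
    also have "\<dots> = (\<Prod>m\<in>UNIV. c n m)"
      unfolding set c_def by (rule sum_prod_vec[of _ "\<lambda>m j. ramp (real n * s $ m) j * ramp (real n * t $ m) (j + k $ m)"])
        (rule finite_subset[of _ "{1..int n}"], auto)
    finally show ?thesis by (simp add: prod_dividef)
  qed
  have "(\<lambda>n. c n m / real n) \<longlonglongrightarrow> min (s $ m) (t $ m)" for m
  proof (rule LIM_zero_cancel, rule Lim_null_comparison)
    show "\<forall>\<^sub>F n in sequentially. norm (c n m / real n - min (s $ m) (t $ m)) \<le> (3 * real_of_int \<bar>k $ m\<bar> + 1) / real n"
    proof (rule eventually_sequentiallyI[of 1])
      fix n :: nat assume n: "1 \<le> n"
      have le: "real n * s $ m \<le> real n" "real n * t $ m \<le> real n"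
        using st[of m] by (auto intro: mult_left_le)
      have "min (real n * s $ m) (real n * t $ m) = real n * min (s $ m) (t $ m)"
        using n by (simp add: min_mult_distrib_left)
      then have "\<bar>c n m - real n * min (s $ m) (t $ m)\<bar> \<le> 3 * real_of_int \<bar>k $ m\<bar> + 1"
        using ramp_correlation[of "real n * s $ m" n "real n * t $ m" "k $ m"] st[of m] le by (simp add: c_def)
      then have "\<bar>c n m - real n * min (s $ m) (t $ m)\<bar> / real n \<le> (3 * real_of_int \<bar>k $ m\<bar> + 1) / real n"
        by (rule divide_right_mono) simp
      moreover have "c n m / real n - min (s $ m) (t $ m) = (c n m - real n * min (s $ m) (t $ m)) / real n"
        using n by (simp add: field_simps)
      ultimately show "norm (c n m / real n - min (s $ m) (t $ m)) \<le> (3 * real_of_int \<bar>k $ m\<bar> + 1) / real n"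
        by (simp add: abs_divide)
    qed
    show "(\<lambda>n. (3 * real_of_int \<bar>k $ m\<bar> + 1) / real n) \<longlonglongrightarrow> 0"
      by (rule lim_const_over_n)
  qed
  then show ?thesis unfolding eq by (intro tendsto_prod)
qed

text \<open>Dominated convergence for counting measure: unconditional summability of reals is
  absolute, so B |f| is an integrable bound.\<close>

lemma tendsto_weighted_infsum:
  fixes f :: "'k::countable \<Rightarrow> real"
  assumes f: "f summable_on UNIV" and B: "\<And>n k. \<bar>g n k\<bar> \<le> B" and lim: "\<And>k. (\<lambda>n. g n k) \<longlonglongrightarrow> G"
    and fin: "\<And>n. finite (S n)" and supp: "\<And>n k. k \<notin> S n \<Longrightarrow> g n k = 0"
  shows "(\<lambda>n. \<Sum>k\<in>S n. f k * g n k) \<longlonglongrightarrow> infsum f UNIV * G"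
proof -
  have abs: "Infinite_Set_Sum.abs_summable_on f UNIV"
    using f summable_on_iff_abs_summable_on_real[of f UNIV] abs_summable_equivalent[of f UNIV] by blast
  then have int: "integrable (count_space UNIV) f" by (simp add: Infinite_Set_Sum.abs_summable_on_def)
  have "(\<lambda>n. \<integral>k. f k * g n k \<partial>count_space UNIV) \<longlonglongrightarrow> (\<integral>k. f k * G \<partial>count_space UNIV)"
  proof (rule integral_dominated_convergence[where w = "\<lambda>k. B * \<bar>f k\<bar>"])
    show "integrable (count_space UNIV) (\<lambda>k. B * \<bar>f k\<bar>)" using int by (intro integrable_mult_right integrable_abs)
    show "AE k in count_space UNIV. (\<lambda>n. f k * g n k) \<longlonglongrightarrow> f k * G"
      by (intro AE_I2 tendsto_mult tendsto_const lim)
    show "AE k in count_space UNIV. norm (f k * g n k) \<le> B * \<bar>f k\<bar>" for n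
      using B by (intro AE_I2) (simp add: abs_mult mult.commute[of B] mult_left_mono)
  qed auto
  moreover have "(\<integral>k. f k * G \<partial>count_space UNIV) = infsum f UNIV * G"
    using infsetsum_infsum[OF abs] int by (simp add: infsetsum_def)
  moreover have "(\<integral>k. f k * g n k \<partial>count_space UNIV) = (\<Sum>k\<in>S n. f k * g n k)" for n
  proof -
    have "(\<integral>k. f k * g n k \<partial>count_space UNIV) = (\<Sum>k | f k * g n k \<noteq> 0. f k * g n k)"
      by (subst lebesgue_integral_count_space_finite_support)
        (rule finite_subset[OF _ fin[of n]], use supp in auto)
    also have "\<dots> = (\<Sum>k\<in>S n. f k * g n k)"
      by (rule sum.mono_neutral_left[OF fin]) (use supp in auto)
    finally show ?thesis .
  qed
  ultimately show ?thesis by (simp only:)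
qed

subsection \<open>Gaussian variables and convergence of finite-dimensional distributions\<close>

lemma char_std_normal_cos: "(\<integral>x. cos (s * x + b) \<partial>std_normal_distribution) = exp (- s\<^sup>2 / 2) * cos b"
proof -
  interpret prob_space std_normal_distribution by (rule prob_space_normal_density) simp
  have c: "(CLINT x|std_normal_distribution. iexp (s * x)) = complex_of_real (exp (- s\<^sup>2 / 2))"
    using fun_cong[OF char_std_normal_distribution, of s] by (simp add: char_def)
  have int: "integrable std_normal_distribution (\<lambda>x. iexp (s * x))"
    by (rule integrable_const_bound[where B = 1]) auto
  have b: "brv std_normal_distribution (\<lambda>x. cos (s * x))" "brv std_normal_distribution (\<lambda>x. sin (s * x))"
    by (rule brvI[where D = 1]; simp)+
  have 1: "(\<integral>x. cos (s * x) \<partial>std_normal_distribution) = exp (- s\<^sup>2 / 2)"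
    using integral_Re[OF int] c by (simp add: Re_exp)
  have 2: "(\<integral>x. sin (s * x) \<partial>std_normal_distribution) = 0"
    using integral_Im[OF int] c by (simp add: Im_exp)
  have "(\<integral>x. cos (s * x + b) \<partial>std_normal_distribution)
      = (\<integral>x. cos b * cos (s * x) - sin b * sin (s * x) \<partial>std_normal_distribution)"
    by (simp add: cos_add mult.commute)
  also have "\<dots> = cos b * (\<integral>x. cos (s * x) \<partial>std_normal_distribution) - sin b * (\<integral>x. sin (s * x) \<partial>std_normal_distribution)"
    by (subst Bochner_Integration.integral_diff, intro brv_integrable brvs b, intro brv_integrable brvs b) simp
  finally show ?thesis using 1 2 by simp
qed

text \<open>A variable with a density is rescaled to the standard normal. In the degenerate case the
  constant must be the mean 0, and the formula reads cos b = cos b.\<close>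

lemma (in prob_space) gaussian_rv_centered:
  assumes X: "gaussian_rv M X" and X0: "(\<integral>x. X x \<partial>M) = 0"
  shows gaussian_rv_square_integrable: "integrable M (\<lambda>x. (X x)\<^sup>2)"
    and gaussian_rv_cos: "(\<integral>x. cos (X x + b) \<partial>M) = exp (- (\<integral>x. (X x)\<^sup>2 \<partial>M) / 2) * cos b"
proof -
  have Xm[measurable]: "X \<in> borel_measurable M" using X by (simp add: gaussian_rv_def)
  have "integrable M (\<lambda>x. (X x)\<^sup>2) \<and> (\<integral>x. cos (X x + b) \<partial>M) = exp (- (\<integral>x. (X x)\<^sup>2 \<partial>M) / 2) * cos b"
  proof (cases "\<exists>m s. 0 < s \<and> distributed M lborel X (normal_density m s)")
    case True
    then obtain m s where s: "0 < s" and d: "distributed M lborel X (normal_density m s)" by blast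
    have m: "m = 0" using normal_distributed_expectation[OF s d] X0 by simp
    have int: "integrable M (\<lambda>x. (X x)\<^sup>2)"
    proof -
      have "integrable lborel (\<lambda>x. normal_density 0 s x * (x - 0) ^ 2)"
        by (rule integrable_normal_moment[OF s])
      then show ?thesis
        using distributed_integrable[OF d, of "\<lambda>x. x\<^sup>2"] by (simp add: m)
    qed
    have var: "(\<integral>x. (X x)\<^sup>2 \<partial>M) = s\<^sup>2"
      using normal_distributed_variance[OF s d] X0 by simp
    have dZ: "distributed M lborel (\<lambda>x. X x / s) std_normal_density"
      using normal_standard_normal_convert[OF s, of X 0] d by (simp add: m)
    have "(\<integral>x. cos (X x + b) \<partial>M) = (\<integral>x. cos (s * (X x / s) + b) \<partial>M)" using s by simp
    also have "\<dots> = (\<integral>x. cos (s * x + b) \<partial>distr M lborel (\<lambda>x. X x / s))"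
      by (rule integral_distr[symmetric]) auto
    also have "distr M lborel (\<lambda>x. X x / s) = std_normal_distribution"
      by (rule distributed_distr_eq_density[OF dZ])
    finally show ?thesis using int var by (simp add: char_std_normal_cos)
  next
    case False
    then obtain m where m: "AE x in M. X x = m" using X by (auto simp: gaussian_rv_def)
    have "(\<integral>x. X x \<partial>M) = (\<integral>x. m \<partial>M)"
      by (rule integral_cong_AE) (use m in auto)
    then have m0: "m = 0" using X0 by (simp add: prob_space)
    have i: "integrable M (\<lambda>x. (X x)\<^sup>2) \<longleftrightarrow> integrable M (\<lambda>x. 0::real)"
      by (rule integrable_cong_AE) (use m m0 in auto)
    have e1: "(\<integral>x. (X x)\<^sup>2 \<partial>M) = (\<integral>x. 0 \<partial>M)"
      by (rule integral_cong_AE) (use m m0 in auto)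
    have e2: "(\<integral>x. cos (X x + b) \<partial>M) = (\<integral>x. cos b \<partial>M)"
      by (rule integral_cong_AE) (use m m0 in auto)
    show ?thesis using i e1 e2 by (simp add: prob_space)
  qed
  then show "integrable M (\<lambda>x. (X x)\<^sup>2)" "(\<integral>x. cos (X x + b) \<partial>M) = exp (- (\<integral>x. (X x)\<^sup>2 \<partial>M) / 2) * cos b"
    by auto
qed

text \<open>The functions whose integrals are controlled by the cosine integrals. The phases include
  sines, and product-to-sum formulas make the class an algebra, as Stone-Weierstrass
  requires.\<close>

inductive_set trig_polys :: "'i set \<Rightarrow> (('i \<Rightarrow> real) \<Rightarrow> real) set" for G where
  cosine: "(\<lambda>x. r * cos ((\<Sum>i\<in>G. a i * x i) + b)) \<in> trig_polys G"
| plus: "f \<in> trig_polys G \<Longrightarrow> g \<in> trig_polys G \<Longrightarrow> (\<lambda>x. f x + g x) \<in> trig_polys G"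

lemma trig_polys_cos_mult:
  assumes "f \<in> trig_polys G"
  shows "(\<lambda>x. (r * cos ((\<Sum>i\<in>G. a i * x i) + b)) * f x) \<in> trig_polys G"
  using assms
proof induction
  case (cosine r' a' b')
  have "(\<lambda>x. (r * cos ((\<Sum>i\<in>G. a i * x i) + b)) * (r' * cos ((\<Sum>i\<in>G. a' i * x i) + b')))
    = (\<lambda>x. (r * r' / 2) * cos ((\<Sum>i\<in>G. (a i - a' i) * x i) + (b - b'))
         + (r * r' / 2) * cos ((\<Sum>i\<in>G. (a i + a' i) * x i) + (b + b')))"
  proof
    fix x
    have e: "((\<Sum>i\<in>G. a i * x i) + b) - ((\<Sum>i\<in>G. a' i * x i) + b') = (\<Sum>i\<in>G. (a i - a' i) * x i) + (b - b')"
       "((\<Sum>i\<in>G. a i * x i) + b) + ((\<Sum>i\<in>G. a' i * x i) + b') = (\<Sum>i\<in>G. (a i + a' i) * x i) + (b + b')"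
      by (simp_all add: left_diff_distrib distrib_right sum_subtractf sum.distrib)
    show "(r * cos ((\<Sum>i\<in>G. a i * x i) + b)) * (r' * cos ((\<Sum>i\<in>G. a' i * x i) + b'))
      = (r * r' / 2) * cos ((\<Sum>i\<in>G. (a i - a' i) * x i) + (b - b'))
         + (r * r' / 2) * cos ((\<Sum>i\<in>G. (a i + a' i) * x i) + (b + b'))"
      unfolding e[symmetric] using cos_times_cos[of "(\<Sum>i\<in>G. a i * x i) + b" "(\<Sum>i\<in>G. a' i * x i) + b'"]
      by (simp add: field_simps)
  qed
  also have "\<dots> \<in> trig_polys G"
    by (intro trig_polys.plus trig_polys.cosine)
  finally show ?case .
next
  case (plus f g)
  then show ?case by (simp only: distrib_left) (rule trig_polys.plus)
qed

lemma trig_polys_mult: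
  assumes "f \<in> trig_polys G" "g \<in> trig_polys G"
  shows "(\<lambda>x. f x * g x) \<in> trig_polys G"
  using assms(1)
proof induction
  case (cosine r a b)
  show ?case by (rule trig_polys_cos_mult[OF assms(2)])
next
  case (plus f f')
  then show ?case by (simp only: distrib_right) (rule trig_polys.plus)
qed

lemma trig_polys_const: "(\<lambda>_. r) \<in> trig_polys G"
  using trig_polys.cosine[where G = G and r = r and a = "\<lambda>_. 0" and b = 0] by simp

lemma trig_polys_sin_coord:
  assumes "finite G" "i \<in> G" shows "(\<lambda>x. sin (c * x i)) \<in> trig_polys G"
proof -
  have "(\<Sum>j\<in>G. (if j = i then c else 0) * x j) = c * x i" for x :: "'a \<Rightarrow> real"
    using assms by (simp add: if_distrib[of "\<lambda>z. z * _"] cong: if_cong)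
  then have "(\<lambda>x. 1 * cos ((\<Sum>j\<in>G. (if j = i then c else 0) * x j) + (- pi / 2))) = (\<lambda>x. sin (c * x i))"
    by (simp add: cos_diff)
  then show ?thesis using trig_polys.cosine[where G = G and r = 1 and a = "\<lambda>j. if j = i then c else 0" and b = "- pi/2"] by simp
qed

text \<open>Turns a function on the full product into one of the coordinates in \<open>G\<close>,
  without leaving the type of all families.\<close>

definition cut :: "'i set \<Rightarrow> ('i \<Rightarrow> real) \<Rightarrow> 'i \<Rightarrow> real" where
  "cut G x = (\<lambda>i. if i \<in> G then x i else 0)"

text \<open>A bounded continuous function of finitely many coordinates agrees on a large cube with a
  function of the sines of the coordinates, and is therefore approximated there by a trigonometric
  polynomial that is bounded everywhere.\<close>

lemma trig_polys_approx:
  fixes g :: "('i::countable \<Rightarrow> real) \<Rightarrow> real"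
  assumes G: "finite G" and g: "continuous_on UNIV g" and Mg: "\<And>x. \<bar>g x\<bar> \<le> Mg" and K: "0 < K" and e: "0 < e"
  obtains h where "h \<in> trig_polys G" "\<And>x. (\<And>i. i \<in> G \<Longrightarrow> \<bar>x i\<bar> \<le> K) \<Longrightarrow> \<bar>g (cut G x) - h x\<bar> \<le> e"
    "\<And>x. \<bar>h x\<bar> \<le> Mg + e"
proof -
  \<comment> \<open>With this frequency x \<mapsto> sin(c x) maps [-K, K] bijectively onto [-1, 1],
    with inverse arcsin(.)/c.\<close>
  define c where "c = pi / (2 * K)"
  have c: "0 < c" using K by (simp add: c_def)
  \<comment> \<open>The range of the sine map. It is compact, and the factors {0} off
    \<open>G\<close> ensure that distinct points differ at a coordinate in \<open>G\<close>.\<close>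
  define S where "S = Pi\<^sub>E UNIV (\<lambda>i::'i. if i \<in> G then {-1..1::real} else {0})"
  define H where "H s = g (\<lambda>i. arcsin (s i) / c)" for s
  define sc where "sc x = (\<lambda>i. if i \<in> G then sin (c * x i) else 0)" for x :: "'i \<Rightarrow> real"
  define Rg where "Rg = {f. continuous_on S f \<and> (\<lambda>x. f (sc x)) \<in> trig_polys G}"
  have S: "s i \<in> {-1..1}" if "s \<in> S" for s i
    using that by (auto simp: S_def PiE_iff split: if_splits)
  have sc: "sc x \<in> S" for x by (auto simp: S_def sc_def)
  have "compact S"
  proof -
    have "compactin (product_topology (\<lambda>_::'i. euclidean :: real topology) UNIV) S"
      unfolding S_def by (subst compactin_PiE) auto
    then show ?thesis by (simp add: euclidean_product_topology)
  qed
  interpret function_ring_on Rg S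
  proof
    show "compact S" by fact
    fix f assume "f \<in> Rg" then show "continuous_on S f" by (simp add: Rg_def)
  next
    fix f g assume "f \<in> Rg" "g \<in> Rg"
    then show "(\<lambda>x. f x + g x) \<in> Rg" "(\<lambda>x. f x * g x) \<in> Rg"
      by (auto simp: Rg_def intro: continuous_intros trig_polys.plus trig_polys_mult)
  next
    show "(\<lambda>_. c) \<in> Rg" for c by (simp add: Rg_def trig_polys_const)
  next
    fix x y assume xy: "x \<in> S" "y \<in> S" "x \<noteq> y"
    then obtain i where i: "x i \<noteq> y i" by auto
    have "i \<in> G"
    proof (rule ccontr)
      assume "i \<notin> G"
      then have "x i = 0" "y i = 0" using xy(1,2) by (auto simp: S_def PiE_iff dest!: spec[of _ i])
      with i show False by simp
    qed
    moreover have "continuous_on S (\<lambda>x. x i)"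
      by (rule continuous_on_subset[OF continuous_on_product_coordinates]) auto
    ultimately have "(\<lambda>x. x i) \<in> Rg"
      using trig_polys_sin_coord[OF G, of i c] by (simp add: Rg_def sc_def)
    with i show "\<exists>f\<in>Rg. f x \<noteq> f y" by (intro bexI[of _ "\<lambda>x. x i"])
  qed
  have "continuous_on S H"
    unfolding H_def
  proof (rule continuous_on_compose2[OF g])
    show "continuous_on S (\<lambda>s i. arcsin (s i) / c)"
    proof (rule continuous_on_coordinatewise_then_product)
      fix i
      have "continuous_on S (\<lambda>x. x i)"
        by (rule continuous_on_subset[OF continuous_on_product_coordinates]) auto
      then show "continuous_on S (\<lambda>s. arcsin (s i) / c)"
        using S c by (intro continuous_intros continuous_on_arcsin) auto
    qed
  qed auto
  from Stone_Weierstrass_basic[OF this e] obtain f where f: "f \<in> Rg" "\<And>s. s \<in> S \<Longrightarrow> \<bar>H s - f s\<bar> < e"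
    by blast
  show thesis
  proof (rule that[of "\<lambda>x. f (sc x)"])
    show "(\<lambda>x. f (sc x)) \<in> trig_polys G" using f(1) by (simp add: Rg_def)
    \<comment> \<open>The sine map sends every x into S, including those outside the cube; hence the
      approximant inherits a global bound.\<close>
    show "\<bar>f (sc x)\<bar> \<le> Mg + e" for x
      using f(2)[OF sc[of x]] Mg[of "\<lambda>i. arcsin (sc x i) / c"] by (simp add: H_def)
    fix x assume x: "\<And>i. i \<in> G \<Longrightarrow> \<bar>x i\<bar> \<le> K"
    have "(\<lambda>i. arcsin (sc x i) / c) = cut G x"
    proof
      fix i
      show "arcsin (sc x i) / c = cut G x i"
      proof (cases "i \<in> G")
        case True
        have "\<bar>c * x i\<bar> \<le> c * K" using x[OF True] c by (simp add: abs_mult mult_left_mono)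
        also have "c * K = pi / 2" using K by (simp add: c_def)
        finally have "arcsin (sin (c * x i)) = c * x i" by (intro arcsin_sin) auto
        then show ?thesis using True c by (simp add: sc_def cut_def)
      qed (simp add: sc_def cut_def)
    qed
    then show "\<bar>g (cut G x) - f (sc x)\<bar> \<le> e" using f(2)[OF sc[of x]] by (simp add: H_def)
  qed
qed

lemma measurable_cut:
  fixes X :: "'i::countable \<Rightarrow> 'x \<Rightarrow> real" and g :: "('i \<Rightarrow> real) \<Rightarrow> real"
  assumes "\<And>i. i \<in> G \<Longrightarrow> X i \<in> borel_measurable M" and g: "continuous_on UNIV g"
  shows "(\<lambda>x. g (cut G (\<lambda>i. X i x))) \<in> borel_measurable M"
proof (rule measurable_compose[where N = borel and g = g and f = "\<lambda>x. cut G (\<lambda>i. X i x)"])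
  show "g \<in> borel_measurable borel" by (rule borel_measurable_continuous_onI[OF g])
  show "(\<lambda>x. cut G (\<lambda>i. X i x)) \<in> borel_measurable M"
    unfolding cut_def
  proof (rule measurable_coordinatewise_then_product)
    show "(\<lambda>x. if i \<in> G then X i x else 0) \<in> borel_measurable M" for i
      using assms(1) by (cases "i \<in> G") simp_all
  qed
qed

lemma brv_trig_polys:
  assumes "\<And>i. i \<in> G \<Longrightarrow> X i \<in> borel_measurable M" "h \<in> trig_polys G"
  shows "brv M (\<lambda>x. h (\<lambda>i. X i x))"
  using assms(2)
proof induction
  case (cosine r a b)
  have "(\<lambda>x. cos ((\<Sum>i\<in>G. a i * X i x) + b)) \<in> borel_measurable M"
    using assms(1) by simp
  then have "brv M (\<lambda>x. cos ((\<Sum>i\<in>G. a i * X i x) + b))"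
    by (rule brvI[where D = 1]) simp
  then show ?case by (rule brv_mult[OF brv_const])
qed (rule brv_add)

text \<open>Inside the cube of half-width K the error is e. Outside it the sum of squares over K^2
  is at least 1, which dominates the trivial bound 2 Mg + e pointwise and integrates to Chebyshev's
  estimate.\<close>

lemma (in prob_space) trig_polys_approx_integral:
  fixes X :: "'i::countable \<Rightarrow> 'a \<Rightarrow> real" and g :: "('i \<Rightarrow> real) \<Rightarrow> real"
  assumes X: "\<And>i. i \<in> G \<Longrightarrow> X i \<in> borel_measurable M" and G: "finite G"
    and int: "\<And>i. i \<in> G \<Longrightarrow> integrable M (\<lambda>x. (X i x)\<^sup>2)" "\<And>i. i \<in> G \<Longrightarrow> (\<integral>x. (X i x)\<^sup>2 \<partial>M) \<le> B"
    and g: "continuous_on UNIV g" and Mg: "\<And>x. \<bar>g x\<bar> \<le> Mg" and K: "0 < K" and e: "0 < e"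
    and h: "h \<in> trig_polys G" "\<And>x. (\<And>i. i \<in> G \<Longrightarrow> \<bar>x i\<bar> \<le> K) \<Longrightarrow> \<bar>g (cut G x) - h x\<bar> \<le> e"
      "\<And>x. \<bar>h x\<bar> \<le> Mg + e"
  shows "\<bar>(\<integral>x. g (cut G (\<lambda>i. X i x)) \<partial>M) - (\<integral>x. h (\<lambda>i. X i x) \<partial>M)\<bar> \<le> e + (2 * Mg + e) * (real (card G) * B / K\<^sup>2)"
proof -
  have Mg0: "0 \<le> Mg" using Mg[of undefined] by linarith
  have gb: "brv M (\<lambda>x. g (cut G (\<lambda>i. X i x)))"
    by (rule brvI[OF measurable_cut[OF X g] Mg])
  have hb: "brv M (\<lambda>x. h (\<lambda>i. X i x))" by (rule brv_trig_polys[OF X h(1)])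
  have intR: "integrable M (\<lambda>x. e + (2 * Mg + e) * ((\<Sum>i\<in>G. (X i x)\<^sup>2) / K\<^sup>2))"
    using int(1) by (intro Bochner_Integration.integrable_add integrable_mult_right integrable_divide_zero Bochner_Integration.integrable_sum) auto
  have "\<bar>(\<integral>x. g (cut G (\<lambda>i. X i x)) \<partial>M) - (\<integral>x. h (\<lambda>i. X i x) \<partial>M)\<bar>
     = \<bar>\<integral>x. g (cut G (\<lambda>i. X i x)) - h (\<lambda>i. X i x) \<partial>M\<bar>"
    by (subst Bochner_Integration.integral_diff, intro brv_integrable gb, intro brv_integrable hb) simp
  also have "\<dots> \<le> (\<integral>x. \<bar>g (cut G (\<lambda>i. X i x)) - h (\<lambda>i. X i x)\<bar> \<partial>M)" by (rule integral_abs_bound)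
  also have "\<dots> \<le> (\<integral>x. e + (2 * Mg + e) * ((\<Sum>i\<in>G. (X i x)\<^sup>2) / K\<^sup>2) \<partial>M)"
  proof (rule integral_mono[OF _ intR])
    show "integrable M (\<lambda>x. \<bar>g (cut G (\<lambda>i. X i x)) - h (\<lambda>i. X i x)\<bar>)"
      by (intro brv_integrable brv_abs brv_diff gb hb)
    fix x
    define T where "T = (2 * Mg + e) * ((\<Sum>i\<in>G. (X i x)\<^sup>2) / K\<^sup>2)"
    have nn: "0 \<le> T" unfolding T_def
      using Mg0 e by (intro mult_nonneg_nonneg divide_nonneg_nonneg sum_nonneg) auto
    have "\<bar>g (cut G (\<lambda>i. X i x)) - h (\<lambda>i. X i x)\<bar> \<le> e + T"
    proof (cases "\<forall>i\<in>G. \<bar>X i x\<bar> \<le> K")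
      case True
      then have "\<bar>g (cut G (\<lambda>i. X i x)) - h (\<lambda>i. X i x)\<bar> \<le> e" by (intro h(2)) auto
      with nn show ?thesis by linarith
    next
      case False
      then obtain i where i: "i \<in> G" "K < \<bar>X i x\<bar>" by auto
      have "K\<^sup>2 \<le> \<bar>X i x\<bar>\<^sup>2" using i K by (intro power_mono) auto
      also have "\<dots> \<le> (\<Sum>i\<in>G. (X i x)\<^sup>2)" using member_le_sum[OF i(1), of "\<lambda>i. (X i x)\<^sup>2"] G by simp
      finally have "1 \<le> (\<Sum>i\<in>G. (X i x)\<^sup>2) / K\<^sup>2" using K by simp
      then have "(2 * Mg + e) * 1 \<le> T"
        unfolding T_def using Mg0 e by (intro mult_left_mono) auto
      then have "Mg + (Mg + e) \<le> T" by simp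
      moreover have "\<bar>g (cut G (\<lambda>i. X i x)) - h (\<lambda>i. X i x)\<bar> \<le> Mg + (Mg + e)"
        by (rule order_trans[OF abs_triangle_ineq4 add_mono[OF Mg h(3)]])
      ultimately have "\<bar>g (cut G (\<lambda>i. X i x)) - h (\<lambda>i. X i x)\<bar> \<le> T" by (rule order_trans[rotated])
      also have "T \<le> e + T" using e by simp
      finally show ?thesis .
    qed
    then show "\<bar>g (cut G (\<lambda>i. X i x)) - h (\<lambda>i. X i x)\<bar> \<le> e + (2 * Mg + e) * ((\<Sum>i\<in>G. (X i x)\<^sup>2) / K\<^sup>2)"
      by (simp only: T_def)
  qed
  also have "\<dots> = e + (2 * Mg + e) * ((\<Sum>i\<in>G. \<integral>x. (X i x)\<^sup>2 \<partial>M) / K\<^sup>2)"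
    using int(1) by (subst Bochner_Integration.integral_add) (auto simp: prob_space integral_divide_zero)
  also have "\<dots> \<le> e + (2 * Mg + e) * (real (card G) * B / K\<^sup>2)"
  proof -
    have "(\<Sum>i\<in>G. \<integral>x. (X i x)\<^sup>2 \<partial>M) \<le> real (card G) * B"
      using int(2) by (rule sum_bounded_above)
    then show ?thesis using Mg0 e by (intro add_left_mono mult_left_mono divide_right_mono) auto
  qed
  finally show ?thesis .
qed

text \<open>Cosine integrals determine the limits for trigonometric polynomials. The common
  second-moment bound keeps the mass in a large cube, where these approximate any bounded continuous
  function of the coordinates in \<open>G\<close>; it takes the place of tightness.\<close>

lemma cramer_wold:
  fixes X :: "nat \<Rightarrow> 'i::countable \<Rightarrow> 'x \<Rightarrow> real" and X' :: "'i \<Rightarrow> 'w \<Rightarrow> real" and g :: "('i \<Rightarrow> real) \<Rightarrow> real"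
  assumes M: "prob_space M" and N: "prob_space N" and G: "finite G"
    and X: "\<And>n i. i \<in> G \<Longrightarrow> X n i \<in> borel_measurable M" "\<And>i. i \<in> G \<Longrightarrow> X' i \<in> borel_measurable N"
    and int: "\<And>n i. i \<in> G \<Longrightarrow> integrable M (\<lambda>x. (X n i x)\<^sup>2)" "\<And>i. i \<in> G \<Longrightarrow> integrable N (\<lambda>x. (X' i x)\<^sup>2)"
    and B: "\<And>n i. i \<in> G \<Longrightarrow> (\<integral>x. (X n i x)\<^sup>2 \<partial>M) \<le> B" "\<And>i. i \<in> G \<Longrightarrow> (\<integral>x. (X' i x)\<^sup>2 \<partial>N) \<le> B"
    and conv: "\<And>a b. (\<lambda>n. \<integral>x. cos ((\<Sum>i\<in>G. a i * X n i x) + b) \<partial>M) \<longlonglongrightarrow> (\<integral>w. cos ((\<Sum>i\<in>G. a i * X' i w) + b) \<partial>N)"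
    and g: "continuous_on UNIV g" and Mg: "\<And>x. \<bar>g x\<bar> \<le> Mg"
  shows "(\<lambda>n. \<integral>x. g (cut G (\<lambda>i. X n i x)) \<partial>M) \<longlonglongrightarrow> (\<integral>w. g (cut G (\<lambda>i. X' i w)) \<partial>N)"
proof (rule LIMSEQ_I)
  fix r :: real assume r: "0 < r"
  interpret M: prob_space M by fact
  interpret N: prob_space N by fact
  have Mg0: "0 \<le> Mg" using Mg[of undefined] by linarith
  define e where "e = min 1 (r / 8)"
  have e: "0 < e" "e \<le> 1" "e \<le> r / 8" using r by (auto simp: e_def)
  define A where "A = (2 * Mg + 1) * (real (card G) * \<bar>B\<bar>)"
  have A: "0 \<le> A" using Mg0 by (simp add: A_def)
  \<comment> \<open>Makes A / K^2 at most r/8; the added 1 keeps K positive when A = 0.\<close>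
  define K where "K = sqrt (8 * A / r + 1)"
  have K: "0 < K" "K\<^sup>2 = 8 * A / r + 1" using A r by (auto simp: K_def add_nonneg_pos)
  have AK: "A / K\<^sup>2 \<le> r / 8"
  proof -
    have "A \<le> r / 8 * (8 * A / r + 1)" using r by (simp add: distrib_left)
    then show ?thesis unfolding K(2)[symmetric] using K(1) by (simp add: pos_divide_le_eq)
  qed
  have err: "e + (2 * Mg + e) * (real (card G) * B / K\<^sup>2) \<le> r / 4"
  proof -
    have "(2 * Mg + e) * (real (card G) * B / K\<^sup>2) \<le> (2 * Mg + 1) * (real (card G) * \<bar>B\<bar> / K\<^sup>2)"
    proof (rule order_trans)
      show "(2 * Mg + e) * (real (card G) * B / K\<^sup>2) \<le> (2 * Mg + e) * (real (card G) * \<bar>B\<bar> / K\<^sup>2)"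
        using Mg0 e by (intro mult_left_mono divide_right_mono) auto
      show "(2 * Mg + e) * (real (card G) * \<bar>B\<bar> / K\<^sup>2) \<le> (2 * Mg + 1) * (real (card G) * \<bar>B\<bar> / K\<^sup>2)"
        using Mg0 e by (intro mult_right_mono) auto
    qed
    also have "\<dots> = A / K\<^sup>2" by (simp add: A_def)
    finally show ?thesis using AK e by linarith
  qed
  obtain h where h: "h \<in> trig_polys G" "\<And>x. (\<And>i. i \<in> G \<Longrightarrow> \<bar>x i\<bar> \<le> K) \<Longrightarrow> \<bar>g (cut G x) - h x\<bar> \<le> e"
    "\<And>x. \<bar>h x\<bar> \<le> Mg + e"
    using trig_polys_approx[OF G g Mg K(1) e(1)] by blast
  have "(\<lambda>n. \<integral>x. h (\<lambda>i. X n i x) \<partial>M) \<longlonglongrightarrow> (\<integral>w. h (\<lambda>i. X' i w) \<partial>N)"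
    using h(1)
  proof induction
    case (cosine r a b)
    show ?case by (simp only: integral_mult_right_zero) (intro tendsto_mult tendsto_const conv)
  next
    case (plus f g)
    have "(\<integral>x. f (\<lambda>i. X n i x) + g (\<lambda>i. X n i x) \<partial>M) = (\<integral>x. f (\<lambda>i. X n i x) \<partial>M) + (\<integral>x. g (\<lambda>i. X n i x) \<partial>M)" for n
      by (rule Bochner_Integration.integral_add)
        (rule M.brv_integrable[OF brv_trig_polys[OF X(1) plus.hyps(1)]], assumption,
         rule M.brv_integrable[OF brv_trig_polys[OF X(1) plus.hyps(2)]], assumption)
    moreover have "(\<integral>w. f (\<lambda>i. X' i w) + g (\<lambda>i. X' i w) \<partial>N) = (\<integral>w. f (\<lambda>i. X' i w) \<partial>N) + (\<integral>w. g (\<lambda>i. X' i w) \<partial>N)"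
      by (rule Bochner_Integration.integral_add)
        (rule N.brv_integrable[OF brv_trig_polys[OF X(2) plus.hyps(1)]], assumption,
         rule N.brv_integrable[OF brv_trig_polys[OF X(2) plus.hyps(2)]], assumption)
    ultimately show ?case using plus.IH by (simp add: tendsto_add)
  qed
  from LIMSEQ_D[OF this, of "r / 4"] r obtain n0 where
    n0: "\<And>n. n \<ge> n0 \<Longrightarrow> \<bar>(\<integral>x. h (\<lambda>i. X n i x) \<partial>M) - (\<integral>w. h (\<lambda>i. X' i w) \<partial>N)\<bar> < r / 4"
    by (metis real_norm_def zero_less_divide_iff zero_less_numeral)
  show "\<exists>no. \<forall>n\<ge>no. norm ((\<integral>x. g (cut G (\<lambda>i. X n i x)) \<partial>M) - (\<integral>w. g (cut G (\<lambda>i. X' i w)) \<partial>N)) < r"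
  proof (intro exI allI impI)
    fix n assume n: "n0 \<le> n"
    have 1: "\<bar>(\<integral>x. g (cut G (\<lambda>i. X n i x)) \<partial>M) - (\<integral>x. h (\<lambda>i. X n i x) \<partial>M)\<bar> \<le> e + (2 * Mg + e) * (real (card G) * B / K\<^sup>2)"
      using X int B by (intro M.trig_polys_approx_integral G g Mg K(1) e(1) h) auto
    have 2: "\<bar>(\<integral>w. g (cut G (\<lambda>i. X' i w)) \<partial>N) - (\<integral>w. h (\<lambda>i. X' i w) \<partial>N)\<bar> \<le> e + (2 * Mg + e) * (real (card G) * B / K\<^sup>2)"
      using X int B by (intro N.trig_polys_approx_integral G g Mg K(1) e(1) h) auto
    show "norm ((\<integral>x. g (cut G (\<lambda>i. X n i x)) \<partial>M) - (\<integral>w. g (cut G (\<lambda>i. X' i w)) \<partial>N)) < r"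
      using 1 2 err n0[OF n] r unfolding real_norm_def by linarith
  qed
qed

subsection \<open>Central limit theorem for the finite-dimensional distributions\<close>

context finitary_setup
begin

definition scale :: "nat \<Rightarrow> real" where
  "scale n = real n powr (- real CARD('d) / 2)"

definition F :: "nat \<Rightarrow> real^'d \<Rightarrow> (int^'d \<Rightarrow> 'a) \<Rightarrow> real" where
  "F n t x = scale n * W_proc v n t x"

definition cov :: "int^'d \<Rightarrow> real" where
  "cov k = (\<integral>x. v x * v (shift k x) \<partial>\<mu>)"

section \<open>Moments and covariances of the normalized process\<close>

lemma F_eq: "t \<in> unit_cube \<Longrightarrow> F n t x =
    (\<Sum>i\<in>index_cube n. (scale n * weight n t i) * v (shift i x))"
  by (simp add: F_def W_proc_eq sum_distrib_left mult.assoc)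

lemma scale_0[simp]: "scale 0 = 0"
  by (simp add: scale_def)

lemma scale_sq:
  assumes "0 < n" shows "(scale n)\<^sup>2 = 1 / real n ^ CARD('d)"
proof -
  have "(scale n)\<^sup>2 = real n powr (- real CARD('d))"
    using assms by (simp add: scale_def powr_realpow[symmetric] powr_powr powr_add[symmetric] power2_eq_square)
  also have "\<dots> = 1 / real n ^ CARD('d)"
    using assms by (simp add: powr_minus powr_realpow divide_inverse)
  finally show ?thesis .
qed

lemma brv_F: assumes "t \<in> unit_cube" shows "brv \<mu> (F n t)"
proof -
  have "brv \<mu> (\<lambda>x. \<Sum>i\<in>index_cube n. (scale n * weight n t i) * v (shift i x))"
    by (intro brvs brv_v_shift)
  then show ?thesis by (simp add: F_eq[OF assms, abs_def])
qed

lemma Z_eq: "y \<in> Y \<Longrightarrow> Z y = v (\<pi> y)"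
  by (simp add: Z_def)

lemma moment_sum:
  obtains K where "0 \<le> K" "\<And>I a. finite I \<Longrightarrow>
    (\<integral>x. \<bar>\<Sum>i\<in>I. a i * v (shift i x)\<bar> ^ (2 * (2 * CARD('d))) \<partial>\<mu>) \<le> (K * sqrt (\<Sum>i\<in>I. (a i)\<^sup>2)) ^ (2 * (2 * CARD('d)))"
proof -
  obtain C \<rho> m where "approx_field L P Z C \<rho> m" using approx_field_Z by blast
  then interpret A: approx_field L P Z C \<rho> m .
  obtain K where K: "0 \<le> K" "\<And>I a. finite I \<Longrightarrow>
    (\<integral>y. \<bar>A.wsum Z I a y\<bar> ^ (2 * (2 * CARD('d))) \<partial>P) \<le> (K * sqrt (\<Sum>i\<in>I. (a i)\<^sup>2)) ^ (2 * (2 * CARD('d)))"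
    using A.moment_bound by blast
  show thesis
  proof (rule that[OF K(1)])
    fix I :: "(int^'d) set" and a :: "int^'d \<Rightarrow> real" assume I: "finite I"
    have "(\<integral>x. \<bar>\<Sum>i\<in>I. a i * v (shift i x)\<bar> ^ (2 * (2 * CARD('d))) \<partial>\<mu>)
        = (\<integral>y. \<bar>\<Sum>i\<in>I. a i * Z (shift i y)\<bar> ^ (2 * (2 * CARD('d))) \<partial>P)"
      by (rule transfer_sum[of "\<lambda>r. \<bar>r\<bar> ^ (2 * (2 * CARD('d)))"]) measurable
    then show "(\<integral>x. \<bar>\<Sum>i\<in>I. a i * v (shift i x)\<bar> ^ (2 * (2 * CARD('d))) \<partial>\<mu>) \<le> (K * sqrt (\<Sum>i\<in>I. (a i)\<^sup>2)) ^ (2 * (2 * CARD('d)))"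
      using K(2)[OF I, of a] by (simp only: A.wsum_def)
  qed
qed

text \<open>The squared coefficients of the increment sum to at most the l^1 distance of s and t, so
  the moment of order 4d is of order |t - s|^(2d). The exponent exceeds the dimension, as chaining
  requires.\<close>

lemma moment_increment:
  obtains K where "0 \<le> K" "\<And>n s t. s \<in> unit_cube \<Longrightarrow> t \<in> unit_cube \<Longrightarrow>
    (\<integral>x. \<bar>F n t x - F n s x\<bar> ^ (4 * CARD('d)) \<partial>\<mu>) \<le> K * (\<Sum>m\<in>UNIV. \<bar>t $ m - s $ m\<bar>) ^ (2 * CARD('d))"
proof -
  obtain K where K: "0 \<le> K" "\<And>I a. finite I \<Longrightarrow>
    (\<integral>x. \<bar>\<Sum>i\<in>I. a i * v (shift i x)\<bar> ^ (2 * (2 * CARD('d))) \<partial>\<mu>) \<le> (K * sqrt (\<Sum>i\<in>I. (a i)\<^sup>2)) ^ (2 * (2 * CARD('d)))"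
    using moment_sum by blast
  show thesis
  proof (rule that[of "K ^ (4 * CARD('d))"])
    show "0 \<le> K ^ (4 * CARD('d))" using K by simp
    fix n and s t :: "real^'d" assume st: "s \<in> unit_cube" "t \<in> unit_cube"
    define r where "r = (\<Sum>m\<in>UNIV. \<bar>t $ m - s $ m\<bar>)"
    have r: "0 \<le> r" by (simp add: r_def sum_nonneg)
    define a where "a i = scale n * (weight n t i - weight n s i)" for i
    have diff: "F n t x - F n s x = (\<Sum>i\<in>index_cube n. a i * v (shift i x))" for x
      using st by (simp add: F_eq a_def sum_subtractf[symmetric] algebra_simps)
    have a2: "(\<Sum>i\<in>index_cube n. (a i)\<^sup>2) \<le> r"
    proof (cases "n = 0")
      case True
      then show ?thesis using r by (simp add: a_def)
    next
      case False
      then have "(\<Sum>i\<in>index_cube n. (a i)\<^sup>2) = (\<Sum>i\<in>index_cube n. (weight n t i - weight n s i)\<^sup>2) / real n ^ CARD('d)"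
        by (simp add: a_def power_mult_distrib scale_sq sum_divide_distrib)
      also have "\<dots> \<le> (real n ^ CARD('d) * r) / real n ^ CARD('d)"
        unfolding r_def by (intro divide_right_mono sum_weight_diff_sq) simp
      also have "\<dots> = r" using False by simp
      finally show ?thesis .
    qed
    have "(\<integral>x. \<bar>F n t x - F n s x\<bar> ^ (2 * (2 * CARD('d))) \<partial>\<mu>) \<le> (K * sqrt (\<Sum>i\<in>index_cube n. (a i)\<^sup>2)) ^ (2 * (2 * CARD('d)))"
      unfolding diff by (rule K(2)) simp
    also have "\<dots> \<le> (K * sqrt r) ^ (2 * (2 * CARD('d)))"
      using K a2 by (intro power_mono mult_left_mono real_sqrt_le_mono mult_nonneg_nonneg real_sqrt_ge_zero sum_nonneg) auto
    also have "\<dots> = K ^ (2 * (2 * CARD('d))) * r ^ (2 * CARD('d))"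
      unfolding power_mult_distrib power_mult[of "sqrt r" 2] using r by simp
    finally show "(\<integral>x. \<bar>F n t x - F n s x\<bar> ^ (4 * CARD('d)) \<partial>\<mu>) \<le> K ^ (4 * CARD('d)) * (\<Sum>m\<in>UNIV. \<bar>t $ m - s $ m\<bar>) ^ (2 * CARD('d))"
      by (simp add: r_def)
  qed
qed

lemma second_moment_F:
  obtains B where "\<And>n t. t \<in> unit_cube \<Longrightarrow> (\<integral>x. (F n t x)\<^sup>2 \<partial>\<mu>) \<le> B"
proof -
  obtain K where K: "0 \<le> K" "\<And>I a. finite I \<Longrightarrow>
    (\<integral>x. \<bar>\<Sum>i\<in>I. a i * v (shift i x)\<bar> ^ (2 * (2 * CARD('d))) \<partial>\<mu>) \<le> (K * sqrt (\<Sum>i\<in>I. (a i)\<^sup>2)) ^ (2 * (2 * CARD('d)))"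
    using moment_sum by blast
  show thesis
  proof (rule that[of "K\<^sup>2"])
    fix n and t :: "real^'d" assume t: "t \<in> unit_cube"
    define a where "a i = scale n * weight n t i" for i
    have a2: "(\<Sum>i\<in>index_cube n. (a i)\<^sup>2) \<le> 1"
    proof (cases "n = 0")
      case True
      then show ?thesis by (simp add: a_def)
    next
      case False
      then have "(\<Sum>i\<in>index_cube n. (a i)\<^sup>2) = (\<Sum>i\<in>index_cube n. (weight n t i)\<^sup>2) / real n ^ CARD('d)"
        by (simp add: a_def power_mult_distrib scale_sq sum_divide_distrib)
      also have "\<dots> \<le> (\<Sum>i\<in>(index_cube n :: (int^'d) set). 1) / real n ^ CARD('d)"
        by (intro divide_right_mono sum_mono power_le_one weight_range) simp
      also have "\<dots> = 1" using False by (simp add: card_index_cube)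
      finally show ?thesis .
    qed
    have "(\<integral>x. \<bar>F n t x\<bar> ^ (2 * (2 * CARD('d))) \<partial>\<mu>) \<le> (K * sqrt (\<Sum>i\<in>index_cube n. (a i)\<^sup>2)) ^ (2 * (2 * CARD('d)))"
      unfolding F_eq[OF t] a_def by (rule K(2)) simp
    also have "\<dots> \<le> (K * 1) ^ (2 * (2 * CARD('d)))"
      using K a2 by (intro power_mono mult_left_mono mult_nonneg_nonneg real_sqrt_ge_zero sum_nonneg) auto
    finally have m: "(\<integral>x. \<bar>F n t x\<bar> ^ (2 * (2 * CARD('d))) \<partial>\<mu>) \<le> K ^ (2 * (2 * CARD('d)))" by simp
    have "2 \<le> 2 * (2 * CARD('d))"
    proof -
      have "0 < CARD('d)" by simp
      then show ?thesis by linarith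
    qed
    from mu.integral_abs_power_le_of_higher[OF brv_F[OF t] this K(1) m]
    show "(\<integral>x. (F n t x)\<^sup>2 \<partial>\<mu>) \<le> K\<^sup>2" by simp
  qed
qed

text \<open>Stationarity, read off on the product space, where shifts preserve
  \<open>P\<close>.\<close>

lemma covariance_shift: "(\<integral>x. v (shift i x) * v (shift j x) \<partial>\<mu>) = cov (j - i)"
proof -
  have Zm: "(\<lambda>y. Z (shift i y)) \<in> borel_measurable P" for i
    by (rule brv_measurable[OF brv_shift[OF brv_Z]])
  have "(\<integral>x. v (shift i x) * v (shift j x) \<partial>\<mu>) = (\<integral>y. Z (shift i y) * Z (shift j y) \<partial>P)"
    by (rule transfer) (auto simp: Z_shift intro!: borel_measurable_times measurable_v_shift Zm)
  also have "\<dots> = (\<integral>y. Z (shift i y) * Z (shift (j - i) (shift i y)) \<partial>P)"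
    by (simp add: shift_def algebra_simps)
  also have "\<dots> = (\<integral>y. Z y * Z (shift (j - i) y) \<partial>P)"
    by (rule integral_shift[of "\<lambda>y. Z y * Z (shift (j - i) y)"])
      (intro borel_measurable_times Zm brv_measurable[OF brv_Z])
  also have "\<dots> = cov (j - i)"
    unfolding cov_def
    by (rule transfer[symmetric])
      (auto simp: Z_shift Z_eq intro!: borel_measurable_times measurable_v_shift measurable_v Zm brv_measurable[OF brv_Z])
  finally show ?thesis .
qed

lemma variance_sum:
  assumes I: "finite I"
  defines "S \<equiv> (\<lambda>(i, j). j - i) ` (I \<times> I)"
  shows "(\<integral>x. (\<Sum>i\<in>I. a i * v (shift i x))\<^sup>2 \<partial>\<mu>) = (\<Sum>k\<in>S. cov k * (\<Sum>i\<in>{i\<in>I. i + k \<in> I}. a i * a (i + k)))"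
proof -
  have S: "finite S" using I by (simp add: S_def)
  have "(\<integral>x. (\<Sum>i\<in>I. a i * v (shift i x))\<^sup>2 \<partial>\<mu>)
      = (\<integral>x. (\<Sum>i\<in>I. \<Sum>j\<in>I. (a i * a j) * (v (shift i x) * v (shift j x))) \<partial>\<mu>)"
    by (simp add: power2_eq_square sum_product mult_ac)
  also have "\<dots> = (\<Sum>i\<in>I. \<Sum>j\<in>I. (a i * a j) * cov (j - i))"
    by (subst Bochner_Integration.integral_sum, intro mu.brv_integrable brvs brv_v_shift,
        subst Bochner_Integration.integral_sum, intro mu.brv_integrable brvs brv_v_shift)
      (simp add: covariance_shift)
  also have "\<dots> = (\<Sum>i\<in>I. \<Sum>k\<in>S. if i + k \<in> I then (a i * a (i + k)) * cov k else 0)"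
  proof (rule sum.cong[OF refl])
    fix i assume i: "i \<in> I"
    have "(\<Sum>j\<in>I. (a i * a j) * cov (j - i)) = (\<Sum>k\<in>{k\<in>S. i + k \<in> I}. (a i * a (i + k)) * cov k)"
      by (rule sum.reindex_bij_witness[of _ "\<lambda>k. i + k" "\<lambda>j. j - i"]) (use i in \<open>auto simp: S_def\<close>)
    then show "(\<Sum>j\<in>I. (a i * a j) * cov (j - i)) = (\<Sum>k\<in>S. if i + k \<in> I then (a i * a (i + k)) * cov k else 0)"
      using S by (simp add: sum.inter_filter)
  qed
  also have "\<dots> = (\<Sum>k\<in>S. \<Sum>i\<in>I. if i + k \<in> I then (a i * a (i + k)) * cov k else 0)"
    by (rule sum.swap)
  also have "\<dots> = (\<Sum>k\<in>S. cov k * (\<Sum>i\<in>{i\<in>I. i + k \<in> I}. a i * a (i + k)))"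
    using I by (simp add: sum.inter_filter[symmetric] sum_distrib_left mult_ac)
  finally show ?thesis .
qed

text \<open>A linear combination of values of the process is again one weighted sum, with weights
  \<open>a n\<close>. Its variance is a sum over lattice differences k of covariances times weight
  correlations, whose limit V is the same for every k; dominated convergence yields
  \<open>asymp_var\<close> times V, and \<open>char_bound\<close> supplies the Gaussian
  form.\<close>

lemma clt_finite_dim:
  fixes u :: "'g \<Rightarrow> real^'d"
  assumes G: "finite G" and u: "\<And>g. g \<in> G \<Longrightarrow> u g \<in> unit_cube" and pos: "asymp_var \<mu> v > 0"
  shows "(\<lambda>n. \<integral>x. cos ((\<Sum>g\<in>G. c g * F n (u g) x) + b) \<partial>\<mu>)
    \<longlonglongrightarrow> exp (- (asymp_var \<mu> v * (\<Sum>g\<in>G. \<Sum>g'\<in>G. c g * c g' * (\<Prod>m\<in>UNIV. min (u g $ m) (u g' $ m)))) / 2) * cos b"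
proof -
  define V where "V = (\<Sum>g\<in>G. \<Sum>g'\<in>G. c g * c g' * (\<Prod>m\<in>UNIV. min (u g $ m) (u g' $ m)))"
  define C0 where "C0 = (\<Sum>g\<in>G. \<bar>c g\<bar>)"
  have C0: "0 \<le> C0" by (simp add: C0_def sum_nonneg)
  define w where "w n i = (\<Sum>g\<in>G. c g * weight n (u g) i)" for n i
  define a where "a n i = scale n * w n i" for n i
  have wC: "\<bar>w n i\<bar> \<le> C0" for n i
  proof -
    have "\<bar>w n i\<bar> \<le> (\<Sum>g\<in>G. \<bar>c g * weight n (u g) i\<bar>)" unfolding w_def by (rule sum_abs)
    also have "\<dots> \<le> C0" unfolding C0_def abs_mult
      by (intro sum_mono mult_left_le) (auto simp: abs_of_nonneg[OF weight_range(1)] weight_range)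
    finally show ?thesis .
  qed
  have eq: "(\<Sum>g\<in>G. c g * F n (u g) x) = (\<Sum>i\<in>index_cube n. a n i * v (shift i x))" for n x
  proof -
    have "(\<Sum>g\<in>G. c g * F n (u g) x) = (\<Sum>g\<in>G. \<Sum>i\<in>index_cube n. c g * ((scale n * weight n (u g) i) * v (shift i x)))"
      using u by (intro sum.cong refl) (simp add: F_eq sum_distrib_left)
    also have "\<dots> = (\<Sum>i\<in>index_cube n. \<Sum>g\<in>G. c g * ((scale n * weight n (u g) i) * v (shift i x)))"
      by (rule sum.swap)
    finally show ?thesis by (simp add: a_def w_def sum_distrib_left sum_distrib_right mult_ac)
  qed
  \<comment> \<open>Divergent sums have value 0, so positivity of the asymptotic variance forces
    summability.\<close>
  have sumd: "cov summable_on UNIV"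
  proof (rule ccontr)
    assume "\<not> cov summable_on UNIV"
    then have "infsum cov UNIV = 0" by (rule infsum_not_exists)
    then show False using pos by (simp add: asymp_var_def cov_def[abs_def])
  qed
  have avar: "infsum cov UNIV = asymp_var \<mu> v" by (simp add: asymp_var_def cov_def[abs_def])
  define S where "S n = (\<lambda>(i, j). j - i) ` (index_cube n \<times> (index_cube n :: (int^'d) set))" for n
  define g where "g n k = (\<Sum>i\<in>{i\<in>index_cube n. i + k \<in> index_cube n}. a n i * a n (i + k))" for n k
  define vr where "vr n = (\<integral>x. (\<Sum>i\<in>index_cube n. a n i * v (shift i x))\<^sup>2 \<partial>\<mu>)" for n
  have vr_eq: "vr n = (\<Sum>k\<in>S n. cov k * g n k)" for n
    unfolding vr_def S_def g_def by (rule variance_sum) simp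
  have a_sq: "\<bar>a n i * a n j\<bar> \<le> C0\<^sup>2 / real n ^ CARD('d)" if "0 < n" for n i j
  proof -
    have "\<bar>a n i * a n j\<bar> = (scale n)\<^sup>2 * (\<bar>w n i\<bar> * \<bar>w n j\<bar>)"
      by (simp add: a_def abs_mult power2_eq_square mult_ac)
    also have "\<dots> \<le> (scale n)\<^sup>2 * (C0 * C0)"
      using wC C0 by (intro mult_left_mono mult_mono) auto
    also have "\<dots> = C0\<^sup>2 / real n ^ CARD('d)"
      unfolding scale_sq[OF that] by (simp add: power2_eq_square)
    finally show ?thesis .
  qed
  have gB: "\<bar>g n k\<bar> \<le> C0\<^sup>2" for n k
  proof (cases "n = 0")
    case True
    then show ?thesis by (simp add: g_def a_def)
  next
    case False
    have "\<bar>g n k\<bar> \<le> (\<Sum>i\<in>{i\<in>index_cube n. i + k \<in> index_cube n}. \<bar>a n i * a n (i + k)\<bar>)"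
      unfolding g_def by (rule sum_abs)
    also have "\<dots> \<le> (\<Sum>i\<in>{i\<in>index_cube n. i + k \<in> index_cube n}. C0\<^sup>2 / real n ^ CARD('d))"
      using False by (intro sum_mono a_sq) auto
    also have "\<dots> \<le> (\<Sum>i\<in>(index_cube n :: (int^'d) set). C0\<^sup>2 / real n ^ CARD('d))"
      by (intro sum_mono2) auto
    also have "\<dots> = C0\<^sup>2" using False by (simp add: card_index_cube)
    finally show ?thesis .
  qed
  have glim: "(\<lambda>n. g n k) \<longlonglongrightarrow> V" for k
  proof -
    have "(\<lambda>n. \<Sum>h\<in>G. \<Sum>h'\<in>G. c h * c h' * ((\<Sum>i\<in>{i\<in>index_cube n. i + k \<in> index_cube n}. weight n (u h) i * weight n (u h') (i + k)) / real n ^ CARD('d)))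
       \<longlonglongrightarrow> V"
      unfolding V_def by (intro tendsto_sum tendsto_mult tendsto_const weight_correlation_limit u)
    moreover have "\<forall>\<^sub>F n in sequentially. (\<Sum>h\<in>G. \<Sum>h'\<in>G. c h * c h' * ((\<Sum>i\<in>{i\<in>index_cube n. i + k \<in> index_cube n}. weight n (u h) i * weight n (u h') (i + k)) / real n ^ CARD('d)))
        = g n k"
    proof (rule eventually_sequentiallyI[of 1])
      fix n :: nat assume n: "1 \<le> n"
      define J where "J = {i\<in>index_cube n. i + k \<in> (index_cube n :: (int^'d) set)}"
      have "g n k = (\<Sum>i\<in>J. (w n i * w n (i + k)) * (scale n)\<^sup>2)"
        unfolding g_def J_def by (simp add: a_def power2_eq_square mult_ac)
      also have "\<dots> = (\<Sum>i\<in>J. w n i * w n (i + k)) / real n ^ CARD('d)"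
        using n by (simp add: scale_sq sum_divide_distrib)
      also have "(\<Sum>i\<in>J. w n i * w n (i + k)) = (\<Sum>i\<in>J. \<Sum>h\<in>G. \<Sum>h'\<in>G. c h * c h' * (weight n (u h) i * weight n (u h') (i + k)))"
        by (simp add: w_def sum_product mult_ac)
      also have "\<dots> = (\<Sum>h\<in>G. \<Sum>i\<in>J. \<Sum>h'\<in>G. c h * c h' * (weight n (u h) i * weight n (u h') (i + k)))"
        by (rule sum.swap)
      also have "\<dots> = (\<Sum>h\<in>G. \<Sum>h'\<in>G. \<Sum>i\<in>J. c h * c h' * (weight n (u h) i * weight n (u h') (i + k)))"
        by (intro sum.cong refl) (rule sum.swap)
      also have "\<dots> = (\<Sum>h\<in>G. \<Sum>h'\<in>G. c h * c h' * (\<Sum>i\<in>J. weight n (u h) i * weight n (u h') (i + k)))"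
        by (simp add: sum_distrib_left)
      finally show "(\<Sum>h\<in>G. \<Sum>h'\<in>G. c h * c h' * ((\<Sum>i\<in>{i\<in>index_cube n. i + k \<in> index_cube n}. weight n (u h) i * weight n (u h') (i + k)) / real n ^ CARD('d)))
        = g n k"
        unfolding J_def[symmetric] by (simp only: times_divide_eq_right sum_divide_distrib[symmetric])
    qed
    ultimately show ?thesis by (rule Lim_transform_eventually)
  qed
  have vlim: "vr \<longlonglongrightarrow> asymp_var \<mu> v * V"
    unfolding vr_eq[abs_def] avar[symmetric]
  proof (rule tendsto_weighted_infsum[OF sumd gB glim])
    show "finite (S n)" for n by (simp add: S_def)
    show "g n k = 0" if "k \<notin> S n" for n k
    proof -
      have "{i\<in>index_cube n. i + k \<in> index_cube n} = {}"
      proof (rule ccontr)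
        assume "{i\<in>index_cube n. i + k \<in> index_cube n} \<noteq> {}"
        then obtain i where i: "i \<in> index_cube n" "i + k \<in> index_cube n" by auto
        then have "k \<in> S n" unfolding S_def by (intro image_eqI[of _ _ "(i, i + k)"]) auto
        with that show False by simp
      qed
      then show ?thesis by (simp only: g_def sum.empty)
    qed
  qed
  obtain C \<rho> m where "approx_field L P Z C \<rho> m" using approx_field_Z by blast
  then interpret A: approx_field L P Z C \<rho> m .
  obtain K \<eta> cc where K: "0 \<le> K" "0 < \<eta>" "\<eta> < 1" "\<And>l. 0 \<le> cc l"
    and bound: "\<And>l I a \<alpha> b. finite I \<Longrightarrow> 0 \<le> \<alpha> \<Longrightarrow> (\<And>i. i \<in> I \<Longrightarrow> \<bar>a i\<bar> \<le> \<alpha>) \<Longrightarrow>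
      \<bar>(\<integral>y. cos (A.wsum Z I a y + b) \<partial>P) - exp (- (\<integral>y. (A.wsum Z I a y)\<^sup>2 \<partial>P) / 2) * cos b\<bar>
        \<le> K * \<eta> ^ l * (1 + (\<Sum>i\<in>I. (a i)\<^sup>2)) + cc l * real (card I) * \<alpha> ^ 3"
    using A.char_bound by blast
  define X where "X n = (\<integral>x. cos ((\<Sum>g\<in>G. c g * F n (u g) x) + b) \<partial>\<mu>)" for n
  have step: "\<bar>X n - exp (- vr n / 2) * cos b\<bar> \<le> K * \<eta> ^ l * (1 + C0\<^sup>2) + cc l * C0 ^ 3 * scale n"
    if n: "0 < n" for n l
  proof -
    define \<alpha> where "\<alpha> = scale n * C0"
    have al: "0 \<le> \<alpha>" "\<bar>a n i\<bar> \<le> \<alpha>" for i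
    proof -
      have s0: "0 \<le> scale n" by (simp add: scale_def)
      show "0 \<le> \<alpha>" using s0 C0 by (simp add: \<alpha>_def)
      show "\<bar>a n i\<bar> \<le> \<alpha>" unfolding \<alpha>_def a_def abs_mult abs_of_nonneg[OF s0]
        by (intro mult_left_mono wC s0)
    qed
    have e1: "X n = (\<integral>y. cos (A.wsum Z (index_cube n) (a n) y + b) \<partial>P)"
      unfolding X_def eq A.wsum_def by (rule transfer_sum[of "\<lambda>r. cos (r + b)"]) measurable
    have e2: "vr n = (\<integral>y. (A.wsum Z (index_cube n) (a n) y)\<^sup>2 \<partial>P)"
      unfolding vr_def A.wsum_def by (rule transfer_sum[of "\<lambda>r. r\<^sup>2"]) measurable
    have "\<bar>X n - exp (- vr n / 2) * cos b\<bar> \<le> K * \<eta> ^ l * (1 + (\<Sum>i\<in>index_cube n. (a n i)\<^sup>2)) + cc l * real (card (index_cube n :: (int^'d) set)) * \<alpha> ^ 3"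
      unfolding e1 e2 by (rule bound) (use al in auto)
    also have "(\<Sum>i\<in>index_cube n. (a n i)\<^sup>2) \<le> C0\<^sup>2"
      using gB[of n 0] by (simp add: g_def power2_eq_square)
    then have "K * \<eta> ^ l * (1 + (\<Sum>i\<in>index_cube n. (a n i)\<^sup>2)) + cc l * real (card (index_cube n :: (int^'d) set)) * \<alpha> ^ 3
       \<le> K * \<eta> ^ l * (1 + C0\<^sup>2) + cc l * real (card (index_cube n :: (int^'d) set)) * \<alpha> ^ 3"
      using K by (intro add_right_mono mult_left_mono add_left_mono) auto
    \<comment> \<open>n^d sites with weights of order n^(-d/2): the third-order error is of order
      n^d n^(-3d/2) = n^(-d/2).\<close>
    also have "cc l * real (card (index_cube n :: (int^'d) set)) * \<alpha> ^ 3 = cc l * C0 ^ 3 * scale n"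
    proof -
      have "real (card (index_cube n :: (int^'d) set)) * (scale n) ^ 3
          = (real n ^ CARD('d) * (scale n)\<^sup>2) * scale n"
        by (simp add: card_index_cube power3_eq_cube power2_eq_square)
      also have "\<dots> = scale n" using n by (simp add: scale_sq)
      finally show ?thesis by (simp add: \<alpha>_def power_mult_distrib mult_ac)
    qed
    finally show ?thesis .
  qed
  \<comment> \<open>The level l is fixed first, to make the truncation error small uniformly in n;
    only then does n grow, since the Stein constant \<open>cc l\<close> depends on l.\<close>
  have "(\<lambda>n. X n - exp (- vr n / 2) * cos b) \<longlonglongrightarrow> 0"
  proof (rule LIMSEQ_I)
    fix r :: real assume r: "0 < r"
    have "(\<lambda>l. K * \<eta> ^ l * (1 + C0\<^sup>2)) \<longlonglongrightarrow> K * 0 * (1 + C0\<^sup>2)"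
      using K by (intro tendsto_mult tendsto_const LIMSEQ_realpow_zero) auto
    then have "\<forall>\<^sub>F l in sequentially. K * \<eta> ^ l * (1 + C0\<^sup>2) < r / 2"
      using r by (intro order_tendstoD(2)[where y = 0 and a = "r/2"]) auto
    then obtain l where l: "K * \<eta> ^ l * (1 + C0\<^sup>2) < r / 2" by (auto simp: eventually_sequentially)
    have "(\<lambda>n. scale n) \<longlonglongrightarrow> 0"
      unfolding scale_def by (intro tendsto_neg_powr filterlim_real_sequentially) auto
    then have "(\<lambda>n. cc l * C0 ^ 3 * scale n) \<longlonglongrightarrow> cc l * C0 ^ 3 * 0"
      by (intro tendsto_mult tendsto_const)
    then have "\<forall>\<^sub>F n in sequentially. cc l * C0 ^ 3 * scale n < r / 2"
      using r by (intro order_tendstoD(2)[where y = 0 and a = "r/2"]) auto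
    then obtain n0 where n0: "\<And>n. n \<ge> n0 \<Longrightarrow> cc l * C0 ^ 3 * scale n < r / 2"
      by (auto simp: eventually_sequentially)
    show "\<exists>no. \<forall>n\<ge>no. norm (X n - exp (- vr n / 2) * cos b - 0) < r"
    proof (intro exI allI impI)
      fix n assume n: "max 1 n0 \<le> n"
      then show "norm (X n - exp (- vr n / 2) * cos b - 0) < r"
        using step[of n l] n0[of n] l by simp
    qed
  qed
  moreover have "(\<lambda>n. exp (- vr n / 2) * cos b) \<longlonglongrightarrow> exp (- (asymp_var \<mu> v * V) / 2) * cos b"
    by (intro tendsto_intros vlim) auto
  ultimately have "(\<lambda>n. (X n - exp (- vr n / 2) * cos b) + exp (- vr n / 2) * cos b) \<longlonglongrightarrow> 0 + exp (- (asymp_var \<mu> v * V) / 2) * cos b"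
    by (rule tendsto_add)
  then show ?thesis by (simp add: X_def V_def)
qed

end

subsection \<open>Weak convergence in metric spaces via Lipschitz functions\<close>

lemma space_borel_of: "space (borel_of T) = topspace T"
  by (simp add: borel_of_def space_measure_of_conv)

lemma measurable_borel_of:
  assumes "\<And>x. x \<in> space M \<Longrightarrow> f x \<in> topspace T" "\<And>U. openin T U \<Longrightarrow> f -` U \<inter> space M \<in> sets M"
  shows "f \<in> measurable M (borel_of T)"
  unfolding borel_of_def using assms by (intro measurable_measure_of) (auto dest: openin_subset)

lemma sets_borel_of_open: "openin T U \<Longrightarrow> U \<in> sets (borel_of T)"
  unfolding borel_of_def by (subst sets_measure_of) (auto dest: openin_subset)

lemma borel_of_continuous_measurable:
  assumes "continuous_map T euclideanreal f" shows "f \<in> borel_measurable (borel_of T)"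
proof (rule borel_measurableI)
  fix S :: "real set" assume "open S"
  then have "openin T {x \<in> topspace T. f x \<in> S}"
    using assms by (intro openin_continuous_map_preimage[OF assms]) auto
  then have "{x \<in> topspace T. f x \<in> S} \<in> sets (borel_of T)" by (rule sets_borel_of_open)
  also have "{x \<in> topspace T. f x \<in> S} = f -` S \<inter> space (borel_of T)" by (auto simp: space_borel_of)
  finally show "f -` S \<inter> space (borel_of T) \<in> sets (borel_of T)" .
qed

context Metric_space
begin

text \<open>The infimal convolution of f with k times the distance. For f bounded below and k \<ge>
  0 it is the largest k-Lipschitz function below f.\<close>

definition inf_conv :: "('a \<Rightarrow> real) \<Rightarrow> real \<Rightarrow> 'a \<Rightarrow> real" where
  "inf_conv f k x = (INF y\<in>M. f y + k * d x y)"

lemma inf_conv_bdd: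
  assumes "\<And>y. y \<in> M \<Longrightarrow> - B \<le> f y" "0 \<le> k"
  shows "bdd_below ((\<lambda>y. f y + k * d x y) ` M)"
proof (rule bdd_belowI2[of _ "- B"])
  fix y assume "y \<in> M"
  then show "- B \<le> f y + k * d x y" using assms(1)[of y] assms(2) nonneg[of x y]
    by (meson add_increasing2 mult_nonneg_nonneg)
qed

lemma inf_conv_le:
  assumes "\<And>y. y \<in> M \<Longrightarrow> - B \<le> f y" "0 \<le> k" "x \<in> M" "y \<in> M"
  shows "inf_conv f k x \<le> f y + k * d x y"
  unfolding inf_conv_def by (rule cINF_lower[OF inf_conv_bdd[OF assms(1,2)] assms(4)])

lemma inf_conv_le_self:
  assumes "\<And>y. y \<in> M \<Longrightarrow> - B \<le> f y" "0 \<le> k" "x \<in> M"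
  shows "inf_conv f k x \<le> f x"
  using inf_conv_le[OF assms assms(3)] assms(3) by simp

lemma inf_conv_ge:
  assumes "x \<in> M" "\<And>y. y \<in> M \<Longrightarrow> c \<le> f y + k * d x y"
  shows "c \<le> inf_conv f k x"
  unfolding inf_conv_def using assms by (intro cINF_greatest) auto

lemma inf_conv_lipschitz:
  assumes f: "\<And>y. y \<in> M \<Longrightarrow> - B \<le> f y" and k: "0 \<le> k" and x: "x \<in> M" "x' \<in> M"
  shows "\<bar>inf_conv f k x - inf_conv f k x'\<bar> \<le> k * d x x'"
proof -
  have *: "inf_conv f k x - k * d x x' \<le> inf_conv f k x'" if "x \<in> M" "x' \<in> M" for x x'
  proof (rule inf_conv_ge[OF that(2)])
    fix y assume y: "y \<in> M"
    have "inf_conv f k x \<le> f y + k * d x y" by (rule inf_conv_le[OF f k that(1) y])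
    also have "\<dots> \<le> f y + k * (d x x' + d x' y)"
      using triangle[OF that y] k by (intro add_left_mono mult_left_mono)
    finally show "inf_conv f k x - k * d x x' \<le> f y + k * d x' y" by (simp add: distrib_left)
  qed
  show ?thesis using *[OF x] *[OF x(2,1)] by (simp add: commute abs_le_iff)
qed

lemma lipschitz_imp_continuous_map:
  assumes "\<And>x y. x \<in> M \<Longrightarrow> y \<in> M \<Longrightarrow> \<bar>f x - f y\<bar> \<le> k * d x y"
  shows "continuous_map mtopology euclideanreal f"
proof -
  have "continuous_map mtopology Met_TC.mtopology f"
  proof (subst Met_TC.continuous_map_to_metric, intro ballI allI impI)
    fix a and e :: real assume a: "a \<in> topspace mtopology" and e: "0 < e"
    \<comment> \<open>The 1 added to |k| keeps the radius finite and positive when the Lipschitz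
      constant is 0.\<close>
    have "f x \<in> Met_TC.mball (f a) e" if "x \<in> mball a (e / (\<bar>k\<bar> + 1))" for x
    proof -
      have x: "x \<in> M" "d a x < e / (\<bar>k\<bar> + 1)" using that by auto
      have "dist (f a) (f x) \<le> k * d a x" using assms[of a x] a x by (simp add: dist_real_def)
      also have "\<dots> \<le> (\<bar>k\<bar> + 1) * d a x" by (intro mult_right_mono) auto
      also have "\<dots> < e" using x e by (simp add: pos_less_divide_eq mult.commute)
      finally show ?thesis by simp
    qed
    moreover have "a \<in> mball a (e / (\<bar>k\<bar> + 1))" using a e by (simp add: add_nonneg_pos)
    ultimately show "\<exists>U. openin mtopology U \<and> a \<in> U \<and> (\<forall>y\<in>U. f y \<in> Met_TC.mball (f a) e)"
      by (intro exI[of _ "mball a (e / (\<bar>k\<bar> + 1))"]) auto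
  qed
  then show ?thesis by (simp add: mtopology_is_euclidean)
qed

text \<open>Points at distance at least \<delta> cannot lower the infimum below f x once k \<delta>
  \<ge> 2B, and within \<delta> continuity keeps f above f x - r/2.\<close>

lemma inf_conv_tendsto:
  assumes f: "continuous_map mtopology euclideanreal f" and B: "\<And>y. y \<in> M \<Longrightarrow> \<bar>f y\<bar> \<le> B" and x: "x \<in> M"
  shows "(\<lambda>k. inf_conv f (real k) x) \<longlonglongrightarrow> f x"
proof (rule LIMSEQ_I)
  fix r :: real assume r: "0 < r"
  have B': "- B \<le> f y" if "y \<in> M" for y using B[OF that] by linarith
  have "openin mtopology {y \<in> topspace mtopology. f y \<in> {f x - r / 2<..}}"
    by (rule openin_continuous_map_preimage[OF f]) simp
  then obtain \<delta> where \<delta>: "0 < \<delta>" "mball x \<delta> \<subseteq> {y \<in> M. f x - r / 2 < f y}"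
    using x r by (auto simp: openin_mtopology)
  obtain k0 :: nat where k0: "2 * B / \<delta> < real k0" using reals_Archimedean2 by blast
  show "\<exists>no. \<forall>k\<ge>no. norm (inf_conv f (real k) x - f x) < r"
  proof (intro exI allI impI)
    fix k assume k: "k0 \<le> k"
    have "f x - r / 2 \<le> inf_conv f (real k) x"
    proof (rule inf_conv_ge[OF x])
      fix y assume y: "y \<in> M"
      show "f x - r / 2 \<le> f y + real k * d x y"
      proof (cases "d x y < \<delta>")
        case True
        then have "f x - r / 2 < f y" using \<delta> x y by (auto simp: subset_iff)
        moreover have "0 \<le> real k * d x y" by simp
        ultimately show ?thesis by linarith
      next
        case False
        have "2 * B \<le> real k0 * \<delta>" using k0 \<delta> by (simp add: divide_less_eq less_imp_le)
        also have "\<dots> \<le> real k * d x y" using k False \<delta> by (intro mult_mono) auto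
        finally show ?thesis using B[OF x] B[OF y] r by linarith
      qed
    qed
    moreover have "inf_conv f (real k) x \<le> f x" by (rule inf_conv_le_self[OF B' _ x]) auto
    ultimately show "norm (inf_conv f (real k) x - f x) < r" using r by simp
  qed
qed

text \<open>An open set U is the positivity set of a 1-Lipschitz function, the infimal convolution
  of its indicator. Preimages of open sets under the limit are thus described by real-valued
  pointwise limits.\<close>

lemma measurable_limit:
  assumes Z: "\<And>j. Z j \<in> measurable N (borel_of mtopology)" and Z': "\<And>w. w \<in> space N \<Longrightarrow> Z' w \<in> M"
    and lim: "\<And>w. w \<in> space N \<Longrightarrow> (\<lambda>j. d (Z j w) (Z' w)) \<longlonglongrightarrow> 0"
  shows "Z' \<in> measurable N (borel_of mtopology)"
proof (rule measurable_borel_of)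
  show "w \<in> space N \<Longrightarrow> Z' w \<in> topspace mtopology" for w using Z' by simp
  fix U assume U: "openin mtopology U"
  define g where "g = inf_conv (indicator U) 1"
  have i0: "- 0 \<le> (indicator U y :: real)" for y by simp
  have lip: "\<bar>g x - g y\<bar> \<le> 1 * d x y" if "x \<in> M" "y \<in> M" for x y
    unfolding g_def by (rule inf_conv_lipschitz[OF i0 _ that]) simp
  have gm: "g \<in> borel_measurable (borel_of mtopology)"
    by (rule borel_of_continuous_measurable[OF lipschitz_imp_continuous_map[OF lip]])
  have ZM: "Z j w \<in> M" if "w \<in> space N" for j w
    using measurable_space[OF Z that] by (simp add: space_borel_of)
  have "(\<lambda>w. g (Z' w)) \<in> borel_measurable N"
  proof (rule borel_measurable_LIMSEQ_metric)
    show "(\<lambda>w. g (Z j w)) \<in> borel_measurable N" for j by (rule measurable_compose[OF Z gm])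
    fix w assume w: "w \<in> space N"
    show "(\<lambda>j. g (Z j w)) \<longlonglongrightarrow> g (Z' w)"
    proof (rule LIM_zero_cancel, rule Lim_null_comparison[OF _ lim[OF w]])
      show "\<forall>\<^sub>F j in sequentially. norm (g (Z j w) - g (Z' w)) \<le> d (Z j w) (Z' w)"
        using lip[OF ZM[OF w] Z'[OF w]] by simp
    qed
  qed
  then have "{w \<in> space N. 0 < g (Z' w)} \<in> sets N" by measurable
  also have "{w \<in> space N. 0 < g (Z' w)} = Z' -` U \<inter> space N"
  proof -
    have "0 < g x \<longleftrightarrow> x \<in> U" if x: "x \<in> M" for x
    proof
      assume "x \<in> U"
      then obtain r where r: "0 < r" "mball x r \<subseteq> U" using U by (auto simp: openin_mtopology)
      have "min 1 r \<le> g x" unfolding g_def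
      proof (rule inf_conv_ge[OF x])
        fix y assume y: "y \<in> M"
        show "min 1 r \<le> indicator U y + 1 * d x y"
        proof (cases "d x y < r")
          case True
          then have "y \<in> U" using r x y by (auto simp: subset_iff)
          then show ?thesis by (simp add: min_le_iff_disj)
        next
          case False
          then show ?thesis using nonneg[of x y] by (cases "y \<in> U") (simp_all add: min_def)
        qed
      qed
      then show "0 < g x" using r by linarith
    next
      assume g: "0 < g x"
      show "x \<in> U"
      proof (rule ccontr)
        assume "x \<notin> U"
        moreover have "g x \<le> indicator U x" unfolding g_def by (rule inf_conv_le_self[OF i0 _ x]) simp
        ultimately show False using g by simp
      qed
    qed
    then show ?thesis using Z' by auto
  qed
  finally show "Z' -` U \<inter> space N \<in> sets N" .
qed

text \<open>The infimal convolutions of f increase to f, so Lipschitz test functions give the lower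
  bound for the limit inferior of the integrals. The same bound for -f gives the limit
  superior.\<close>

lemma weak_convergence_lipschitz:
  assumes M1: "prob_space M1" and N: "prob_space N"
    and Z: "\<And>n. Z n \<in> measurable M1 (borel_of mtopology)" and Z': "Z' \<in> measurable N (borel_of mtopology)"
    and lip: "\<And>f k B. 0 \<le> k \<Longrightarrow> (\<And>x. x \<in> M \<Longrightarrow> \<bar>f x\<bar> \<le> B) \<Longrightarrow> (\<And>x y. x \<in> M \<Longrightarrow> y \<in> M \<Longrightarrow> \<bar>f x - f y\<bar> \<le> k * d x y)
       \<Longrightarrow> (\<lambda>n. \<integral>x. f (Z n x) \<partial>M1) \<longlonglongrightarrow> (\<integral>w. f (Z' w) \<partial>N)"
    and f: "continuous_map mtopology euclideanreal f" and B: "\<And>x. x \<in> M \<Longrightarrow> \<bar>f x\<bar> \<le> B"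
  shows "(\<lambda>n. \<integral>x. f (Z n x) \<partial>M1) \<longlonglongrightarrow> (\<integral>w. f (Z' w) \<partial>N)"
proof -
  interpret M1: prob_space M1 by fact
  interpret N: prob_space N by fact
  have ZM: "Z n x \<in> M" if "x \<in> space M1" for n x using measurable_space[OF Z that] by (simp add: space_borel_of)
  have ZM': "Z' w \<in> M" if "w \<in> space N" for w using measurable_space[OF Z' that] by (simp add: space_borel_of)
  have lower: "\<forall>\<^sub>F n in sequentially. (\<integral>w. f (Z' w) \<partial>N) - r < (\<integral>x. f (Z n x) \<partial>M1)"
    if f: "continuous_map mtopology euclideanreal f" and B: "\<And>x. x \<in> M \<Longrightarrow> \<bar>f x\<bar> \<le> B" and r: "0 < r" for f r
  proof -
    have Bl: "- B \<le> f y" if "y \<in> M" for y using B[OF that] by linarith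
    define h where "h k = inf_conv f (real k)" for k :: nat
    have hl: "\<bar>h k x - h k y\<bar> \<le> real k * d x y" if "x \<in> M" "y \<in> M" for k x y
      unfolding h_def by (rule inf_conv_lipschitz[OF Bl _ that]) auto
    have hle: "h k x \<le> f x" if "x \<in> M" for k x unfolding h_def by (rule inf_conv_le_self[OF Bl _ that]) auto
    have hB: "\<bar>h k x\<bar> \<le> B" if x: "x \<in> M" for k x
    proof -
      have "- B \<le> h k x" unfolding h_def
      proof (rule inf_conv_ge[OF x])
        fix y assume "y \<in> M"
        then show "- B \<le> f y + real k * d x y" using Bl[of y] by (simp add: add_increasing2)
      qed
      then show ?thesis using hle[OF x, of k] B[OF x] by linarith
    qed
    have hm: "h k \<in> borel_measurable (borel_of mtopology)" for k
      by (rule borel_of_continuous_measurable[OF lipschitz_imp_continuous_map[OF hl]])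
    have fm: "f \<in> borel_measurable (borel_of mtopology)" by (rule borel_of_continuous_measurable[OF f])
    have "(\<lambda>k. \<integral>w. h k (Z' w) \<partial>N) \<longlonglongrightarrow> (\<integral>w. f (Z' w) \<partial>N)"
    proof (rule integral_dominated_convergence[where w = "\<lambda>_. B"])
      show "(\<lambda>w. f (Z' w)) \<in> borel_measurable N" by (rule measurable_compose[OF Z' fm])
      show "(\<lambda>w. h k (Z' w)) \<in> borel_measurable N" for k by (rule measurable_compose[OF Z' hm])
      show "AE w in N. (\<lambda>k. h k (Z' w)) \<longlonglongrightarrow> f (Z' w)"
        unfolding h_def by (intro AE_I2 inf_conv_tendsto[OF f B] ZM')
      show "AE w in N. norm (h k (Z' w)) \<le> B" for k
        by (intro AE_I2) (simp add: hB ZM')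
    qed simp
    then have "\<forall>\<^sub>F k in sequentially. (\<integral>w. f (Z' w) \<partial>N) - r < (\<integral>w. h k (Z' w) \<partial>N)"
      using r by (intro order_tendstoD(1)) auto
    then obtain k where k: "(\<integral>w. f (Z' w) \<partial>N) - r < (\<integral>w. h k (Z' w) \<partial>N)" by (auto simp: eventually_sequentially)
    have "(\<lambda>n. \<integral>x. h k (Z n x) \<partial>M1) \<longlonglongrightarrow> (\<integral>w. h k (Z' w) \<partial>N)"
      by (rule lip[of "real k" "h k" B]) (use hB hl in auto)
    then have "\<forall>\<^sub>F n in sequentially. (\<integral>w. f (Z' w) \<partial>N) - r < (\<integral>x. h k (Z n x) \<partial>M1)"
      using k by (rule order_tendstoD(1))
    then show ?thesis
    proof eventually_elim
      case (elim n)
      have "(\<integral>x. h k (Z n x) \<partial>M1) \<le> (\<integral>x. f (Z n x) \<partial>M1)"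
      proof (rule integral_mono)
        show "integrable M1 (\<lambda>x. h k (Z n x))"
          by (intro M1.brv_integrable brvI[where D = B] measurable_compose[OF Z hm]) (simp add: hB ZM)
        show "integrable M1 (\<lambda>x. f (Z n x))"
          by (intro M1.brv_integrable brvI[where D = B] measurable_compose[OF Z fm]) (simp add: B ZM)
      qed (simp add: hle ZM)
      with elim show ?case by linarith
    qed
  qed
  show ?thesis
  proof (rule order_tendstoI)
    fix a assume a: "a < (\<integral>w. f (Z' w) \<partial>N)"
    then show "\<forall>\<^sub>F n in sequentially. a < (\<integral>x. f (Z n x) \<partial>M1)"
      using lower[OF f B, of "(\<integral>w. f (Z' w) \<partial>N) - a"] by simp
  next
    fix a assume a: "(\<integral>w. f (Z' w) \<partial>N) < a"
    have "\<forall>\<^sub>F n in sequentially. (\<integral>w. - f (Z' w) \<partial>N) - (a - (\<integral>w. f (Z' w) \<partial>N)) < (\<integral>x. - f (Z n x) \<partial>M1)"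
      using a B by (intro lower[of "\<lambda>x. - f x"] continuous_map_minus[OF f]) auto
    then show "\<forall>\<^sub>F n in sequentially. (\<integral>x. f (Z n x) \<partial>M1) < a"
      by eventually_elim simp
  qed
qed

end

subsection \<open>The space of continuous functions on the cube\<close>

abbreviation C_metric :: "(real^'d::finite \<Rightarrow> real) metric" where
  "C_metric \<equiv> cfunspace (top_of_set unit_cube) euclidean_metric"

lemma unit_cube_nonempty: "(unit_cube :: (real^'d::finite) set) \<noteq> {}"
  by (simp add: interval_ne_empty_cart)

text \<open>On the compact cube the boundedness built into \<open>cfunspace\<close> is
  automatic.\<close>

lemma mspace_C_metric:
  "mspace (C_metric :: (real^'d::finite \<Rightarrow> real) metric) = {f. f \<in> extensional unit_cube \<and> continuous_on unit_cube f}"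
proof -
  have "compactin (top_of_set unit_cube) (topspace (top_of_set (unit_cube :: (real^'d) set)))"
    by (simp add: compactin_subtopology)
  from compactin_mspace_cfunspace[OF this, of "euclidean_metric :: real metric"] show ?thesis
    by simp
qed

lemma path_in_C_metric:
  fixes Z :: "real^'d::finite \<Rightarrow> 'w \<Rightarrow> real"
  assumes "continuous_on unit_cube (\<lambda>t. Z t w)" shows "path_of Z w \<in> mspace C_metric"
  unfolding mspace_C_metric path_of_def using assms by (auto cong: continuous_on_cong)

lemma mdist_C_metric_le:
  fixes f g :: "real^'d::finite \<Rightarrow> real"
  assumes "0 \<le> B" "\<And>t. t \<in> unit_cube \<Longrightarrow> \<bar>f t - g t\<bar> \<le> B"
  shows "mdist C_metric f g \<le> B"
  using assms by (intro mdist_cfunspace_le) (auto simp: dist_real_def)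

text \<open>The sup distance of two such paths is at most a constant times the l^1 distance of the
  coefficients. This makes interpolated paths measurable and turns a continuous functional of them
  into a continuous function of finitely many values.\<close>

lemma continuous_map_path:
  fixes \<phi> :: "'i::countable \<Rightarrow> real^'d::finite \<Rightarrow> real"
  assumes I: "finite I" and \<phi>: "\<And>i. i \<in> I \<Longrightarrow> continuous_on unit_cube (\<phi> i)"
  shows "continuous_map euclidean C_cube (\<lambda>x. restrict (\<lambda>t. \<Sum>i\<in>I. \<phi> i t * x i) unit_cube)"
proof -
  interpret C: Metric_space "mspace C_metric" "mdist (C_metric :: (real^'d \<Rightarrow> real) metric)"
    by (rule Metric_space_mspace_mdist)
  define \<Phi> where "\<Phi> x = restrict (\<lambda>t. \<Sum>i\<in>I. \<phi> i t * x i) unit_cube" for x :: "'i \<Rightarrow> real"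
  have \<Phi>C: "\<Phi> x \<in> mspace C_metric" for x
    unfolding mspace_C_metric \<Phi>_def using \<phi> by (auto intro!: continuous_intros cong: continuous_on_cong)
  have "\<exists>B. \<forall>i\<in>I. \<forall>t\<in>unit_cube. \<bar>\<phi> i t\<bar> \<le> B"
  proof -
    have "\<exists>b. \<forall>t\<in>unit_cube. \<bar>\<phi> i t\<bar> \<le> b" if "i \<in> I" for i
    proof -
      have "bounded (\<phi> i ` unit_cube)" by (intro compact_imp_bounded compact_continuous_image \<phi> that) simp
      then show ?thesis by (auto simp: bounded_iff)
    qed
    then obtain b where b: "\<And>i t. i \<in> I \<Longrightarrow> t \<in> unit_cube \<Longrightarrow> \<bar>\<phi> i t\<bar> \<le> b i" by metis
    have "\<bar>\<phi> i t\<bar> \<le> (\<Sum>j\<in>I. \<bar>b j\<bar>)" if "i \<in> I" "t \<in> unit_cube" for i t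
    proof -
      have "\<bar>\<phi> i t\<bar> \<le> \<bar>b i\<bar>" using b[OF that] by linarith
      also have "\<dots> \<le> (\<Sum>j\<in>I. \<bar>b j\<bar>)" using member_le_sum[OF that(1), of "\<lambda>j. \<bar>b j\<bar>"] I by simp
      finally show ?thesis .
    qed
    then show ?thesis by blast
  qed
  then obtain B where B: "\<And>i t. i \<in> I \<Longrightarrow> t \<in> unit_cube \<Longrightarrow> \<bar>\<phi> i t\<bar> \<le> B" by blast
  have dist: "mdist C_metric (\<Phi> x) (\<Phi> y) \<le> (\<Sum>i\<in>I. \<bar>B\<bar> * \<bar>y i - x i\<bar>)" for x y
  proof (rule mdist_C_metric_le)
    show "0 \<le> (\<Sum>i\<in>I. \<bar>B\<bar> * \<bar>y i - x i\<bar>)" by (intro sum_nonneg) simp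
    fix t :: "real^'d" assume t: "t \<in> unit_cube"
    have "\<bar>\<Phi> x t - \<Phi> y t\<bar> = \<bar>\<Sum>i\<in>I. \<phi> i t * (x i - y i)\<bar>"
      using t by (simp add: \<Phi>_def sum_subtractf right_diff_distrib)
    also have "\<dots> \<le> (\<Sum>i\<in>I. \<bar>\<phi> i t * (x i - y i)\<bar>)" by (rule sum_abs)
    also have "\<dots> \<le> (\<Sum>i\<in>I. \<bar>B\<bar> * \<bar>y i - x i\<bar>)"
    proof (rule sum_mono)
      fix i assume "i \<in> I"
      then have "\<bar>\<phi> i t\<bar> \<le> \<bar>B\<bar>" using B[of i t] t by linarith
      then show "\<bar>\<phi> i t * (x i - y i)\<bar> \<le> \<bar>B\<bar> * \<bar>y i - x i\<bar>"
        unfolding abs_mult abs_minus_commute[of "x i"] by (rule mult_right_mono) simp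
    qed
    finally show "\<bar>\<Phi> x t - \<Phi> y t\<bar> \<le> (\<Sum>i\<in>I. \<bar>B\<bar> * \<bar>y i - x i\<bar>)" .
  qed
  have "continuous_map euclidean C.mtopology \<Phi>"
  proof (subst C.continuous_map_to_metric, intro ballI allI impI)
    fix x :: "'i \<Rightarrow> real" and e :: real assume e: "0 < e"
    define U where "U = {y. (\<Sum>i\<in>I. \<bar>B\<bar> * \<bar>y i - x i\<bar>) < e}"
    have "open U" unfolding U_def
      by (intro open_Collect_less continuous_intros continuous_on_product_coordinates)
    moreover have "x \<in> U" using e by (simp add: U_def)
    moreover have "\<forall>y\<in>U. \<Phi> y \<in> C.mball (\<Phi> x) e"
    proof
      fix y assume "y \<in> U"
      then have "mdist C_metric (\<Phi> x) (\<Phi> y) < e" using dist[of x y] unfolding U_def by (simp only: mem_Collect_eq)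
      then show "\<Phi> y \<in> C.mball (\<Phi> x) e" using \<Phi>C by (simp only: C.in_mball)
    qed
    ultimately show "\<exists>U. openin euclidean U \<and> x \<in> U \<and> (\<forall>y\<in>U. \<Phi> y \<in> C.mball (\<Phi> x) e)"
      by (intro exI[of _ U]) simp
  qed
  then show ?thesis by (simp add: C_cube_def mtopology_of_def \<Phi>_def[abs_def])
qed

lemma path_sum_measurable:
  fixes \<phi> :: "'i::countable \<Rightarrow> real^'d::finite \<Rightarrow> real"
  assumes I: "finite I" and \<phi>: "\<And>i. i \<in> I \<Longrightarrow> continuous_on unit_cube (\<phi> i)"
    and Z: "\<And>i. i \<in> I \<Longrightarrow> Z i \<in> borel_measurable M"
  shows "path_of (\<lambda>t w. \<Sum>i\<in>I. \<phi> i t * Z i w) \<in> measurable M (borel_of C_cube)"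
proof -
  define \<Phi> where "\<Phi> x = restrict (\<lambda>t. \<Sum>i\<in>I. \<phi> i t * x i) unit_cube" for x :: "'i \<Rightarrow> real"
  have \<Phi>: "continuous_map euclidean C_cube \<Phi>" unfolding \<Phi>_def by (rule continuous_map_path[OF I \<phi>])
  have c: "(\<lambda>w. cut I (\<lambda>i. Z i w)) \<in> borel_measurable M"
    unfolding cut_def
  proof (rule measurable_coordinatewise_then_product)
    show "(\<lambda>w. if i \<in> I then Z i w else 0) \<in> borel_measurable M" for i using Z by (cases "i \<in> I") auto
  qed
  have "path_of (\<lambda>t w. \<Sum>i\<in>I. \<phi> i t * Z i w) = (\<lambda>w. \<Phi> (cut I (\<lambda>i. Z i w)))"
    by (rule ext) (simp add: path_of_def \<Phi>_def cut_def)
  moreover have "(\<lambda>w. \<Phi> (cut I (\<lambda>i. Z i w))) \<in> measurable M (borel_of C_cube)"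
  proof (rule measurable_compose[OF c], rule measurable_borel_of)
    show "\<Phi> x \<in> topspace C_cube" for x using continuous_map_image_subset_topspace[OF \<Phi>] by auto
    fix U :: "(real^'d \<Rightarrow> real) set" assume "openin C_cube U"
    then have "open (\<Phi> -` U)"
      using openin_continuous_map_preimage[OF \<Phi>, of U] by (simp add: vimage_def)
    then show "\<Phi> -` U \<inter> space borel \<in> sets borel" by simp
  qed
  ultimately show ?thesis by simp
qed

subsection \<open>Chaining along dyadic grids\<close>

definition l1 :: "real^'d::finite \<Rightarrow> real^'d \<Rightarrow> real" where
  "l1 s t = (\<Sum>m\<in>UNIV. \<bar>s $ m - t $ m\<bar>)"

lemma l1_nonneg: "0 \<le> l1 s t"
  by (simp add: l1_def sum_nonneg)

lemma l1_le:
  fixes s t :: "real^'d::finite"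
  assumes "\<And>m. \<bar>s $ m - t $ m\<bar> \<le> c" shows "l1 s t \<le> real CARD('d) * c"
  unfolding l1_def using sum_bounded_above[of UNIV "\<lambda>m. \<bar>s $ m - t $ m\<bar>" c] assms by simp

definition node :: "nat \<Rightarrow> int^'d::finite \<Rightarrow> real^'d" where
  "node j i = (\<chi> m. real_of_int (i $ m) / 2 ^ j)"

definition grid :: "nat \<Rightarrow> (int^'d::finite) set" where
  "grid j = {i. \<forall>m. i $ m \<in> {0..2 ^ j}}"

definition floor_index :: "nat \<Rightarrow> real^'d::finite \<Rightarrow> int^'d" where
  "floor_index j t = (\<chi> m. \<lfloor>2 ^ j * t $ m\<rfloor>)"

text \<open>The parent of an index on the next coarser grid. The floor indices of a point are
  related by it from level to level, so they form the chain along which increments are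
  summed.\<close>

definition half :: "int^'d::finite \<Rightarrow> int^'d" where
  "half i = (\<chi> m. i $ m div 2)"

section \<open>Dyadic nodes, floor indices and their distances\<close>

lemma mem_unit_cube: "t \<in> unit_cube \<longleftrightarrow> (\<forall>m. 0 \<le> t $ m \<and> t $ m \<le> 1)"
  by (simp add: mem_box_cart)

lemma finite_grid[simp]: "finite (grid j)"
  unfolding grid_def by (rule finite_vec_box) simp

lemma card_grid: "real (card (grid j :: (int^'d::finite) set)) \<le> (2 * 2 ^ j) ^ CARD('d)"
proof -
  have "card (grid j :: (int^'d) set) = nat (2 ^ j + 1) ^ CARD('d)"
    unfolding grid_def by (subst card_vec_box) simp_all
  also have "nat (2 ^ j + 1) = 2 ^ j + 1" by (simp add: nat_add_distrib nat_power_eq)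
  finally have "real (card (grid j :: (int^'d) set)) = (2 ^ j + 1) ^ CARD('d)" by (simp add: add.commute)
  also have "\<dots> \<le> (2 * 2 ^ j) ^ CARD('d)" by (intro power_mono) auto
  finally show ?thesis .
qed

lemma node_in_cube: "i \<in> grid j \<Longrightarrow> node j i \<in> unit_cube"
proof -
  assume i: "i \<in> grid j"
  have "0 \<le> real_of_int (i $ m) / 2 ^ j \<and> real_of_int (i $ m) / 2 ^ j \<le> 1" for m
  proof -
    have "0 \<le> i $ m" "i $ m \<le> 2 ^ j" using i by (auto simp: grid_def)
    then have "0 \<le> real_of_int (i $ m)" "real_of_int (i $ m) \<le> 2 ^ j" by (simp_all flip: of_int_power_le_of_int_cancel_iff add: of_int_le_numeral_power_cancel_iff)
    then show ?thesis by simp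
  qed
  then show "node j i \<in> unit_cube" by (simp add: mem_unit_cube node_def)
qed

lemma floor_index_grid: "t \<in> unit_cube \<Longrightarrow> floor_index j t \<in> grid j"
proof -
  assume t: "t \<in> unit_cube"
  have "0 \<le> \<lfloor>2 ^ j * t $ m\<rfloor> \<and> \<lfloor>2 ^ j * t $ m\<rfloor> \<le> 2 ^ j" for m
  proof
    have t: "0 \<le> t $ m" "t $ m \<le> 1" using t by (auto simp: mem_unit_cube)
    then show "0 \<le> \<lfloor>2 ^ j * t $ m\<rfloor>" by simp
    have "2 ^ j * t $ m \<le> 2 ^ j * 1" using t by (intro mult_left_mono) auto
    then have "\<lfloor>2 ^ j * t $ m\<rfloor> \<le> \<lfloor>(2 ^ j :: real)\<rfloor>" by (intro floor_mono) simp
    also have "\<lfloor>(2 ^ j :: real)\<rfloor> = 2 ^ j" by (metis floor_of_int of_int_numeral of_int_power)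
    finally show "\<lfloor>2 ^ j * t $ m\<rfloor> \<le> 2 ^ j" .
  qed
  then show "floor_index j t \<in> grid j" by (simp add: grid_def floor_index_def)
qed

lemma half_floor_index: "half (floor_index (Suc j) t) = floor_index j t"
proof -
  have "\<lfloor>2 * 2 ^ j * t $ m\<rfloor> div 2 = \<lfloor>2 ^ j * t $ m\<rfloor>" for m
    using floor_divide_real_eq_div[of 2 "2 * 2 ^ j * t $ m"] by simp
  then show ?thesis by (simp add: half_def floor_index_def vec_eq_iff)
qed

lemma half_grid: "i \<in> grid (Suc j) \<Longrightarrow> half i \<in> grid j"
proof -
  assume i: "i \<in> grid (Suc j)"
  have "0 \<le> i $ m div 2 \<and> i $ m div 2 \<le> 2 ^ j" for m
  proof -
    have "0 \<le> i $ m" "i $ m \<le> 2 * 2 ^ j" using i by (auto simp: grid_def)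
    then show ?thesis by linarith
  qed
  then show "half i \<in> grid j" by (simp add: grid_def half_def)
qed

lemma l1_half:
  fixes i :: "int^'d::finite"
  shows "l1 (node (Suc j) i) (node j (half i)) \<le> real CARD('d) * (1 / 2 ^ Suc j)"
proof (rule l1_le)
  fix m
  have "real_of_int (i $ m) = 2 * real_of_int (i $ m div 2) + real_of_int (i $ m mod 2)"
    by (metis mult_div_mod_eq of_int_add of_int_mult of_int_numeral)
  then have "node (Suc j) i $ m - node j (half i) $ m = real_of_int (i $ m mod 2) / 2 ^ Suc j"
    by (simp add: node_def half_def field_simps)
  moreover have "0 \<le> i $ m mod 2" "i $ m mod 2 \<le> 1" by auto
  ultimately show "\<bar>node (Suc j) i $ m - node j (half i) $ m\<bar> \<le> 1 / 2 ^ Suc j"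
    by (simp add: divide_right_mono)
qed

lemma l1_floor_index:
  fixes t :: "real^'d::finite"
  shows "l1 (node j (floor_index j t)) t \<le> real CARD('d) * (1 / 2 ^ j)"
proof (rule l1_le)
  fix m
  have f: "real_of_int \<lfloor>2 ^ j * t $ m\<rfloor> \<le> 2 ^ j * t $ m" "2 ^ j * t $ m < real_of_int \<lfloor>2 ^ j * t $ m\<rfloor> + 1"
    by linarith+
  have "node j (floor_index j t) $ m - t $ m = (real_of_int \<lfloor>2 ^ j * t $ m\<rfloor> - 2 ^ j * t $ m) / 2 ^ j"
    by (simp add: node_def floor_index_def diff_divide_distrib)
  also have "\<bar>\<dots>\<bar> = \<bar>real_of_int \<lfloor>2 ^ j * t $ m\<rfloor> - 2 ^ j * t $ m\<bar> / 2 ^ j" by (simp add: abs_divide)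
  also have "\<dots> \<le> 1 / 2 ^ j" by (rule divide_right_mono) (use f in linarith, simp)
  finally show "\<bar>node j (floor_index j t) $ m - t $ m\<bar> \<le> 1 / 2 ^ j" .
qed

definition nu :: real where "nu = sqrt (sqrt (1 / 2))"

lemma nu: "0 < nu" "nu < 1" "nu ^ 4 = 1 / 2"
proof -
  show "0 < nu" by (simp add: nu_def)
  show "nu < 1" by (simp add: nu_def)
  have "nu ^ 4 = (nu\<^sup>2)\<^sup>2" by simp
  then show "nu ^ 4 = 1 / 2" by (simp add: nu_def)
qed

lemma abs_le_eps_plus_power:
  fixes x e :: real
  assumes "0 < e" "0 < q" shows "\<bar>x\<bar> \<le> e + \<bar>x\<bar> ^ q / e ^ (q - 1)"
proof (cases "\<bar>x\<bar> \<le> e")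
  case True
  then show ?thesis using assms by (simp add: add_increasing2)
next
  case False
  have "e ^ (q - 1) \<le> \<bar>x\<bar> ^ (q - 1)" using False assms by (intro power_mono) auto
  then have "\<bar>x\<bar> * e ^ (q - 1) \<le> \<bar>x\<bar> * \<bar>x\<bar> ^ (q - 1)" by (intro mult_left_mono) auto
  also have "\<dots> = \<bar>x\<bar> ^ q" using assms by (cases q) auto
  finally have "\<bar>x\<bar> \<le> \<bar>x\<bar> ^ q / e ^ (q - 1)" using assms by (simp add: pos_le_divide_eq)
  then show ?thesis using assms by linarith
qed

text \<open>The linear bound \<open>\<bar>x\<bar> \<le> \<epsilon> + \<bar>x\<bar>\<^sup>q / \<epsilon>\<^sup>q\<^sup>-\<^sup>1\<close> replaces the maximum over the edges by
  a sum. With $\epsilon = \nu^j$, $\nu = 2^{-1/4}$ and $q = 4d$, both terms have expectation of order $\nu^j$.\<close>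

lemma (in prob_space) max_increment:
  fixes F :: "real^'d::finite \<Rightarrow> 'a \<Rightarrow> real" and E :: "'e set"
  assumes F: "\<And>t. t \<in> unit_cube \<Longrightarrow> brv M (F t)"
    and mom: "\<And>s t. s \<in> unit_cube \<Longrightarrow> t \<in> unit_cube \<Longrightarrow>
      (\<integral>x. \<bar>F t x - F s x\<bar> ^ (4 * CARD('d)) \<partial>M) \<le> K * l1 t s ^ (2 * CARD('d))"
    and K: "0 \<le> K" and E: "finite E" "real (card E) \<le> 4 ^ CARD('d) * (2 ^ j) ^ CARD('d)"
    and uw: "\<And>e. e \<in> E \<Longrightarrow> u e \<in> unit_cube" "\<And>e. e \<in> E \<Longrightarrow> w e \<in> unit_cube"
      "\<And>e. e \<in> E \<Longrightarrow> l1 (u e) (w e) \<le> real CARD('d) * (1 / 2 ^ j)"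
  obtains H where "brv M H" "(\<integral>x. H x \<partial>M) \<le> (1 + 4 ^ CARD('d) * K * real CARD('d) ^ (2 * CARD('d))) * nu ^ j"
    "\<And>e x. e \<in> E \<Longrightarrow> \<bar>F (u e) x - F (w e) x\<bar> \<le> H x"
proof -
  define q where "q = 4 * CARD('d)"
  have q: "0 < q" by (simp add: q_def)
  define d where "d = CARD('d)"
  define H where "H x = nu ^ j + (\<Sum>e\<in>E. \<bar>F (u e) x - F (w e) x\<bar> ^ q) / (nu ^ j) ^ (q - 1)" for x
  have nuj: "0 < nu ^ j" using nu by simp
  have b: "brv M (\<lambda>x. \<bar>F (u e) x - F (w e) x\<bar> ^ q)" if "e \<in> E" for e
    using that by (intro brv_power brv_abs brv_diff F uw)
  have bS: "brv M (\<lambda>x. \<Sum>e\<in>E. \<bar>F (u e) x - F (w e) x\<bar> ^ q)" by (rule brv_sum[OF b])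
  show thesis
  proof (rule that)
    show "brv M H" unfolding H_def[abs_def] by (intro brv_add brv_divide brv_const bS)
    fix e x assume e: "e \<in> E"
    have "\<bar>F (u e) x - F (w e) x\<bar> \<le> nu ^ j + \<bar>F (u e) x - F (w e) x\<bar> ^ q / (nu ^ j) ^ (q - 1)"
      by (rule abs_le_eps_plus_power[OF nuj q])
    also have "\<dots> \<le> H x"
      unfolding H_def using E e nuj member_le_sum[OF e, of "\<lambda>e. \<bar>F (u e) x - F (w e) x\<bar> ^ q"]
      by (intro add_left_mono divide_right_mono) auto
    finally show "\<bar>F (u e) x - F (w e) x\<bar> \<le> H x" .
  next
    have "(\<integral>x. H x \<partial>M) = nu ^ j + (\<Sum>e\<in>E. \<integral>x. \<bar>F (u e) x - F (w e) x\<bar> ^ q \<partial>M) / (nu ^ j) ^ (q - 1)"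
    proof -
      have "(\<integral>x. (\<Sum>e\<in>E. \<bar>F (u e) x - F (w e) x\<bar> ^ q) \<partial>M) = (\<Sum>e\<in>E. \<integral>x. \<bar>F (u e) x - F (w e) x\<bar> ^ q \<partial>M)"
        by (rule Bochner_Integration.integral_sum) (rule brv_integrable[OF b])
      moreover have "integrable M (\<lambda>x. (\<Sum>e\<in>E. \<bar>F (u e) x - F (w e) x\<bar> ^ q) / (nu ^ j) ^ (q - 1))"
        by (rule brv_integrable[OF brv_divide[OF bS]])
      ultimately show ?thesis unfolding H_def
        by (subst Bochner_Integration.integral_add) (simp_all add: prob_space)
    qed
    also have "(\<Sum>e\<in>E. \<integral>x. \<bar>F (u e) x - F (w e) x\<bar> ^ q \<partial>M) \<le> (\<Sum>e\<in>E. K * (real d * (1 / 2 ^ j)) ^ (2 * d))"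
    proof (rule sum_mono)
      fix e assume e: "e \<in> E"
      have "(\<integral>x. \<bar>F (u e) x - F (w e) x\<bar> ^ q \<partial>M) \<le> K * l1 (u e) (w e) ^ (2 * d)"
        unfolding q_def d_def by (rule mom) (use e uw in auto)
      also have "\<dots> \<le> K * (real d * (1 / 2 ^ j)) ^ (2 * d)"
        using K uw(3)[OF e] by (intro mult_left_mono power_mono l1_nonneg) (auto simp: d_def)
      finally show "(\<integral>x. \<bar>F (u e) x - F (w e) x\<bar> ^ q \<partial>M) \<le> K * (real d * (1 / 2 ^ j)) ^ (2 * d)" .
    qed
    also have "\<dots> = real (card E) * (K * (real d * (1 / 2 ^ j)) ^ (2 * d))" by simp
    also have "\<dots> \<le> (4 ^ d * (2 ^ j) ^ d) * (K * (real d * (1 / 2 ^ j)) ^ (2 * d))"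
      using K E(2) by (intro mult_right_mono) (auto simp: d_def)
    also have "\<dots> = 4 ^ d * K * real d ^ (2 * d) * ((2 ^ j) ^ d * (1 / 2 ^ j) ^ (2 * d))"
      by (simp only: power_mult_distrib mult_ac)
    \<comment> \<open>At most 4^d 2^(d j) edges with moments of order 2^(-2 d j) leave 2^(-d j),
      which is the q-th power of nu^j.\<close>
    also have "(2 ^ j) ^ d * (1 / 2 ^ j :: real) ^ (2 * d) = (1 / 2 ^ j) ^ d"
      by (simp add: mult_2 power_add power_divide)
    also have "(1 / 2 ^ j :: real) ^ d = (nu ^ j) ^ q"
    proof -
      have "(nu ^ j) ^ q = ((nu ^ 4) ^ j) ^ d" by (simp add: q_def d_def power_mult[symmetric] mult_ac)
      then show ?thesis by (simp add: nu power_divide)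
    qed
    also have "(nu ^ j) ^ q = nu ^ j * (nu ^ j) ^ (q - 1)" using q by (cases q) auto
    finally have "(\<integral>x. H x \<partial>M) \<le> nu ^ j + (4 ^ d * K * real d ^ (2 * d) * (nu ^ j * (nu ^ j) ^ (q - 1))) / (nu ^ j) ^ (q - 1)"
      using nuj by (simp add: divide_right_mono)
    also have "\<dots> = (1 + 4 ^ d * K * real d ^ (2 * d)) * nu ^ j"
      using nuj by (simp add: distrib_right)
    finally show "(\<integral>x. H x \<partial>M) \<le> (1 + 4 ^ CARD('d) * K * real CARD('d) ^ (2 * CARD('d))) * nu ^ j"
      by (simp only: d_def)
  qed
qed

subsection \<open>Multilinear interpolation\<close>

text \<open>Products of tent functions: 1 at the own node, 0 at all others, and a partition of unity
  on the cube. At any point only corners of the dyadic cell containing it contribute.\<close>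

definition hat :: "nat \<Rightarrow> int^'d::finite \<Rightarrow> real^'d \<Rightarrow> real" where
  "hat j i t = (\<Prod>m\<in>UNIV. max 0 (1 - \<bar>2 ^ j * t $ m - real_of_int (i $ m)\<bar>))"

lemma continuous_hat: "continuous_on A (hat j i)"
  unfolding hat_def by (intro continuous_intros)

lemma hat_nonneg: "0 \<le> hat j i t"
  unfolding hat_def by (intro prod_nonneg) auto

lemma sum_tent:
  fixes x :: real
  assumes "0 \<le> x" "x \<le> real N"
  shows "(\<Sum>i\<in>{0..int N}. max 0 (1 - \<bar>x - real_of_int i\<bar>)) = 1"
  using assms
proof (induction N)
  case 0
  then show ?case by simp
next
  case (Suc N)
  have S: "{0..int (Suc N)} = insert (int N + 1) {0..int N}" by auto
  show ?case
  proof (cases "x \<le> real N")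
    case True
    then show ?thesis unfolding S using Suc by simp
  next
    case False
    have "(\<Sum>i\<in>{0..int N}. max 0 (1 - \<bar>x - real_of_int i\<bar>)) = (\<Sum>i\<in>{int N}. max 0 (1 - \<bar>x - real_of_int i\<bar>))"
    proof (rule sum.mono_neutral_right)
      show "\<forall>i\<in>{0..int N} - {int N}. max 0 (1 - \<bar>x - real_of_int i\<bar>) = 0"
      proof
        fix i assume "i \<in> {0..int N} - {int N}"
        then have "i + 1 \<le> int N" by auto
        then have "real_of_int i + 1 \<le> real N" by linarith
        then show "max 0 (1 - \<bar>x - real_of_int i\<bar>) = 0" using False by auto
      qed
    qed auto
    then show ?thesis unfolding S using False Suc.prems by simp
  qed
qed

lemma sum_hat:
  fixes t :: "real^'d::finite"
  assumes "t \<in> unit_cube" shows "(\<Sum>i\<in>grid j. hat j i t) = 1"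
proof -
  have "(\<Sum>i\<in>grid j. hat j i t) = (\<Prod>m\<in>UNIV. \<Sum>i\<in>{0..2 ^ j}. max 0 (1 - \<bar>2 ^ j * t $ m - real_of_int i\<bar>))"
    unfolding grid_def hat_def
    by (rule sum_prod_vec[of "\<lambda>_. {0..2 ^ j}" "\<lambda>m i. max 0 (1 - \<bar>2 ^ j * t $ m - real_of_int i\<bar>)"]) simp
  also have "\<dots> = (\<Prod>m\<in>(UNIV :: 'd set). 1)"
  proof (intro prod.cong refl)
    fix m
    have "0 \<le> t $ m" "t $ m \<le> 1" using assms by (auto simp: mem_unit_cube)
    then have "0 \<le> 2 ^ j * t $ m" "2 ^ j * t $ m \<le> real (2 ^ j)" by (auto simp: mult_left_le)
    from sum_tent[OF this] show "(\<Sum>i\<in>{0..2 ^ j}. max 0 (1 - \<bar>2 ^ j * t $ m - real_of_int i\<bar>)) = 1" by simp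
  qed
  finally show ?thesis by simp
qed

lemma hat_support:
  assumes "hat j i t \<noteq> 0" shows "i - floor_index j t \<in> {k. \<forall>m. k $ m \<in> {0..1}}"
proof -
  have "(i - floor_index j t) $ m \<in> {0..1}" for m
  proof -
    have "max 0 (1 - \<bar>2 ^ j * t $ m - real_of_int (i $ m)\<bar>) \<noteq> 0"
      using assms unfolding hat_def by (auto simp: prod_zero_iff)
    then have "\<bar>2 ^ j * t $ m - real_of_int (i $ m)\<bar> < 1" by (auto simp: max_def split: if_splits)
    then have "\<lfloor>2 ^ j * t $ m\<rfloor> \<le> i $ m \<and> i $ m \<le> \<lfloor>2 ^ j * t $ m\<rfloor> + 1" by linarith
    then show ?thesis by (simp add: floor_index_def)
  qed
  then show ?thesis by simp
qed

text \<open>\<open>H\<close> has three parts: increments between the corners of a cell of level j, a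
  chain of increments from the lower corner down to a finer level j + k, and nu^j for the final step
  to t, by the Lipschitz bound. The depth k depends on the Lipschitz constant B, but the geometric
  series bounds the mean of \<open>H\<close> independently of k and B. For the process this gives
  uniformity in n.\<close>

lemma (in prob_space) interpolation_error:
  fixes F :: "real^'d::finite \<Rightarrow> 'a \<Rightarrow> real"
  assumes F: "\<And>t. t \<in> unit_cube \<Longrightarrow> brv M (F t)"
    and mom: "\<And>s t. s \<in> unit_cube \<Longrightarrow> t \<in> unit_cube \<Longrightarrow>
      (\<integral>x. \<bar>F t x - F s x\<bar> ^ (4 * CARD('d)) \<partial>M) \<le> K * l1 t s ^ (2 * CARD('d))"
    and K: "0 \<le> K"
    and lip: "\<And>x s t. x \<in> space M \<Longrightarrow> s \<in> unit_cube \<Longrightarrow> t \<in> unit_cube \<Longrightarrow> \<bar>F s x - F t x\<bar> \<le> B * l1 s t"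
  defines "C \<equiv> 1 + 4 ^ CARD('d) * K * real CARD('d) ^ (2 * CARD('d))"
  obtains H where "brv M H" "(\<integral>x. H x \<partial>M) \<le> (C + C / (1 - nu) + 1) * nu ^ j"
    "\<And>x t. x \<in> space M \<Longrightarrow> t \<in> unit_cube \<Longrightarrow> \<bar>(\<Sum>i\<in>grid j. hat j i t * F (node j i) x) - F t x\<bar> \<le> H x"
proof -
  have C: "0 \<le> C" using K by (simp add: C_def)
  define K1 where "K1 = {k::int^'d. \<forall>m. k $ m \<in> {0..1}}"
  define E where "E = {(i, k). i \<in> grid j \<and> k \<in> K1 \<and> i + k \<in> grid j}"
  have "\<exists>H0. brv M H0 \<and> (\<integral>x. H0 x \<partial>M) \<le> C * nu ^ j \<and>
      (\<forall>e x. e \<in> E \<longrightarrow> \<bar>F (node j (fst e + snd e)) x - F (node j (fst e)) x\<bar> \<le> H0 x)"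
  proof (rule max_increment[OF F mom K, where E = E and j = j and u = "\<lambda>e. node j (fst e + snd e)" and w = "\<lambda>e. node j (fst e)"])
    have K1f: "finite K1" unfolding K1_def by (rule finite_vec_box) simp
    have K1c: "card K1 = 2 ^ CARD('d)" unfolding K1_def by (subst card_vec_box) simp_all
    have sub: "E \<subseteq> grid j \<times> K1" by (auto simp: E_def)
    then show "finite E" using K1f by (auto intro: finite_subset)
    have "card E \<le> card (grid j :: (int^'d) set) * card K1"
      using card_mono[OF _ sub] K1f by (simp add: card_cartesian_product)
    then have "real (card E) \<le> real (card (grid j :: (int^'d) set) * 2 ^ CARD('d))"
      unfolding K1c by (rule of_nat_mono)
    then have "real (card E) \<le> real (card (grid j :: (int^'d) set)) * 2 ^ CARD('d)" by simp
    also have "\<dots> \<le> (2 * 2 ^ j) ^ CARD('d) * 2 ^ CARD('d)"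
      by (intro mult_right_mono card_grid) simp
    also have "\<dots> = 4 ^ CARD('d) * (2 ^ j) ^ CARD('d)"
      using power_mult_distrib[of "2::real" 2 "CARD('d)"] by (simp add: power_mult_distrib)
    finally show "real (card E) \<le> 4 ^ CARD('d) * (2 ^ j) ^ CARD('d)" .
    fix e assume e: "e \<in> E"
    show "node j (fst e + snd e) \<in> unit_cube" "node j (fst e) \<in> unit_cube"
      using e by (auto simp: E_def intro: node_in_cube)
    show "l1 (node j (fst e + snd e)) (node j (fst e)) \<le> real CARD('d) * (1 / 2 ^ j)"
    proof (rule l1_le)
      fix m
      have k: "0 \<le> snd e $ m" "snd e $ m \<le> 1" using e by (auto simp: E_def K1_def)
      have "node j (fst e + snd e) $ m - node j (fst e) $ m = real_of_int (snd e $ m) / 2 ^ j"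
        by (simp add: node_def add_divide_distrib)
      then show "\<bar>node j (fst e + snd e) $ m - node j (fst e) $ m\<bar> \<le> 1 / 2 ^ j"
        using k by (simp add: divide_right_mono)
    qed
  qed (use C_def in auto)
  then obtain H0 where H0: "brv M H0" "(\<integral>x. H0 x \<partial>M) \<le> C * nu ^ j"
    "\<And>e x. e \<in> E \<Longrightarrow> \<bar>F (node j (fst e + snd e)) x - F (node j (fst e)) x\<bar> \<le> H0 x" by blast
  have "\<exists>H. brv M H \<and> (\<integral>x. H x \<partial>M) \<le> C * nu ^ Suc l \<and>
      (\<forall>i x. i \<in> grid (Suc l) \<longrightarrow> \<bar>F (node (Suc l) i) x - F (node l (half i)) x\<bar> \<le> H x)" for l
  proof (rule max_increment[OF F mom K, where E = "grid (Suc l)" and j = "Suc l" and u = "\<lambda>i. node (Suc l) i" and w = "\<lambda>i. node l (half i)"])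
    show "finite (grid (Suc l))" by simp
    have "real (card (grid (Suc l) :: (int^'d) set)) \<le> (2 * 2 ^ Suc l) ^ CARD('d)" by (rule card_grid)
    also have "\<dots> \<le> (4 * 2 ^ Suc l) ^ CARD('d)" by (intro power_mono) auto
    finally show "real (card (grid (Suc l) :: (int^'d) set)) \<le> 4 ^ CARD('d) * (2 ^ Suc l) ^ CARD('d)"
      by (simp only: power_mult_distrib)
    fix i :: "int^'d" assume i: "i \<in> grid (Suc l)"
    show "node (Suc l) i \<in> unit_cube" "node l (half i) \<in> unit_cube"
      using i by (auto intro: node_in_cube half_grid)
    show "l1 (node (Suc l) i) (node l (half i)) \<le> real CARD('d) * (1 / 2 ^ Suc l)" by (rule l1_half)
  qed (use C_def in auto)
  then obtain G where G: "\<And>l. brv M (G l)" "\<And>l. (\<integral>x. G l x \<partial>M) \<le> C * nu ^ Suc l"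
    "\<And>l i x. i \<in> grid (Suc l) \<Longrightarrow> \<bar>F (node (Suc l) i) x - F (node l (half i)) x\<bar> \<le> G l x" by metis
  \<comment> \<open>Fixes the depth at which the Lipschitz bound takes over; the chain stays finite
    and no limit of chains is taken.\<close>
  have "(\<lambda>k. \<bar>B\<bar> * (real CARD('d) * (1 / 2) ^ k)) \<longlonglongrightarrow> \<bar>B\<bar> * (real CARD('d) * 0)"
    by (intro tendsto_mult tendsto_const LIMSEQ_realpow_zero) auto
  then have "\<forall>\<^sub>F k in sequentially. \<bar>B\<bar> * (real CARD('d) * (1 / 2) ^ k) < nu ^ j"
    using nu by (intro order_tendstoD(2)[where y = 0]) auto
  then obtain k0 where k0: "\<And>k. k \<ge> k0 \<Longrightarrow> \<bar>B\<bar> * (real CARD('d) * (1 / 2) ^ k) < nu ^ j"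
    by (auto simp: eventually_sequentially)
  define k where "k = k0"
  have kk: "\<bar>B\<bar> * (real CARD('d) * (1 / 2 ^ (j + k))) \<le> nu ^ j"
    using k0[of "j + k"] by (simp add: k_def power_divide)
  have chain: "\<bar>F (node j (floor_index j t)) x - F (node (j + l) (floor_index (j + l) t)) x\<bar> \<le> (\<Sum>i<l. G (j + i) x)"
    if t: "t \<in> unit_cube" for t x l
  proof (induction l)
    case (Suc l)
    have "\<bar>F (node (Suc (j + l)) (floor_index (Suc (j + l)) t)) x - F (node (j + l) (half (floor_index (Suc (j + l)) t))) x\<bar> \<le> G (j + l) x"
      by (rule G(3)[OF floor_index_grid[OF t]])
    then show ?case using Suc unfolding half_floor_index by simp
  qed simp
  define H where "H x = H0 x + (\<Sum>i<k. G (j + i) x) + nu ^ j" for x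
  show thesis
  proof (rule that)
    show "brv M H" unfolding H_def[abs_def] by (intro brv_add brv_sum brv_const H0(1) G(1))
    have "(\<integral>x. H x \<partial>M) = (\<integral>x. H0 x \<partial>M) + (\<Sum>i<k. \<integral>x. G (j + i) x \<partial>M) + nu ^ j"
    proof -
      have sG: "(\<integral>x. (\<Sum>i<k. G (j + i) x) \<partial>M) = (\<Sum>i<k. \<integral>x. G (j + i) x \<partial>M)"
        by (rule Bochner_Integration.integral_sum) (rule brv_integrable[OF G(1)])
      have iG: "integrable M (\<lambda>x. \<Sum>i<k. G (j + i) x)" by (intro brv_integrable brv_sum G(1))
      have iH: "integrable M H0" by (rule brv_integrable[OF H0(1)])
      show ?thesis unfolding H_def
        using iG iH by (simp add: sG prob_space)
    qed
    also have "\<dots> \<le> C * nu ^ j + (\<Sum>i<k. C * nu ^ Suc (j + i)) + nu ^ j"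
      by (intro add_mono H0(2) sum_mono G(2)) simp
    also have "(\<Sum>i<k. C * nu ^ Suc (j + i)) = C * nu ^ j * (nu * (\<Sum>i<k. nu ^ i))"
      by (simp add: sum_distrib_left power_add mult_ac)
    also have "\<dots> \<le> C * nu ^ j * (1 / (1 - nu))"
    proof (rule mult_left_mono)
      have "(\<Sum>i<k. nu ^ i) = (1 - nu ^ k) / (1 - nu)" using nu by (subst sum_gp_strict) auto
      also have "\<dots> \<le> 1 / (1 - nu)" using nu by (intro divide_right_mono) auto
      finally have "nu * (\<Sum>i<k. nu ^ i) \<le> 1 * (1 / (1 - nu))"
        using nu by (intro mult_mono) (auto intro: sum_nonneg)
      then show "nu * (\<Sum>i<k. nu ^ i) \<le> 1 / (1 - nu)" by simp
    qed (use C nu in simp)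
    finally show "(\<integral>x. H x \<partial>M) \<le> (C + C / (1 - nu) + 1) * nu ^ j" by (simp add: distrib_right)
  next
    fix x t assume x: "x \<in> space M" and t: "t \<in> (unit_cube :: (real^'d) set)"
    define f where "f = floor_index j t"
    have f: "f \<in> grid j" unfolding f_def by (rule floor_index_grid[OF t])
    have near: "\<bar>F (node j f) x - F t x\<bar> \<le> (\<Sum>i<k. G (j + i) x) + nu ^ j"
    proof -
      define s where "s = node (j + k) (floor_index (j + k) t)"
      have s: "s \<in> unit_cube" unfolding s_def by (intro node_in_cube floor_index_grid t)
      have "\<bar>F s x - F t x\<bar> \<le> B * l1 s t" by (rule lip[OF x s t])
      also have "\<dots> \<le> \<bar>B\<bar> * l1 s t" by (intro mult_right_mono l1_nonneg) simp
      also have "\<dots> \<le> \<bar>B\<bar> * (real CARD('d) * (1 / 2 ^ (j + k)))"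
        unfolding s_def by (intro mult_left_mono l1_floor_index) simp
      also note kk
      finally have "\<bar>F s x - F t x\<bar> \<le> nu ^ j" .
      with chain[OF t, of x k] show ?thesis unfolding f_def s_def by linarith
    qed
    \<comment> \<open>As the hats sum to 1, the error is a weighted mean of the differences between
      F t and the values at the corners of the cell of t.\<close>
    have "(\<Sum>i\<in>grid j. hat j i t * F (node j i) x) - F t x = (\<Sum>i\<in>grid j. hat j i t * (F (node j i) x - F t x))"
      by (simp add: right_diff_distrib sum_subtractf sum_distrib_right[symmetric] sum_hat[OF t])
    also have "\<bar>\<dots>\<bar> \<le> (\<Sum>i\<in>grid j. \<bar>hat j i t * (F (node j i) x - F t x)\<bar>)" by (rule sum_abs)
    also have "\<dots> \<le> (\<Sum>i\<in>grid j. hat j i t * H x)"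
    proof (rule sum_mono)
      fix i :: "int^'d" assume i: "i \<in> grid j"
      show "\<bar>hat j i t * (F (node j i) x - F t x)\<bar> \<le> hat j i t * H x"
      proof (cases "hat j i t = 0")
        case False
        then have "i - f \<in> K1" using hat_support unfolding f_def K1_def by blast
        then have "(f, i - f) \<in> E" using f i by (simp add: E_def)
        from H0(3)[OF this, of x] have "\<bar>F (node j i) x - F (node j f) x\<bar> \<le> H0 x" by simp
        with near have "\<bar>F (node j i) x - F t x\<bar> \<le> H x" unfolding H_def by linarith
        then show ?thesis unfolding abs_mult abs_of_nonneg[OF hat_nonneg] by (intro mult_left_mono hat_nonneg)
      qed simp
    qed
    also have "\<dots> = H x" by (simp add: sum_distrib_right[symmetric] sum_hat[OF t])
    finally show "\<bar>(\<Sum>i\<in>grid j. hat j i t * F (node j i) x) - F t x\<bar> \<le> H x" .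
  qed
qed

text \<open>A deterministic statement from uniform continuity. Applied path by path to the limiting
  sheet, it uses only continuity of the sample paths and no moments of increments.\<close>

lemma interpolation_tendsto:
  fixes g :: "real^'d::finite \<Rightarrow> real"
  assumes g: "continuous_on unit_cube g" and e: "0 < e"
  shows "\<forall>\<^sub>F j in sequentially. \<forall>t\<in>unit_cube. \<bar>(\<Sum>i\<in>grid j. hat j i t * g (node j i)) - g t\<bar> \<le> e"
proof -
  have "uniformly_continuous_on unit_cube g" by (rule compact_uniformly_continuous[OF g]) simp
  then obtain \<delta> where \<delta>: "0 < \<delta>" "\<And>s t. s \<in> unit_cube \<Longrightarrow> t \<in> unit_cube \<Longrightarrow> dist s t < \<delta> \<Longrightarrow> dist (g s) (g t) < e"
    using e unfolding uniformly_continuous_on_def by metis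
  have "(\<lambda>j. real CARD('d) * (1 / 2) ^ j) \<longlonglongrightarrow> real CARD('d) * 0"
    by (intro tendsto_mult tendsto_const LIMSEQ_realpow_zero) auto
  then have "\<forall>\<^sub>F j in sequentially. real CARD('d) * (1 / 2) ^ j < \<delta>"
    using \<delta> by (intro order_tendstoD(2)[where y = 0]) auto
  then show ?thesis
  proof eventually_elim
    case (elim j)
    show ?case
    proof
      fix t :: "real^'d" assume t: "t \<in> unit_cube"
      have "(\<Sum>i\<in>grid j. hat j i t * g (node j i)) - g t = (\<Sum>i\<in>grid j. hat j i t * (g (node j i) - g t))"
        by (simp add: right_diff_distrib sum_subtractf sum_distrib_right[symmetric] sum_hat[OF t])
      also have "\<bar>\<dots>\<bar> \<le> (\<Sum>i\<in>grid j. \<bar>hat j i t * (g (node j i) - g t)\<bar>)" by (rule sum_abs)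
      also have "\<dots> \<le> (\<Sum>i\<in>grid j. hat j i t * e)"
      proof (rule sum_mono)
        fix i :: "int^'d" assume i: "i \<in> grid j"
        show "\<bar>hat j i t * (g (node j i) - g t)\<bar> \<le> hat j i t * e"
        proof (cases "hat j i t = 0")
          case False
          have "\<bar>node j i $ m - t $ m\<bar> \<le> 1 / 2 ^ j" for m
          proof -
            have "max 0 (1 - \<bar>2 ^ j * t $ m - real_of_int (i $ m)\<bar>) \<noteq> 0"
              using False unfolding hat_def by (auto simp: prod_zero_iff)
            then have "\<bar>real_of_int (i $ m) - 2 ^ j * t $ m\<bar> \<le> 1" by (auto simp: max_def split: if_splits)
            then have "\<bar>real_of_int (i $ m) - 2 ^ j * t $ m\<bar> / 2 ^ j \<le> 1 / 2 ^ j" by (rule divide_right_mono) simp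
            moreover have "node j i $ m - t $ m = (real_of_int (i $ m) - 2 ^ j * t $ m) / 2 ^ j"
              by (simp add: node_def diff_divide_distrib)
            ultimately show ?thesis by (simp add: abs_divide)
          qed
          then have "l1 (node j i) t \<le> real CARD('d) * (1 / 2 ^ j)" by (rule l1_le)
          moreover have "dist (node j i) t \<le> l1 (node j i) t"
            unfolding dist_norm l1_def using norm_le_l1_cart[of "node j i - t"] by simp
          ultimately have "dist (node j i) t < \<delta>" using elim by (simp add: power_divide)
          then have "\<bar>g (node j i) - g t\<bar> \<le> e" using \<delta>(2)[OF node_in_cube[OF i] t] by (simp add: dist_real_def)
          then show ?thesis unfolding abs_mult abs_of_nonneg[OF hat_nonneg] by (intro mult_left_mono hat_nonneg)
        qed simp
      qed
      also have "\<dots> = e" by (simp add: sum_distrib_right[symmetric] sum_hat[OF t])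
      finally show "\<bar>(\<Sum>i\<in>grid j. hat j i t * g (node j i)) - g t\<bar> \<le> e" .
    qed
  qed
qed

subsection \<open>The functional central limit theorem\<close>

lemma brownian_sheet_measurable:
  fixes W :: "real^'d::finite \<Rightarrow> 'w \<Rightarrow> real"
  assumes "brownian_sheet N W" "t \<in> unit_cube"
  shows "gaussian_rv N (W t)"
proof -
  have "gaussian_field N unit_cube W" using assms(1) by (simp add: brownian_sheet_def)
  then have "gaussian_rv N (\<lambda>w. \<Sum>t\<in>{t}. 1 * W t w)"
    unfolding gaussian_field_def using assms(2) by (elim allE[of _ "{t}"] allE[of _ "\<lambda>_. 1"]) simp
  then show ?thesis by simp
qed

text \<open>\<open>gaussian_field\<close> speaks of sums over a set of points, so the family is
  reindexed by its image; this is where injectivity enters.\<close>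

lemma brownian_sheet_combination:
  fixes W :: "real^'d::finite \<Rightarrow> 'w \<Rightarrow> real" and u :: "'g \<Rightarrow> real^'d"
  assumes W: "brownian_sheet N W" and G: "finite G" and u: "\<And>g. g \<in> G \<Longrightarrow> u g \<in> unit_cube" and inj: "inj_on u G"
  shows "(\<integral>w. cos ((\<Sum>g\<in>G. a g * W (u g) w) + b) \<partial>N)
    = exp (- (\<Sum>g\<in>G. \<Sum>g'\<in>G. a g * a g' * (\<Prod>m\<in>UNIV. min (u g $ m) (u g' $ m))) / 2) * cos b"
proof -
  interpret N: prob_space N using W by (simp add: brownian_sheet_def)
  have W0: "(\<integral>w. W t w \<partial>N) = 0" if "t \<in> unit_cube" for t using W that by (simp add: brownian_sheet_def)
  have Wc: "(\<integral>w. W s w * W t w \<partial>N) = (\<Prod>m\<in>UNIV. min (s $ m) (t $ m))" if "s \<in> unit_cube" "t \<in> unit_cube" for s t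
    using W that by (simp add: brownian_sheet_def)
  have Wg: "gaussian_rv N (W t)" if "t \<in> unit_cube" for t by (rule brownian_sheet_measurable[OF W that])
  have Wm: "W t \<in> borel_measurable N" if "t \<in> unit_cube" for t using Wg[OF that] by (simp add: gaussian_rv_def)
  have W2: "integrable N (\<lambda>w. (W t w)\<^sup>2)" if "t \<in> unit_cube" for t
    by (rule N.gaussian_rv_square_integrable[OF Wg[OF that] W0[OF that]])
  have W1: "integrable N (W t)" if "t \<in> unit_cube" for t
    by (rule N.square_integrable_imp_integrable[OF Wm[OF that] W2[OF that]])
  \<comment> \<open>Integrability has to be proved here, since the sheet is unbounded; products are
    dominated by sums of squares.\<close>
  have W12: "integrable N (\<lambda>w. W s w * W t w)" if st: "s \<in> unit_cube" "t \<in> unit_cube" for s t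
  proof (rule Bochner_Integration.integrable_bound)
    show "integrable N (\<lambda>w. (W s w)\<^sup>2 + (W t w)\<^sup>2)" by (intro Bochner_Integration.integrable_add W2 st)
    show "(\<lambda>w. W s w * W t w) \<in> borel_measurable N" by (intro borel_measurable_times Wm st)
    show "AE w in N. norm (W s w * W t w) \<le> norm ((W s w)\<^sup>2 + (W t w)\<^sup>2)"
    proof (rule AE_I2)
      fix w
      have "0 \<le> (\<bar>W s w\<bar> - \<bar>W t w\<bar>)\<^sup>2" by simp
      then have "2 * (\<bar>W s w\<bar> * \<bar>W t w\<bar>) \<le> (W s w)\<^sup>2 + (W t w)\<^sup>2" by (simp add: power2_diff)
      moreover have "0 \<le> \<bar>W s w\<bar> * \<bar>W t w\<bar>" by simp
      ultimately have "\<bar>W s w\<bar> * \<bar>W t w\<bar> \<le> (W s w)\<^sup>2 + (W t w)\<^sup>2" by linarith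
      then show "norm (W s w * W t w) \<le> norm ((W s w)\<^sup>2 + (W t w)\<^sup>2)" by (simp add: abs_mult)
    qed
  qed
  define X where "X w = (\<Sum>g\<in>G. a g * W (u g) w)" for w
  define c where "c t = a (the_inv_into G u t)" for t
  have "gaussian_rv N (\<lambda>w. \<Sum>t\<in>u ` G. c t * W t w)"
    using W G u unfolding brownian_sheet_def gaussian_field_def by blast
  also have "(\<lambda>w. \<Sum>t\<in>u ` G. c t * W t w) = X"
    unfolding X_def by (rule ext) (simp add: sum.reindex[OF inj] c_def the_inv_into_f_f[OF inj])
  finally have Xg: "gaussian_rv N X" .
  have X0: "(\<integral>w. X w \<partial>N) = 0"
    unfolding X_def using u by (subst Bochner_Integration.integral_sum) (auto simp: W0 intro!: integrable_mult_right W1)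
  have X2: "(\<integral>w. (X w)\<^sup>2 \<partial>N) = (\<Sum>g\<in>G. \<Sum>g'\<in>G. a g * a g' * (\<Prod>m\<in>UNIV. min (u g $ m) (u g' $ m)))"
  proof -
    have "(\<integral>w. (X w)\<^sup>2 \<partial>N) = (\<integral>w. (\<Sum>g\<in>G. \<Sum>g'\<in>G. (a g * a g') * (W (u g) w * W (u g') w)) \<partial>N)"
      by (simp add: X_def power2_eq_square sum_product mult_ac)
    also have "\<dots> = (\<Sum>g\<in>G. \<integral>w. (\<Sum>g'\<in>G. (a g * a g') * (W (u g) w * W (u g') w)) \<partial>N)"
      by (rule Bochner_Integration.integral_sum) (auto intro!: Bochner_Integration.integrable_sum integrable_mult_right W12 u)
    also have "\<dots> = (\<Sum>g\<in>G. \<Sum>g'\<in>G. \<integral>w. (a g * a g') * (W (u g) w * W (u g') w) \<partial>N)"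
      by (rule sum.cong[OF refl], rule Bochner_Integration.integral_sum) (auto intro!: integrable_mult_right W12 u)
    also have "\<dots> = (\<Sum>g\<in>G. \<Sum>g'\<in>G. a g * a g' * (\<Prod>m\<in>UNIV. min (u g $ m) (u g' $ m)))"
      by (intro sum.cong refl) (simp add: Wc u)
    finally show ?thesis .
  qed
  show ?thesis using N.gaussian_rv_cos[OF Xg X0, of b] unfolding X2 by (simp only: X_def)
qed

lemma inj_on_node: "inj_on (node j) A"
  by (rule inj_onI) (simp add: node_def vec_eq_iff)

context finitary_setup
begin

text \<open>For fixed n the paths are Lipschitz with a deterministic constant that may grow with n.
  It serves only to end the chaining at a finite depth.\<close>

lemma F_lipschitz:
  obtains B where "\<And>x s t. x \<in> X \<Longrightarrow> s \<in> unit_cube \<Longrightarrow> t \<in> unit_cube \<Longrightarrow> \<bar>F n s x - F n t x\<bar> \<le> B * l1 s t"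
proof -
  obtain D where D: "0 \<le> D" "\<And>x. x \<in> X \<Longrightarrow> \<bar>v x\<bar> \<le> D" using v_bounded by blast
  have sc: "0 \<le> scale n" by (simp add: scale_def)
  show thesis
  proof (rule that)
    fix x and s t :: "real^'d" assume x: "x \<in> X" and st: "s \<in> unit_cube" "t \<in> unit_cube"
    have "\<bar>F n s x - F n t x\<bar> = \<bar>\<Sum>i\<in>index_cube n. scale n * ((weight n s i - weight n t i) * v (shift i x))\<bar>"
      using st by (simp add: F_eq sum_subtractf[symmetric] algebra_simps)
    also have "\<dots> \<le> (\<Sum>i\<in>index_cube n. \<bar>scale n * ((weight n s i - weight n t i) * v (shift i x))\<bar>)"
      by (rule sum_abs)
    also have "\<dots> \<le> (\<Sum>i\<in>(index_cube n :: (int^'d) set). scale n * ((real n * l1 s t) * D))"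
    proof (rule sum_mono)
      fix i :: "int^'d"
      have "\<bar>weight n s i - weight n t i\<bar> \<le> (\<Sum>m\<in>UNIV. \<bar>ramp (real n * s $ m) (i $ m) - ramp (real n * t $ m) (i $ m)\<bar>)"
        by (rule weight_diff_le)
      also have "\<dots> \<le> (\<Sum>m\<in>UNIV. real n * \<bar>s $ m - t $ m\<bar>)"
      proof (rule sum_mono)
        fix m
        have "\<bar>ramp (real n * s $ m) (i $ m) - ramp (real n * t $ m) (i $ m)\<bar> \<le> \<bar>real n * s $ m - real n * t $ m\<bar>"
          by (rule ramp_lipschitz)
        then show "\<bar>ramp (real n * s $ m) (i $ m) - ramp (real n * t $ m) (i $ m)\<bar> \<le> real n * \<bar>s $ m - t $ m\<bar>"
          by (simp add: right_diff_distrib[symmetric] abs_mult)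
      qed
      also have "\<dots> = real n * l1 s t" by (simp add: l1_def sum_distrib_left)
      finally show "\<bar>scale n * ((weight n s i - weight n t i) * v (shift i x))\<bar> \<le> scale n * ((real n * l1 s t) * D)"
        unfolding abs_mult abs_of_nonneg[OF sc] using D x
        by (intro mult_left_mono mult_mono sc mult_nonneg_nonneg l1_nonneg) (auto intro: shift_X)
    qed
    also have "\<dots> = (real (card (index_cube n :: (int^'d) set)) * scale n * real n * D) * l1 s t" by simp
    finally show "\<bar>F n s x - F n t x\<bar> \<le> (real (card (index_cube n :: (int^'d) set)) * scale n * real n * D) * l1 s t" .
  qed
qed

lemma continuous_weight: "continuous_on A (\<lambda>t. weight n t i)"
  unfolding weight_def ramp_def by (intro continuous_intros)

lemma path_F_eq: "path_of (F n) = path_of (\<lambda>t x. \<Sum>i\<in>index_cube n. (scale n * weight n t i) * v (shift i x))"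
  by (rule ext) (auto simp: path_of_def restrict_def F_eq)

lemma path_F_measurable: "path_of (F n) \<in> measurable \<mu> (borel_of C_cube)"
  unfolding path_F_eq by (rule path_sum_measurable) (auto intro!: continuous_intros continuous_weight measurable_v_shift)

lemma continuous_F: "continuous_on unit_cube (\<lambda>t. F n t x)"
proof -
  have "continuous_on unit_cube (\<lambda>t. \<Sum>i\<in>index_cube n. (scale n * weight n t i) * v (shift i x))"
    by (intro continuous_intros continuous_weight)
  then show ?thesis by (simp add: F_eq cong: continuous_on_cong)
qed

text \<open>A three-step comparison for Lipschitz functionals: process and interpolation are close
  uniformly in n, interpolations converge for each fixed level j by the finite-dimensional limit
  theorem, and the interpolated sheet tends to the sheet as j grows. The level is chosen before
  n.\<close>

lemma functional_clt:
  fixes W :: "real^'d \<Rightarrow> 'w \<Rightarrow> real"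
  assumes pos: "asymp_var \<mu> v > 0" and W: "brownian_sheet N W"
  shows "conv_in_law C_cube \<mu> (\<lambda>n. path_of (F n)) N (path_of (\<lambda>t w. sqrt (asymp_var \<mu> v) * W t w))"
proof -
  define \<sigma> where "\<sigma> = sqrt (asymp_var \<mu> v)"
  have \<sigma>2: "\<sigma>\<^sup>2 = asymp_var \<mu> v" using pos by (simp add: \<sigma>_def)
  define V where "V t w = \<sigma> * W t w" for t w
  interpret N: prob_space N using W by (simp add: brownian_sheet_def)
  interpret C: Metric_space "mspace C_metric" "mdist (C_metric :: (real^'d \<Rightarrow> real) metric)"
    by (rule Metric_space_mspace_mdist)
  have top: "C_cube = C.mtopology" by (simp only: C_cube_def mtopology_of_def)
  have Wm: "W t \<in> borel_measurable N" if "t \<in> unit_cube" for t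
    using brownian_sheet_measurable[OF W that] by (simp add: gaussian_rv_def)
  have Vm: "V t \<in> borel_measurable N" if "t \<in> unit_cube" for t
    unfolding V_def using Wm[OF that] by simp
  have Vc: "continuous_on unit_cube (\<lambda>t. V t w)" if "w \<in> space N" for w
    unfolding V_def using W that by (intro continuous_intros) (simp add: brownian_sheet_def)
  define IV where "IV j = path_of (\<lambda>t w. \<Sum>i\<in>grid j. hat j i t * V (node j i) w)" for j
  define IF where "IF j n = path_of (\<lambda>t x. \<Sum>i\<in>grid j. hat j i t * F n (node j i) x)" for j n
  have IVm: "IV j \<in> measurable N (borel_of C.mtopology)" for j
    unfolding IV_def top[symmetric]
    by (rule path_sum_measurable) (auto intro: continuous_hat Vm node_in_cube)
  have IFm: "IF j n \<in> measurable \<mu> (borel_of C.mtopology)" for j n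
    unfolding IF_def top[symmetric]
    by (rule path_sum_measurable) (auto intro: continuous_hat brv_measurable[OF brv_F] node_in_cube)
  have Fm: "path_of (F n) \<in> measurable \<mu> (borel_of C.mtopology)" for n
    using path_F_measurable[of n] by (simp only: top)
  have FC: "path_of (F n) x \<in> mspace C_metric" for n x by (rule path_in_C_metric) (rule continuous_F)
  have IFC: "IF j n x \<in> mspace C_metric" for j n x
    unfolding IF_def by (rule path_in_C_metric) (intro continuous_intros continuous_hat)
  have IVC: "IV j w \<in> mspace C_metric" for j w
    unfolding IV_def by (rule path_in_C_metric) (intro continuous_intros continuous_hat)
  have VC: "path_of V w \<in> mspace C_metric" if "w \<in> space N" for w by (rule path_in_C_metric) (rule Vc[OF that])
  have IV_lim: "(\<lambda>j. mdist C_metric (IV j w) (path_of V w)) \<longlonglongrightarrow> 0" if w: "w \<in> space N" for w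
  proof (rule LIMSEQ_I)
    fix r :: real assume r: "0 < r"
    have "\<forall>\<^sub>F j in sequentially. \<forall>t\<in>unit_cube. \<bar>(\<Sum>i\<in>grid j. hat j i t * V (node j i) w) - V t w\<bar> \<le> r / 2"
      by (rule interpolation_tendsto[OF Vc[OF w]]) (use r in simp)
    then obtain j0 where j0: "\<And>j t. j \<ge> j0 \<Longrightarrow> t \<in> unit_cube \<Longrightarrow> \<bar>(\<Sum>i\<in>grid j. hat j i t * V (node j i) w) - V t w\<bar> \<le> r / 2"
      by (auto simp: eventually_sequentially)
    have "norm (mdist C_metric (IV j w) (path_of V w) - 0) < r" if "j \<ge> j0" for j
    proof -
      have "mdist C_metric (IV j w) (path_of V w) \<le> r / 2"
        by (rule mdist_C_metric_le) (use r j0[OF that] in \<open>auto simp: IV_def path_of_def\<close>)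
      then show ?thesis using r C.nonneg[of "IV j w" "path_of V w"] by simp
    qed
    then show "\<exists>no. \<forall>j\<ge>no. norm (mdist C_metric (IV j w) (path_of V w) - 0) < r" by blast
  qed
  \<comment> \<open>The path map of the limit is Borel as a pointwise limit, in sup distance, of
    interpolations of finitely many measurable values.\<close>
  have Vpm: "path_of V \<in> measurable N (borel_of C.mtopology)"
    by (rule C.measurable_limit[OF IVm VC IV_lim])
  obtain K where K: "0 \<le> K" "\<And>n s t. s \<in> unit_cube \<Longrightarrow> t \<in> unit_cube \<Longrightarrow>
    (\<integral>x. \<bar>F n t x - F n s x\<bar> ^ (4 * CARD('d)) \<partial>\<mu>) \<le> K * l1 t s ^ (2 * CARD('d))"
    using moment_increment unfolding l1_def by blast
  define D where "D = 1 + 4 ^ CARD('d) * K * real CARD('d) ^ (2 * CARD('d))"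
  define D' where "D' = D + D / (1 - nu) + 1"
  have D': "0 \<le> D'"
  proof -
    have "0 \<le> D" using K by (simp add: D_def)
    then show ?thesis using nu by (simp add: D'_def)
  qed
  obtain B2 where B2: "\<And>n t. t \<in> unit_cube \<Longrightarrow> (\<integral>x. (F n t x)\<^sup>2 \<partial>\<mu>) \<le> B2" using second_moment_F by blast
  have lipconv: "(\<lambda>n. \<integral>x. f (path_of (F n) x) \<partial>\<mu>) \<longlonglongrightarrow> (\<integral>w. f (path_of V w) \<partial>N)"
    if k: "0 \<le> k" and fB: "\<And>x. x \<in> mspace C_metric \<Longrightarrow> \<bar>f x\<bar> \<le> B"
      and lip: "\<And>x y. x \<in> mspace C_metric \<Longrightarrow> y \<in> mspace C_metric \<Longrightarrow> \<bar>f x - f y\<bar> \<le> k * mdist C_metric x y"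
    for f :: "(real^'d \<Rightarrow> real) \<Rightarrow> real" and k B
  proof (rule LIMSEQ_I)
    fix r :: real assume r: "0 < r"
    have fcont: "continuous_map C.mtopology euclideanreal f" by (rule C.lipschitz_imp_continuous_map[OF lip])
    have fm: "f \<in> borel_measurable (borel_of C.mtopology)" by (rule borel_of_continuous_measurable[OF fcont])
    have bF: "brv \<mu> (\<lambda>x. f (path_of (F n) x))" for n
      by (rule brvI[OF measurable_compose[OF Fm fm] fB[OF FC]])
    have bIF: "brv \<mu> (\<lambda>x. f (IF j n x))" for j n
      by (rule brvI[OF measurable_compose[OF IFm fm] fB[OF IFC]])
    \<comment> \<open>The Lipschitz constant of the paths depends on n, but it does not enter the
      bound on the mean of \<open>H\<close>; hence the estimate holds for all n at once.\<close>
    have bound: "\<bar>(\<integral>x. f (path_of (F n) x) \<partial>\<mu>) - (\<integral>x. f (IF j n x) \<partial>\<mu>)\<bar> \<le> k * (D' * nu ^ j)" for n j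
    proof -
      obtain L where L: "\<And>x s t. x \<in> X \<Longrightarrow> s \<in> unit_cube \<Longrightarrow> t \<in> unit_cube \<Longrightarrow> \<bar>F n s x - F n t x\<bar> \<le> L * l1 s t"
        using F_lipschitz[of n] by blast
      obtain H where H: "brv \<mu> H" "(\<integral>x. H x \<partial>\<mu>) \<le> D' * nu ^ j"
        "\<And>x t. x \<in> X \<Longrightarrow> t \<in> unit_cube \<Longrightarrow> \<bar>(\<Sum>i\<in>grid j. hat j i t * F n (node j i) x) - F n t x\<bar> \<le> H x"
        using mu.interpolation_error[of "F n" K L j, OF brv_F K(2,1), unfolded space_mu, OF _ _ _ L]
        unfolding D'_def D_def by blast
      have "\<bar>(\<integral>x. f (path_of (F n) x) \<partial>\<mu>) - (\<integral>x. f (IF j n x) \<partial>\<mu>)\<bar> = \<bar>\<integral>x. f (path_of (F n) x) - f (IF j n x) \<partial>\<mu>\<bar>"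
        by (subst Bochner_Integration.integral_diff[OF mu.brv_integrable[OF bF] mu.brv_integrable[OF bIF]]) simp
      also have "\<dots> \<le> (\<integral>x. \<bar>f (path_of (F n) x) - f (IF j n x)\<bar> \<partial>\<mu>)" by (rule integral_abs_bound)
      also have "\<dots> \<le> (\<integral>x. k * H x \<partial>\<mu>)"
      proof (rule integral_mono)
        show "integrable \<mu> (\<lambda>x. \<bar>f (path_of (F n) x) - f (IF j n x)\<bar>)"
          by (rule mu.brv_integrable[OF brv_abs[OF brv_diff[OF bF bIF]]])
        show "integrable \<mu> (\<lambda>x. k * H x)" by (rule mu.brv_integrable[OF brv_mult[OF brv_const H(1)]])
        fix x assume "x \<in> space \<mu>"
        then have x: "x \<in> X" by (simp add: space_mu)
        obtain t0 :: "real^'d" where t0: "t0 \<in> unit_cube" using unit_cube_nonempty by blast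
        have "mdist C_metric (path_of (F n) x) (IF j n x) \<le> H x"
        proof (rule mdist_C_metric_le)
          show "0 \<le> H x" using H(3)[OF x t0] by linarith
          fix t :: "real^'d" assume t: "t \<in> unit_cube"
          show "\<bar>path_of (F n) x t - IF j n x t\<bar> \<le> H x"
            using H(3)[OF x t] t by (simp add: path_of_def IF_def abs_minus_commute)
        qed
        then have "k * mdist C_metric (path_of (F n) x) (IF j n x) \<le> k * H x" using k by (rule mult_left_mono)
        with lip[OF FC IFC, of n x j n x] show "\<bar>f (path_of (F n) x) - f (IF j n x)\<bar> \<le> k * H x" by linarith
      qed
      also have "\<dots> = k * (\<integral>x. H x \<partial>\<mu>)" by simp
      also have "\<dots> \<le> k * (D' * nu ^ j)" by (rule mult_left_mono[OF H(2) k])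
      finally show ?thesis .
    qed
    have fin: "(\<lambda>n. \<integral>x. f (IF j n x) \<partial>\<mu>) \<longlonglongrightarrow> (\<integral>w. f (IV j w) \<partial>N)" for j
    proof -
      define \<Phi> where "\<Phi> z = restrict (\<lambda>t. \<Sum>i\<in>grid j. hat j i t * z i) unit_cube" for z :: "int^'d \<Rightarrow> real"
      have \<Phi>: "continuous_map euclidean C.mtopology \<Phi>"
        unfolding \<Phi>_def top[symmetric] by (rule continuous_map_path) (auto intro: continuous_hat)
      \<comment> \<open>The functional of an interpolated path is a bounded continuous function of
        the values at the grid nodes, which \<open>cramer_wold\<close> can treat.\<close>
      define g where "g z = f (\<Phi> z)" for z
      have g: "continuous_on UNIV g"
      proof -
        have "continuous_map euclidean euclideanreal (f \<circ> \<Phi>)" by (rule continuous_map_compose[OF \<Phi> fcont])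
        then have "continuous_on UNIV (f \<circ> \<Phi>)" by (simp only: continuous_map_iff_continuous2)
        then show ?thesis by (simp only: g_def[abs_def] o_def)
      qed
      have gB: "\<bar>g z\<bar> \<le> B" for z
        unfolding g_def
      proof (rule fB)
        have "\<Phi> z \<in> topspace C.mtopology"
          by (rule subsetD[OF continuous_map_image_subset_topspace[OF \<Phi>]]) simp
        then show "\<Phi> z \<in> mspace C_metric" by (simp only: C.topspace_mtopology)
      qed
      have e1: "f (IF j n x) = g (cut (grid j) (\<lambda>i. F n (node j i) x))" for n x
        by (simp add: g_def \<Phi>_def IF_def path_of_def cut_def)
      have e2: "f (IV j w) = g (cut (grid j) (\<lambda>i. V (node j i) w))" for w
        by (simp add: g_def \<Phi>_def IV_def path_of_def cut_def)
      have Vg0: "(\<integral>w. W t w \<partial>N) = 0" if "t \<in> unit_cube" for t using W that by (simp add: brownian_sheet_def)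
      have W2: "integrable N (\<lambda>w. (W t w)\<^sup>2)" if "t \<in> unit_cube" for t
        by (rule N.gaussian_rv_square_integrable[OF brownian_sheet_measurable[OF W that] Vg0[OF that]])
      have V2: "(\<integral>w. (V t w)\<^sup>2 \<partial>N) \<le> \<sigma>\<^sup>2" if t: "t \<in> unit_cube" for t
      proof -
        have "(\<integral>w. (V t w)\<^sup>2 \<partial>N) = \<sigma>\<^sup>2 * (\<integral>w. W t w * W t w \<partial>N)"
          by (simp add: V_def power_mult_distrib power2_eq_square[of "W t _"])
        also have "(\<integral>w. W t w * W t w \<partial>N) = (\<Prod>m\<in>UNIV. min (t $ m) (t $ m))"
          using W t by (simp only: brownian_sheet_def)
        also have "\<sigma>\<^sup>2 * \<dots> \<le> \<sigma>\<^sup>2 * 1"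
          using t by (intro mult_left_mono prod_le_1) (auto simp: mem_unit_cube)
        finally show ?thesis by simp
      qed
      have "(\<lambda>n. \<integral>x. g (cut (grid j) (\<lambda>i. F n (node j i) x)) \<partial>\<mu>) \<longlonglongrightarrow> (\<integral>w. g (cut (grid j) (\<lambda>i. V (node j i) w)) \<partial>N)"
      proof (rule cramer_wold[where B = "max B2 (\<sigma>\<^sup>2)" and Mg = B])
        show "prob_space \<mu>" "prob_space N" by unfold_locales
        show "finite (grid j :: (int^'d) set)" by simp
        fix n and i :: "int^'d" assume "i \<in> grid j"
        then have c: "node j i \<in> unit_cube" by (rule node_in_cube)
        show "F n (node j i) \<in> borel_measurable \<mu>" by (rule brv_measurable[OF brv_F[OF c]])
        show "V (node j i) \<in> borel_measurable N" by (rule Vm[OF c])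
        show "integrable \<mu> (\<lambda>x. (F n (node j i) x)\<^sup>2)" by (rule mu.brv_integrable[OF brv_power[OF brv_F[OF c]]])
        show "integrable N (\<lambda>w. (V (node j i) w)\<^sup>2)" unfolding V_def power_mult_distrib by (rule integrable_mult_right[OF W2[OF c]])
        show "(\<integral>x. (F n (node j i) x)\<^sup>2 \<partial>\<mu>) \<le> max B2 (\<sigma>\<^sup>2)" using B2[OF c, of n] by simp
        show "(\<integral>w. (V (node j i) w)\<^sup>2 \<partial>N) \<le> max B2 (\<sigma>\<^sup>2)" using V2[OF c] by simp
      next
        fix a :: "int^'d \<Rightarrow> real" and b
        have "(\<integral>w. cos ((\<Sum>i\<in>grid j. a i * V (node j i) w) + b) \<partial>N)
            = (\<integral>w. cos ((\<Sum>i\<in>grid j. (\<sigma> * a i) * W (node j i) w) + b) \<partial>N)"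
          by (simp add: V_def mult_ac)
        also have "\<dots> = exp (- (\<Sum>g\<in>grid j. \<Sum>g'\<in>grid j. (\<sigma> * a g) * (\<sigma> * a g') * (\<Prod>m\<in>UNIV. min (node j g $ m) (node j g' $ m))) / 2) * cos b"
          by (rule brownian_sheet_combination[OF W _ node_in_cube inj_on_node]) simp
        also have "(\<Sum>g\<in>grid j. \<Sum>g'\<in>grid j. (\<sigma> * a g) * (\<sigma> * a g') * (\<Prod>m\<in>UNIV. min (node j g $ m) (node j g' $ m)))
           = asymp_var \<mu> v * (\<Sum>g\<in>grid j. \<Sum>g'\<in>grid j. a g * a g' * (\<Prod>m\<in>UNIV. min (node j g $ m) (node j g' $ m)))"
          unfolding \<sigma>2[symmetric] by (simp add: sum_distrib_left power2_eq_square mult_ac)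
        finally show "(\<lambda>n. \<integral>x. cos ((\<Sum>i\<in>grid j. a i * F n (node j i) x) + b) \<partial>\<mu>)
            \<longlonglongrightarrow> (\<integral>w. cos ((\<Sum>i\<in>grid j. a i * V (node j i) w) + b) \<partial>N)"
          using clt_finite_dim[where G = "grid j" and u = "node j" and c = a and b = b, OF finite_grid node_in_cube pos] by simp
      qed (use g gB in auto)
      then show ?thesis by (simp only: e1 e2)
    qed
    have "(\<lambda>j. \<integral>w. f (IV j w) \<partial>N) \<longlonglongrightarrow> (\<integral>w. f (path_of V w) \<partial>N)"
    proof (rule integral_dominated_convergence[where w = "\<lambda>_. B"])
      show "(\<lambda>w. f (path_of V w)) \<in> borel_measurable N" by (rule measurable_compose[OF Vpm fm])
      show "(\<lambda>w. f (IV j w)) \<in> borel_measurable N" for j by (rule measurable_compose[OF IVm fm])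
      show "AE w in N. (\<lambda>j. f (IV j w)) \<longlonglongrightarrow> f (path_of V w)"
      proof (rule AE_I2)
        fix w assume w: "w \<in> space N"
        have "(\<lambda>j. k * mdist C_metric (IV j w) (path_of V w)) \<longlonglongrightarrow> k * 0"
          by (intro tendsto_mult tendsto_const IV_lim[OF w])
        then have l0: "(\<lambda>j. k * mdist C_metric (IV j w) (path_of V w)) \<longlonglongrightarrow> 0" by simp
        show "(\<lambda>j. f (IV j w)) \<longlonglongrightarrow> f (path_of V w)"
        proof (rule LIM_zero_cancel, rule Lim_null_comparison[OF _ l0])
          show "\<forall>\<^sub>F j in sequentially. norm (f (IV j w) - f (path_of V w)) \<le> k * mdist C_metric (IV j w) (path_of V w)"
            by (rule always_eventually) (simp only: real_norm_def lip[OF IVC VC[OF w]] simp_thms)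
        qed
      qed
      show "AE w in N. norm (f (IV j w)) \<le> B" for j
        by (rule AE_I2) (simp only: real_norm_def fB[OF IVC])
    qed simp
    then have "\<forall>\<^sub>F j in sequentially. dist (\<integral>w. f (IV j w) \<partial>N) (\<integral>w. f (path_of V w) \<partial>N) < r / 3"
      using r by (intro tendstoD) auto
    moreover have "\<forall>\<^sub>F j in sequentially. k * (D' * nu ^ j) < r / 3"
    proof -
      have "(\<lambda>j. k * (D' * nu ^ j)) \<longlonglongrightarrow> k * (D' * 0)"
        using nu by (intro tendsto_mult tendsto_const LIMSEQ_realpow_zero) auto
      then show ?thesis using r by (intro order_tendstoD(2)[where y = 0]) auto
    qed
    ultimately have "\<forall>\<^sub>F j in sequentially. dist (\<integral>w. f (IV j w) \<partial>N) (\<integral>w. f (path_of V w) \<partial>N) < r / 3 \<and> k * (D' * nu ^ j) < r / 3"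
      by eventually_elim simp
    then obtain j where j: "dist (\<integral>w. f (IV j w) \<partial>N) (\<integral>w. f (path_of V w) \<partial>N) < r / 3" "k * (D' * nu ^ j) < r / 3"
      by (auto simp: eventually_sequentially)
    from LIMSEQ_D[OF fin[of j], of "r / 3"] r obtain n0 where
      n0: "\<And>n. n \<ge> n0 \<Longrightarrow> norm ((\<integral>x. f (IF j n x) \<partial>\<mu>) - (\<integral>w. f (IV j w) \<partial>N)) < r / 3" by auto
    show "\<exists>no. \<forall>n\<ge>no. norm ((\<integral>x. f (path_of (F n) x) \<partial>\<mu>) - (\<integral>w. f (path_of V w) \<partial>N)) < r"
    proof (intro exI allI impI)
      fix n assume "n0 \<le> n"
      from n0[OF this] bound[of n j] j show "norm ((\<integral>x. f (path_of (F n) x) \<partial>\<mu>) - (\<integral>w. f (path_of V w) \<partial>N)) < r"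
        unfolding real_norm_def dist_real_def by linarith
    qed
  qed
  have "weak_conv_on C.mtopology (\<lambda>n. distr \<mu> (borel_of C.mtopology) (path_of (F n))) (distr N (borel_of C.mtopology) (path_of V))"
    unfolding weak_conv_on_def
  proof (intro allI impI, elim conjE)
    fix f :: "(real^'d \<Rightarrow> real) \<Rightarrow> real"
    assume f: "continuous_map C.mtopology euclideanreal f" and bd: "bounded (f ` topspace C.mtopology)"
    obtain B where B: "\<And>x. x \<in> mspace C_metric \<Longrightarrow> \<bar>f x\<bar> \<le> B"
      using bd unfolding bounded_iff C.topspace_mtopology by auto
    have fm: "f \<in> borel_measurable (borel_of C.mtopology)" by (rule borel_of_continuous_measurable[OF f])
    have "(\<lambda>n. \<integral>x. f (path_of (F n) x) \<partial>\<mu>) \<longlonglongrightarrow> (\<integral>w. f (path_of V w) \<partial>N)"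
      by (rule C.weak_convergence_lipschitz[OF mu.prob_space_axioms N.prob_space_axioms Fm Vpm lipconv f B])
    then show "(\<lambda>n. \<integral>x. f x \<partial>distr \<mu> (borel_of C.mtopology) (path_of (F n))) \<longlonglongrightarrow> (\<integral>x. f x \<partial>distr N (borel_of C.mtopology) (path_of V))"
      by (simp only: integral_distr[OF Fm fm] integral_distr[OF Vpm fm])
  qed
  then show ?thesis
    unfolding conv_in_law_def top using Fm Vpm unfolding V_def \<sigma>_def by blast
qed

end

theorem theorem2p4:
  fixes X :: "(int^'d::finite \<Rightarrow> 'a::{finite, discrete_topology}) set"
    and \<mu> :: "(int^'d \<Rightarrow> 'a) measure"
    and \<tau> :: "'l topology" and L :: "'l measure"
    and Y :: "(int^'d \<Rightarrow> 'l) set"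
    and \<pi> :: "(int^'d \<Rightarrow> 'l) \<Rightarrow> (int^'d \<Rightarrow> 'a)"
    and R :: "(int^'d \<Rightarrow> 'l) \<Rightarrow> nat"
    and v :: "(int^'d \<Rightarrow> 'a) \<Rightarrow> real"
    and p s :: real
    and N :: "'w measure" and W :: "real^'d \<Rightarrow> 'w \<Rightarrow> real"
  assumes "subshift X" and "invariant_prob X \<mu>"
    and "finitary_factor \<tau> L Y \<mu> \<pi> R"
    and "continuous_on X v" and "(\<integral>x. v x \<partial>\<mu>) = 0"
    and "p \<ge> real CARD('d) - 1"
    and "s > 2 * (real CARD('d))^2 + (real CARD('d))^2 / (p + 1)"
    and "p_regular X p v"
    and "(\<integral>\<^sup>+y. ennreal (real (R y) powr s) \<partial>(restrict_space (iid_measure L) Y)) < \<infinity>"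
    and "asymp_var \<mu> v > 0"
    and "brownian_sheet N W"
  shows "conv_in_law C_cube
           \<mu> (\<lambda>n. path_of (\<lambda>t x. real n powr (- real CARD('d) / 2) * W_proc v n t x))
           N (path_of (\<lambda>t w. sqrt (asymp_var \<mu> v) * W t w))"
proof -
  interpret finitary_setup X \<mu> \<tau> L Y \<pi> R v p s
    using assms(1-9) by (rule finitary_setup.intro)
  show ?thesis
    using functional_clt[OF assms(10,11)] by (simp only: F_def[abs_def] scale_def)
qed

end
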